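(* Let $\beta>0$, let $\mathbf{s}_j=(x'_j,y'_j)$, $j=1,\dots,N_S$, and $\mathbf{t}_l=(x_l,y_l)$, $l=1,\dots,N_T$, be sources and targets in the unit cell $\mathcal{C}$, and let $\mathbf{P}_2^{south},\mathbf{P}_2^{north}$ be the $N_T\times N_S$ block matrices with $2\times2$ blocks $\mathbf{P}_2^{south}(l,j)=\mathbf{K}_2^{south}(\mathbf{t}_l,\mathbf{s}_j)$, $\mathbf{P}_2^{north}(l,j)=\mathbf{K}_2^{north}(\mathbf{t}_l,\mathbf{s}_j)$ for the modified Stokes equations. Given a precision $0<\epsilon<1$, let $$M=\left\lceil\frac{d}{2\pi\eta}\log\left(\frac{1}{1-e^{-2\pi\eta/d}}\,\frac1\epsilon\right)\right\rceil ,$$ and for $m=-M,\dots,M$ let $$\alpha_m=\frac{2\pi m}{d},\quad \chi_m=\sqrt{\alpha_m^2+\beta^2},\quad Q_m^{(\beta)}=\chi_m\eta-i\alpha_m\xi,\quad Q_m=|\alpha_m|\eta-i\alpha_m\xi .$$ Let $\mathbf{I}_2$ be the $2\times2$ identity and define block matrices with $2\times2$ blocks by $$\mathbf{L}_\beta^{south}(l,m)=e^{-\chi_m y_l}e^{i\alpha_m x_l}\mathbf{I}_2,\qquad \mathbf{L}_\beta^{north}(l,m)=e^{\chi_m y_l}e^{i\alpha_m x_l}\mathbf{I}_2,$$ $$\mathbf{L}^{south}(l,m)=e^{-|\alpha_m|y_l}e^{i\alpha_m x_l}\mathbf{I}_2,\qquad \mathbf{L}^{north}(l,m)=e^{|\alpha_m|y_l}e^{i\alpha_m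 x_l}\mathbf{I}_2,$$ $$\mathbf{R}_\beta^{south}(m,j)=e^{\chi_m y'_j}e^{-i\alpha_m x'_j}\mathbf{I}_2,\qquad \mathbf{R}_\beta^{north}(m,j)=e^{-\chi_m y'_j}e^{-i\alpha_m x'_j}\mathbf{I}_2,$$ $$\mathbf{R}^{south}(m,j)=e^{|\alpha_m|y'_j}e^{-i\alpha_m x'_j}\mathbf{I}_2,\qquad \mathbf{R}^{north}(m,j)=e^{-|\alpha_m|y'_j}e^{-i\alpha_m x'_j}\mathbf{I}_2,$$ and block diagonal matrices with $2\times2$ diagonal blocks by $$\mathbf{D}_\beta^{south}(m,m)=\frac{1}{2\beta^2d}\frac{e^{-2Q_m^{(\beta)}}}{1-e^{-Q_m^{(\beta)}}}\begin{pmatrix}\chi_m&i\alpha_m\\ i\alpha_m&-\alpha_m^2/\chi_m\end{pmatrix},\qquad \mathbf{D}_\beta^{north}(m,m)=\overline{\mathbf{D}_\beta^{south}(m,m)},$$ $$\mathbf{D}^{south}(m,m)=\frac{1}{2\beta^2d}\frac{e^{-2Q_m}}{1-e^{-Q_m}}\begin{pmatrix}-|\alpha_m|&-i\alpha_m\\ -i\alpha_m&|\alpha_m|\end{pmatrix}\ (m\ne0),\quad \mathbf{D}^{south}(0,0)=0,\qquad \mathbf{D}^{north}(m,m)=\overline{\mathbf{D}^{south}(m,m)}.$$ Then $$\mathbf{P}_2^{south}=\mathbf{L}_\beta^{south}\mathbf{D}_\beta^{south}\mathbf{R}_\beta^{south}+\mathbf{L}^{south}\mathbf{D}^{south}\mathbf{R}^{south}+O(\epsilon),$$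 $$\mathbf{P}_2^{north}=\mathbf{L}_\beta^{north}\mathbf{D}_\beta^{north}\mathbf{R}_\beta^{north}+\mathbf{L}^{north}\mathbf{D}^{north}\mathbf{R}^{north}+O(\epsilon).$$
   Context: Let $d,\eta>0$ and $\xi\in\mathbb{R}$ with $d\ge\sqrt{\xi^2+\eta^2}$, $\mathbf{e}_1=(d,0)$, $\mathbf{e}_2=(\xi,\eta)$, $\mathcal{C}=\{x_1\mathbf{e}_1+x_2\mathbf{e}_2 : x_1,x_2\in[-\tfrac12,\tfrac12]\}$, $\mathbf{l}_{mn}=m\mathbf{e}_1+n\mathbf{e}_2$. The modified Stokeslet (fundamental solution of $(\beta^2-\Delta)\mathbf{u}+\nabla p=0$, $\nabla\cdot\mathbf{u}=0$) is, for $\mathbf{t}=(x,y)\neq0$, $$\mathbf{G}^{(\mathrm{MS})}(\mathbf{t})=\begin{pmatrix}-\partial_{yy}&\partial_{xy}\\ \partial_{xy}&-\partial_{xx}\end{pmatrix}G_{\mathrm{MB}}(\mathbf{t}),\qquad G_{\mathrm{MB}}(\mathbf{t})=-\frac{1}{2\pi\beta^2}\left[K_0(\beta|\mathbf{t}|)-\log(1/|\mathbf{t}|)\right],$$ with $K_0$ the modified Bessel function of the second kind. The kernels are the iterated sums (inner sum over $m$ first) $$\mathbf{K}_2^{south}(\mathbf{t},\mathbf{s})=\sum_{n=-\infty}^{-2}\ \sum_{m=-\infty}^{\infty}\mathbf{G}^{(\mathrm{MS})}(\mathbf{t}-(\mathbf{s}+\mathbf{l}_{mn})),\qquad \mathbf{K}_2^{north}(\mathbf{t},\mathbf{s})=\sum_{n=2}^{\infty}\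 \sum_{m=-\infty}^{\infty}\mathbf{G}^{(\mathrm{MS})}(\mathbf{t}-(\mathbf{s}+\mathbf{l}_{mn})).$$ Block indices: $l=1,\dots,N_T$, $m=-M,\dots,M$, $j=1,\dots,N_S$. The bar denotes complex conjugation. $O(\epsilon)$ denotes a matrix all of whose entries are bounded in absolute value by $C\epsilon$, with $C$ independent of $\epsilon$ and of the number and locations of sources and targets ($C$ may depend on $d,\xi,\eta,\beta$). *)

theory Defs
  imports "HOL-Analysis.Analysis"
begin

section \<open>The modified Stokeslet\<close>

text \<open>Modified Bessel function of the second kind of order zero, by its classical integral
  representation (DLMF 10.32.9 with order 0), which is valid for \<open>x > 0\<close>.\<close>

definition Bessel_K0 :: "real \<Rightarrow> real" where
  "Bessel_K0 x = (LBINT t:{0..}. exp (- x * cosh t))"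

definition mat2 :: "'a::zero \<Rightarrow> 'a \<Rightarrow> 'a \<Rightarrow> 'a \<Rightarrow> 'a^2^2" where
  "mat2 a b c d = vector [vector [a, b], vector [c, d]]"

definition pderiv_at :: "2 \<Rightarrow> (real^2 \<Rightarrow> real) \<Rightarrow> real^2 \<Rightarrow> real" where
  "pderiv_at k f t = deriv (\<lambda>h. f (t + h *\<^sub>R axis k 1)) 0"

definition G_MB :: "real \<Rightarrow> real^2 \<Rightarrow> real" where
  "G_MB \<beta> t = - 1 / (2 * pi * \<beta>\<^sup>2) * (Bessel_K0 (\<beta> * norm t) - ln (1 / norm t))"

definition G_MS :: "real \<Rightarrow> real^2 \<Rightarrow> real^2^2" where
  "G_MS \<beta> t = mat2
     (- pderiv_at 2 (pderiv_at 2 (G_MB \<beta>)) t) (pderiv_at 1 (pderiv_at 2 (G_MB \<beta>)) t)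
     (pderiv_at 1 (pderiv_at 2 (G_MB \<beta>)) t) (- pderiv_at 1 (pderiv_at 1 (G_MB \<beta>)) t)"


section \<open>Lattice, unit cell and periodic kernels\<close>

definition e1 :: "real \<Rightarrow> real^2" where
  "e1 d = vector [d, 0]"

definition e2 :: "real \<Rightarrow> real \<Rightarrow> real^2" where
  "e2 \<xi> \<eta> = vector [\<xi>, \<eta>]"

definition unit_cell :: "real \<Rightarrow> real \<Rightarrow> real \<Rightarrow> (real^2) set" where
  "unit_cell d \<xi> \<eta> = {x1 *\<^sub>R e1 d + x2 *\<^sub>R e2 \<xi> \<eta> | x1 x2. x1 \<in> {-1/2..1/2} \<and> x2 \<in> {-1/2..1/2}}"

definition lattice_pt :: "real \<Rightarrow> real \<Rightarrow> real \<Rightarrow> int \<Rightarrow> int \<Rightarrow> real^2" where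
  "lattice_pt d \<xi> \<eta> m n = of_int m *\<^sub>R e1 d + of_int n *\<^sub>R e2 \<xi> \<eta>"

text \<open>Since \<open>y - y' - n\<eta>\<close> never vanishes for points of the unit cell and \<open>\<bar>n\<bar> \<ge> 2\<close>, the singularity
  of the Stokeslet is avoided; its entries decay like \<open>m\<^sup>-\<^sup>2\<close> along a row, so that the inner sums
  are absolutely convergent, and the row sums decay exponentially in \<open>\<bar>n\<bar>\<close>. Unordered sums
  therefore render the iterated series.\<close>

definition K2_south :: "real \<Rightarrow> real \<Rightarrow> real \<Rightarrow> real \<Rightarrow> real^2 \<Rightarrow> real^2 \<Rightarrow> real^2^2" where
  "K2_south d \<xi> \<eta> \<beta> t s =
     (\<Sum>\<^sub>\<infinity>n\<in>{..-2}. \<Sum>\<^sub>\<infinity>m\<in>UNIV. G_MS \<beta> (t - (s + lattice_pt d \<xi> \<eta> m n)))"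

definition K2_north :: "real \<Rightarrow> real \<Rightarrow> real \<Rightarrow> real \<Rightarrow> real^2 \<Rightarrow> real^2 \<Rightarrow> real^2^2" where
  "K2_north d \<xi> \<eta> \<beta> t s =
     (\<Sum>\<^sub>\<infinity>n\<in>{2..}. \<Sum>\<^sub>\<infinity>m\<in>UNIV. G_MS \<beta> (t - (s + lattice_pt d \<xi> \<eta> m n)))"


section \<open>Block matrices with 2 by 2 complex blocks\<close>

text \<open>A block matrix is a function from the block indices to its blocks; the index ranges are
  supplied where they matter, namely in the product and in the entrywise bound. (Numbers of
  sources and targets are quantified inside the scope of the constant of the \<open>O(\<epsilon>)\<close> term and so
  cannot be types.)\<close>

type_synonym ('i, 'j) bmat = "'i \<Rightarrow> 'j \<Rightarrow> complex^2^2"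

definition block_mult :: "'k set \<Rightarrow> ('i, 'k) bmat \<Rightarrow> ('k, 'j) bmat \<Rightarrow> ('i, 'j) bmat" where
  "block_mult K A B = (\<lambda>i j. \<Sum>k\<in>K. A i k ** B k j)"

definition block_diag :: "('k \<Rightarrow> complex^2^2) \<Rightarrow> ('k, 'k) bmat" where
  "block_diag D = (\<lambda>k k'. if k = k' then D k else 0)"

definition entries_bounded :: "'i set \<Rightarrow> 'j set \<Rightarrow> real \<Rightarrow> ('i, 'j) bmat \<Rightarrow> bool" where
  "entries_bounded I J b E \<longleftrightarrow> (\<forall>i\<in>I. \<forall>j\<in>J. \<forall>p q. cmod (E i j $ p $ q) \<le> b)"

definition cscale :: "complex \<Rightarrow> complex^2^2 \<Rightarrow> complex^2^2" where
  "cscale c A = (\<chi> p q. c * A $ p $ q)"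

definition mat_cnj :: "complex^2^2 \<Rightarrow> complex^2^2" where
  "mat_cnj A = (\<chi> p q. cnj (A $ p $ q))"

definition mat_of_real :: "real^2^2 \<Rightarrow> complex^2^2" where
  "mat_of_real A = (\<chi> p q. complex_of_real (A $ p $ q))"

definition P2_south ::
  "real \<Rightarrow> real \<Rightarrow> real \<Rightarrow> real \<Rightarrow> (nat \<Rightarrow> real^2) \<Rightarrow> (nat \<Rightarrow> real^2) \<Rightarrow> (nat, nat) bmat" where
  "P2_south d \<xi> \<eta> \<beta> t s = (\<lambda>l j. mat_of_real (K2_south d \<xi> \<eta> \<beta> (t l) (s j)))"

definition P2_north ::
  "real \<Rightarrow> real \<Rightarrow> real \<Rightarrow> real \<Rightarrow> (nat \<Rightarrow> real^2) \<Rightarrow> (nat \<Rightarrow> real^2) \<Rightarrow> (nat, nat) bmat" where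
  "P2_north d \<xi> \<eta> \<beta> t s = (\<lambda>l j. mat_of_real (K2_north d \<xi> \<eta> \<beta> (t l) (s j)))"


section \<open>The factors of the low-rank decomposition\<close>

definition trunc_M :: "real \<Rightarrow> real \<Rightarrow> real \<Rightarrow> int" where
  "trunc_M d \<eta> \<epsilon> = \<lceil>d / (2 * pi * \<eta>) * ln (1 / (1 - exp (- 2 * pi * \<eta> / d)) * (1 / \<epsilon>))\<rceil>"

definition alpha :: "real \<Rightarrow> int \<Rightarrow> real" where
  "alpha d m = 2 * pi * of_int m / d"

definition chi :: "real \<Rightarrow> real \<Rightarrow> int \<Rightarrow> real" where
  "chi d \<beta> m = sqrt ((alpha d m)\<^sup>2 + \<beta>\<^sup>2)"

definition Q_beta :: "real \<Rightarrow> real \<Rightarrow> real \<Rightarrow> real \<Rightarrow> int \<Rightarrow> complex" where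
  "Q_beta d \<xi> \<eta> \<beta> m = of_real (chi d \<beta> m * \<eta>) - \<i> * of_real (alpha d m * \<xi>)"

definition Q :: "real \<Rightarrow> real \<Rightarrow> real \<Rightarrow> int \<Rightarrow> complex" where
  "Q d \<xi> \<eta> m = of_real (\<bar>alpha d m\<bar> * \<eta>) - \<i> * of_real (alpha d m * \<xi>)"

definition L_beta_south :: "real \<Rightarrow> real \<Rightarrow> (nat \<Rightarrow> real^2) \<Rightarrow> (nat, int) bmat" where
  "L_beta_south d \<beta> t = (\<lambda>l m. cscale
     (of_real (exp (- chi d \<beta> m * t l $ 2)) * exp (\<i> * of_real (alpha d m * t l $ 1))) (mat 1))"

definition L_beta_north :: "real \<Rightarrow> real \<Rightarrow> (nat \<Rightarrow> real^2) \<Rightarrow> (nat, int) bmat" where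
  "L_beta_north d \<beta> t = (\<lambda>l m. cscale
     (of_real (exp (chi d \<beta> m * t l $ 2)) * exp (\<i> * of_real (alpha d m * t l $ 1))) (mat 1))"

definition L_south :: "real \<Rightarrow> (nat \<Rightarrow> real^2) \<Rightarrow> (nat, int) bmat" where
  "L_south d t = (\<lambda>l m. cscale
     (of_real (exp (- \<bar>alpha d m\<bar> * t l $ 2)) * exp (\<i> * of_real (alpha d m * t l $ 1))) (mat 1))"

definition L_north :: "real \<Rightarrow> (nat \<Rightarrow> real^2) \<Rightarrow> (nat, int) bmat" where
  "L_north d t = (\<lambda>l m. cscale
     (of_real (exp (\<bar>alpha d m\<bar> * t l $ 2)) * exp (\<i> * of_real (alpha d m * t l $ 1))) (mat 1))"

definition R_beta_south :: "real \<Rightarrow> real \<Rightarrow> (nat \<Rightarrow> real^2) \<Rightarrow> (int, nat) bmat" where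
  "R_beta_south d \<beta> s = (\<lambda>m j. cscale
     (of_real (exp (chi d \<beta> m * s j $ 2)) * exp (- \<i> * of_real (alpha d m * s j $ 1))) (mat 1))"

definition R_beta_north :: "real \<Rightarrow> real \<Rightarrow> (nat \<Rightarrow> real^2) \<Rightarrow> (int, nat) bmat" where
  "R_beta_north d \<beta> s = (\<lambda>m j. cscale
     (of_real (exp (- chi d \<beta> m * s j $ 2)) * exp (- \<i> * of_real (alpha d m * s j $ 1))) (mat 1))"

definition R_south :: "real \<Rightarrow> (nat \<Rightarrow> real^2) \<Rightarrow> (int, nat) bmat" where
  "R_south d s = (\<lambda>m j. cscale
     (of_real (exp (\<bar>alpha d m\<bar> * s j $ 2)) * exp (- \<i> * of_real (alpha d m * s j $ 1))) (mat 1))"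

definition R_north :: "real \<Rightarrow> (nat \<Rightarrow> real^2) \<Rightarrow> (int, nat) bmat" where
  "R_north d s = (\<lambda>m j. cscale
     (of_real (exp (- \<bar>alpha d m\<bar> * s j $ 2)) * exp (- \<i> * of_real (alpha d m * s j $ 1))) (mat 1))"

definition D_beta_south_block :: "real \<Rightarrow> real \<Rightarrow> real \<Rightarrow> real \<Rightarrow> int \<Rightarrow> complex^2^2" where
  "D_beta_south_block d \<xi> \<eta> \<beta> m = cscale
     (of_real (1 / (2 * \<beta>\<^sup>2 * d)) *
        (exp (- 2 * Q_beta d \<xi> \<eta> \<beta> m) / (1 - exp (- Q_beta d \<xi> \<eta> \<beta> m))))
     (mat2 (of_real (chi d \<beta> m)) (\<i> * of_real (alpha d m))
           (\<i> * of_real (alpha d m)) (of_real (- (alpha d m)\<^sup>2 / chi d \<beta> m)))"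

definition D_south_block :: "real \<Rightarrow> real \<Rightarrow> real \<Rightarrow> real \<Rightarrow> int \<Rightarrow> complex^2^2" where
  "D_south_block d \<xi> \<eta> \<beta> m = (if m = 0 then 0 else cscale
     (of_real (1 / (2 * \<beta>\<^sup>2 * d)) * (exp (- 2 * Q d \<xi> \<eta> m) / (1 - exp (- Q d \<xi> \<eta> m))))
     (mat2 (of_real (- \<bar>alpha d m\<bar>)) (- \<i> * of_real (alpha d m))
           (- \<i> * of_real (alpha d m)) (of_real \<bar>alpha d m\<bar>)))"

definition D_beta_south :: "real \<Rightarrow> real \<Rightarrow> real \<Rightarrow> real \<Rightarrow> (int, int) bmat" where
  "D_beta_south d \<xi> \<eta> \<beta> = block_diag (D_beta_south_block d \<xi> \<eta> \<beta>)"

definition D_beta_north :: "real \<Rightarrow> real \<Rightarrow> real \<Rightarrow> real \<Rightarrow> (int, int) bmat" where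
  "D_beta_north d \<xi> \<eta> \<beta> = block_diag (\<lambda>m. mat_cnj (D_beta_south_block d \<xi> \<eta> \<beta> m))"

definition D_south :: "real \<Rightarrow> real \<Rightarrow> real \<Rightarrow> real \<Rightarrow> (int, int) bmat" where
  "D_south d \<xi> \<eta> \<beta> = block_diag (D_south_block d \<xi> \<eta> \<beta>)"

definition D_north :: "real \<Rightarrow> real \<Rightarrow> real \<Rightarrow> real \<Rightarrow> (int, int) bmat" where
  "D_north d \<xi> \<eta> \<beta> = block_diag (\<lambda>m. mat_cnj (D_south_block d \<xi> \<eta> \<beta> m))"

definition LDR :: "int \<Rightarrow> (nat, int) bmat \<Rightarrow> (int, int) bmat \<Rightarrow> (int, nat) bmat \<Rightarrow> (nat, nat) bmat" where
  "LDR M L D R = block_mult {-M..M} (block_mult {-M..M} L D) R"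

end

theory Submission
  imports Defs
begin

text \<open>For \<open>y > 0\<close>, rotating the contour of the defining integral gives
  \<open>2 K\<^sub>0(\<beta> r) = \<integral> exp (- \<beta> (y cosh u - \<i> x sinh u)) du\<close>, which the substitution \<open>k = \<beta> sinh u\<close> turns
  into a Fourier integral in \<open>x\<close> with density \<open>e\<^bsup>-\<chi>(k) y\<^esup> / \<chi>(k)\<close>, \<open>\<chi>(k) = sqrt (k\<^sup>2 + \<beta>\<^sup>2)\<close>. Hence the
  entries of the Stokeslet are Fourier integrals in \<open>x\<close>, the logarithm contributing the same
  expressions with \<open>\<beta> = 0\<close>. Poisson summation along a row of the lattice replaces the row sum by a
  sum over the frequencies \<open>\<alpha>\<^sub>m\<close>, and the sum over the rows \<open>n \<le> -2\<close> is a geometric series for every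
  fixed \<open>m\<close>; this produces the low-rank factors. In the tail \<open>\<bar>m\<bar> > M\<close> the two parts must not be
  estimated separately: each has size \<open>\<bar>\<alpha>\<^sub>m\<bar> e\<^bsup>-\<bar>\<alpha>\<^sub>m\<bar> y\<^esup>\<close>, which would only give \<open>O(\<epsilon> log (1/\<epsilon>))\<close>, but
  since \<open>\<chi>(k) - \<bar>k\<bar> \<le> \<beta>\<^sup>2 / \<bar>k\<bar>\<close> the factor \<open>\<bar>\<alpha>\<^sub>m\<bar>\<close> cancels in their difference. The kernel is even, so
  the northern sum is the southern one with sources and targets exchanged.\<close>

section \<open>Integrals over the real line\<close>

text \<open>The density to be summed has a corner at frequency 0, inherited from
  \<open>\<bar>k\<bar> * exp (- \<bar>k\<bar> * y)\<close>, so its transform decays only like the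
  inverse square of x. The Poisson formula is therefore set up for densities with exponential decay
  and a weighted Lipschitz bound; it identifies limits of symmetric partial sums, and unordered
  summability of each row is derived separately from explicit transforms. For the Bessel part this
  decay comes from rotational invariance: the integral at (x, y) has the modulus of the one at (0,
  r). The two infinite sums are never exchanged in full. For the finitely many frequencies up to M
  the rows are summed exactly; the tail is estimated inside each row and then summed over the rows.
  Two points of the cell differ by at most \<eta> in the second coordinate, so row n is at vertical
  distance at least (\<bar>n\<bar> - 1) \<eta>. The nearest row has n = -2 and distance at least
  \<eta>; this fixes the decay rate w = 2 \<pi> \<eta> / d per frequency, and the factor 1 / (1 -
  exp(-w)) in M pays for summing the geometric tail.\<close>

lemma integrable_exp_minus_abs:
  fixes c :: real
  assumes "c > 0"
  shows "integrable lborel (\<lambda>x::real. exp (- c * \<bar>x\<bar>))"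
proof -
  let ?f = "\<lambda>x::real. indicator {0..} x *\<^sub>R exp (- c * x)"
  have "(\<lambda>x. exp (- c * x)) absolutely_integrable_on {0..}"
    using has_integral_exp_minus_to_infinity[OF assms, of 0]
    by (intro nonnegative_absolutely_integrable_1) (auto simp: integrable_on_def)
  then have f: "integrable lborel ?f"
    unfolding set_integrable_def by (subst (asm) integrable_completion) auto
  then have f': "integrable lborel (\<lambda>x. ?f (0 + (-1) * x))"
    by (intro lborel_integrable_real_affine) auto
  show ?thesis
    by (rule Bochner_Integration.integrable_bound[OF Bochner_Integration.integrable_add[OF f f']])
       (auto simp: indicator_def)
qed

lemma integral_deriv_vanishing_at_infinity:
  fixes F f :: "real \<Rightarrow> complex"
  assumes "\<And>x. (F has_vector_derivative f x) (at x)" "continuous_on UNIV f" "integrable lborel f"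
    and "(F \<longlongrightarrow> 0) at_top" "(F \<longlongrightarrow> 0) at_bot"
  shows "(LBINT x. f x) = 0"
proof -
  have "(LBINT x=-\<infinity>..\<infinity>. f x) = 0 - 0"
    using assms
    by (intro interval_integral_FTC_integrable)
       (auto simp: continuous_on_eq_continuous_at set_integrable_def ereal_tendsto_simps1)
  then show ?thesis
    by (simp add: interval_integral_to_infinity_eq interval_lebesgue_integral_def set_lebesgue_integral_def)
qed

lemma has_vector_derivative_at_iff_quotient:
  "(F has_vector_derivative D) (at p) \<longleftrightarrow> ((\<lambda>q. (F q - F p) /\<^sub>R (q - p)) \<longlongrightarrow> D) (at p)"
proof -
  have "(F has_vector_derivative D) (at p) \<longleftrightarrow>
      ((\<lambda>q. norm (F q - F p - (q - p) *\<^sub>R D) / norm (q - p)) \<longlongrightarrow> 0) (at p)"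
    by (simp add: has_vector_derivative_def has_derivative_iff_norm bounded_linear_scaleR_left)
  also have "\<dots> \<longleftrightarrow> ((\<lambda>q. norm ((F q - F p) /\<^sub>R (q - p) - D)) \<longlongrightarrow> 0) (at p)"
  proof (intro filterlim_cong refl, unfold eventually_at_filter, intro always_eventually allI impI)
    fix q assume "q \<noteq> p"
    then have "(F q - F p) /\<^sub>R (q - p) - D = (F q - F p - (q - p) *\<^sub>R D) /\<^sub>R (q - p)"
      by (simp add: scaleR_diff_right)
    then show "norm (F q - F p - (q - p) *\<^sub>R D) / norm (q - p) = norm ((F q - F p) /\<^sub>R (q - p) - D)"
      by (simp add: divide_inverse_commute)
  qed
  also have "\<dots> \<longleftrightarrow> ((\<lambda>q. (F q - F p) /\<^sub>R (q - p)) \<longlongrightarrow> D) (at p)"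
    by (simp only: tendsto_norm_zero_iff LIM_zero_iff)
  finally show ?thesis .
qed

text \<open>The mean value inequality bounds the difference quotients by \<open>g\<close>, so
  dominated convergence applies along every sequence tending to \<open>p0\<close>.\<close>

lemma has_vector_derivative_integral:
  fixes f :: "real \<Rightarrow> 'a \<Rightarrow> complex"
  assumes \<delta>: "\<delta> > 0"
    and f: "\<And>p. p \<in> ball p0 \<delta> \<Longrightarrow> integrable M (f p)"
    and f': "\<And>p u. p \<in> ball p0 \<delta> \<Longrightarrow> u \<in> space M \<Longrightarrow> ((\<lambda>p. f p u) has_vector_derivative f' p u) (at p)"
    and g: "\<And>p u. p \<in> ball p0 \<delta> \<Longrightarrow> u \<in> space M \<Longrightarrow> norm (f' p u) \<le> g u"
    and int: "integrable M g"
  shows "((\<lambda>p. \<integral>u. f p u \<partial>M) has_vector_derivative (\<integral>u. f' p0 u \<partial>M)) (at p0)"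
proof -
  have lim: "((\<lambda>p. (f p u - f p0 u) /\<^sub>R (p - p0)) \<longlongrightarrow> f' p0 u) (at p0)" if "u \<in> space M" for u
    using f'[of p0 u] \<delta> that by (simp add: has_vector_derivative_at_iff_quotient)
  have bnd: "norm ((f p u - f p0 u) /\<^sub>R (p - p0)) \<le> g u" if "p \<in> ball p0 \<delta>" "p \<noteq> p0" "u \<in> space M" for p u
  proof -
    have "norm (f p u - f p0 u) \<le> g u * norm (p - p0)"
    proof (rule differentiable_bound[where S="ball p0 \<delta>" and f'="\<lambda>p h. h *\<^sub>R f' p u"])
      show "((\<lambda>p. f p u) has_derivative (\<lambda>h. h *\<^sub>R f' q u)) (at q within ball p0 \<delta>)" if "q \<in> ball p0 \<delta>" for q
        using f'[OF that \<open>u \<in> space M\<close>] unfolding has_vector_derivative_def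
        by (rule has_derivative_at_withinI)
      show "onorm (\<lambda>h. h *\<^sub>R f' q u) \<le> g u" if "q \<in> ball p0 \<delta>" for q
        using g[OF that \<open>u \<in> space M\<close>] by (intro onorm_le) (simp add: mult.commute mult_left_mono)
    qed (use \<delta> that in auto)
    then show ?thesis using that by (simp add: divide_inverse_commute[symmetric] pos_divide_le_eq)
  qed
  show ?thesis
    unfolding has_vector_derivative_at_iff_quotient tendsto_at_iff_sequentially comp_def
  proof (intro allI impI)
    fix X :: "nat \<Rightarrow> real" assume X: "\<forall>i. X i \<in> UNIV - {p0}" "X \<longlonglongrightarrow> p0"
    then have "\<forall>\<^sub>F n in sequentially. X n \<in> ball p0 \<delta>"
      using \<delta> by (auto simp: tendsto_iff dist_commute)
    then obtain N where N: "\<And>n. n \<ge> N \<Longrightarrow> X n \<in> ball p0 \<delta>"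
      by (auto simp: eventually_sequentially)
    have N': "X (n + N) \<in> ball p0 \<delta>" "X (n + N) \<noteq> p0" for n
      using N[of "n + N"] X by auto
    have p0: "integrable M (f p0)" using f \<delta> by simp
    have X': "(\<lambda>n. X (n + N)) \<longlonglongrightarrow> p0" using X by (simp add: LIMSEQ_ignore_initial_segment)
    have lim': "(\<lambda>n. (f (X (n + N)) u - f p0 u) /\<^sub>R (X (n + N) - p0)) \<longlonglongrightarrow> f' p0 u" if "u \<in> space M" for u
      using lim[OF that, unfolded tendsto_at_iff_sequentially comp_def, rule_format, of "\<lambda>n. X (n + N)"] X' N'
      by simp
    have meas: "(\<lambda>u. (f (X (n + N)) u - f p0 u) /\<^sub>R (X (n + N) - p0)) \<in> borel_measurable M" for n
      using f[OF N'(1)[of n]] p0 by simp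
    \<comment> \<open>The shift by \<open>N\<close> puts all terms of the sequence into the ball.
      Measurability of \<open>f' p0\<close> comes from its being the pointwise limit of the
      difference quotients.\<close>
    have "(\<lambda>n. \<integral>u. (f (X (n + N)) u - f p0 u) /\<^sub>R (X (n + N) - p0) \<partial>M) \<longlonglongrightarrow> (\<integral>u. f' p0 u \<partial>M)"
      by (rule integral_dominated_convergence[where w=g])
         (use int bnd N' lim' in \<open>auto intro!: borel_measurable_LIMSEQ_metric[OF meas] meas\<close>)
    also have "(\<lambda>n. \<integral>u. (f (X (n + N)) u - f p0 u) /\<^sub>R (X (n + N) - p0) \<partial>M) =
       (\<lambda>n. ((\<integral>u. f (X (n + N)) u \<partial>M) - (\<integral>u. f p0 u \<partial>M)) /\<^sub>R (X (n + N) - p0))"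
      using f[OF N'(1)] p0 by (intro ext) (subst integral_scaleR_right, subst Bochner_Integration.integral_diff, auto)
    finally show "(\<lambda>n. ((\<integral>u. f (X n) u \<partial>M) - (\<integral>u. f p0 u \<partial>M)) /\<^sub>R (X n - p0)) \<longlonglongrightarrow> (\<integral>u. f' p0 u \<partial>M)"
      by (rule LIMSEQ_offset)
  qed
qed

section \<open>Poisson summation\<close>

lemma summable_on_int_even:
  fixes f :: "nat \<Rightarrow> real"
  assumes "summable f" "\<And>n. f n \<ge> 0"
  shows "(\<lambda>m::int. f (nat \<bar>m\<bar>)) summable_on UNIV"
proof -
  have f: "f summable_on UNIV"
    using assms by (auto intro!: norm_summable_imp_summable_on)
  have 1: "(\<lambda>m::int. f (nat \<bar>m\<bar>)) summable_on range int"
    using f by (subst summable_on_reindex) (auto simp: comp_def)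
  have 2: "(\<lambda>m::int. f (nat \<bar>m\<bar>)) summable_on range (\<lambda>n. - int n)"
    using f by (subst summable_on_reindex) (auto simp: comp_def inj_on_def)
  have "range int \<union> range (\<lambda>n. - int n) = UNIV"
    by (auto simp: image_iff) (metis int_cases2)
  with summable_on_union[OF 1 2] show ?thesis by simp
qed

lemma summable_on_exp_minus_abs_int:
  fixes c :: real
  assumes "c > 0"
  shows "(\<lambda>m::int. exp (- c * \<bar>of_int m\<bar>)) summable_on UNIV"
proof -
  have "summable (\<lambda>n. exp (- c) ^ n)"
    using assms by (intro summable_geometric) auto
  from summable_on_int_even[OF this] show ?thesis
    by (simp flip: exp_of_nat_mult) (simp add: mult.commute)
qed

text \<open>Every finite set of integers lies in some \<open>{- int N..int N}\<close>, so these
  intervals are cofinal among the finite sets. The converse fails, which is why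
  \<open>Poisson_summation\<close> takes unordered summability as a separate hypothesis.\<close>

lemma has_sum_int_symmetric_limit:
  fixes f :: "int \<Rightarrow> 'a :: {comm_monoid_add, topological_space}"
  assumes "(f has_sum s) UNIV"
  shows "(\<lambda>N. \<Sum>m\<in>{- int N..int N}. f m) \<longlonglongrightarrow> s"
proof -
  have "filterlim (\<lambda>N. {- int N..int N}) (finite_subsets_at_top UNIV) sequentially"
    unfolding filterlim_iff eventually_finite_subsets_at_top
  proof (intro allI impI, elim exE conjE)
    fix P and X :: "int set"
    assume X: "finite X" "\<forall>Y. finite Y \<and> X \<subseteq> Y \<and> Y \<subseteq> UNIV \<longrightarrow> P Y"
    then obtain k where k: "\<And>x. x \<in> X \<Longrightarrow> \<bar>x\<bar> \<le> k"
      using bdd_above_finite[of "abs ` X"] by (auto simp: bdd_above_def)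
    have "X \<subseteq> {- int N..int N}" if "N \<ge> nat k" for N
    proof
      fix x assume "x \<in> X"
      from k[OF this] that show "x \<in> {- int N..int N}" unfolding atLeastAtMost_iff by linarith
    qed
    then show "\<forall>\<^sub>F N in sequentially. P {- int N..int N}"
      unfolding eventually_sequentially using X(2) by (meson finite_atLeastAtMost_int subset_UNIV)
  qed
  then show ?thesis
    using assms unfolding has_sum_def by (rule filterlim_compose[rotated])
qed

lemma sum_int_telescope:
  fixes u :: "int \<Rightarrow> 'a :: ab_group_add"
  shows "(\<Sum>m\<in>{- int N..int N}. u m - u (m + 1)) = u (- int N) - u (int N + 1)"
proof (induction N)
  case (Suc N)
  have "(\<Sum>m\<in>{- int (Suc N)..int (Suc N)}. u m - u (m + 1)) =
      (\<Sum>m\<in>insert (- int N - 1) (insert (int N + 1) {- int N..int N}). u m - u (m + 1))"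
    by (intro sum.cong) auto
  also have "\<dots> = u (- int N - 1) - u (- int N) + (u (int N + 1) - u (2 + int N)) + (u (- int N) - u (int N + 1))"
    by (simp add: Suc add.commute)
  also have "\<dots> = u (- int N - 1) - u (2 + int N)" by simp
  also have "- int N - 1 = - int (Suc N)" by simp
  also have "2 + int N = int (Suc N) + 1" by simp
  finally show ?case .
qed simp

section \<open>Riemann-Lebesgue lemma for exponentially bounded functions\<close>

lemma borel_measurable_cis_mult[measurable]: "(\<lambda>x. cis (a * x)) \<in> borel_measurable borel" for a :: real
  by (intro borel_measurable_continuous_onI continuous_intros)

lemma integrable_exp_bounded:
  fixes f :: "real \<Rightarrow> 'a :: {banach, second_countable_topology}"
  assumes "f \<in> borel_measurable borel" "c > 0" "\<And>x. norm (f x) \<le> C * exp (- c * \<bar>x\<bar>)"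
  shows "integrable lborel f"
  by (rule Bochner_Integration.integrable_bound[OF integrable_mult_right[OF integrable_exp_minus_abs[OF assms(2)], of C]])
     (use assms(1) order_trans[OF assms(3) abs_ge_self] in auto)

text \<open>Translation by \<open>\<pi> / A n\<close> changes the sign of the oscillating factor, so the integral is half of an
  integral against \<open>H x - H (x + \<pi> / A n)\<close>, which tends to \<open>0\<close> by dominated convergence.\<close>

lemma Riemann_Lebesgue_exp_bounded:
  fixes H :: "real \<Rightarrow> complex" and A :: "nat \<Rightarrow> real"
  assumes H[measurable]: "H \<in> borel_measurable borel"
    and c: "c > 0" and bound: "\<And>x. norm (H x) \<le> C * exp (- c * \<bar>x\<bar>)"
    and cont: "AE x in lborel. isCont H x"
    and A: "\<And>n. \<bar>A n\<bar> \<ge> pi" "filterlim A at_infinity sequentially"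
  shows "(\<lambda>n. LBINT x. H x * cis (A n * x)) \<longlonglongrightarrow> 0"
proof -
  have C: "C \<ge> 0" using bound[of 0] norm_ge_zero[of "H 0"] by (simp del: norm_ge_zero)
  define \<delta> where "\<delta> n = pi / A n" for n
  have A0: "A n \<noteq> 0" for n using A(1)[of n] pi_gt_zero by linarith
  have \<delta>1: "\<bar>\<delta> n\<bar> \<le> 1" for n using A(1)[of n] A0[of n] by (simp add: \<delta>_def)
  have \<delta>0: "\<delta> \<longlonglongrightarrow> 0"
    unfolding \<delta>_def by (intro tendsto_divide_0[OF tendsto_const] A)
  let ?w = "\<lambda>x. C * exp c * exp (- c * \<bar>x\<bar>)"
  \<comment> \<open>A translation by at most 1 costs the factor \<open>exp c\<close>. The hypothesis
    \<open>\<bar>A n\<bar> \<ge> pi\<close> keeps every \<open>\<delta> n\<close> in this range, so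
    that the dominating function does not depend on \<open>n\<close>.\<close>
  have bound': "norm (H (x + h)) \<le> ?w x" if "\<bar>h\<bar> \<le> 1" for x h
  proof -
    have "c * \<bar>x\<bar> \<le> c * (1 + \<bar>x + h\<bar>)" using that c by (intro mult_left_mono) auto
    then have "exp (- c * \<bar>x + h\<bar>) \<le> exp c * exp (- c * \<bar>x\<bar>)"
      by (simp add: algebra_simps flip: exp_add)
    from mult_left_mono[OF this C] bound[of "x + h"] show ?thesis by (simp add: mult_ac)
  qed
  have w: "integrable lborel ?w"
    using integrable_exp_minus_abs[OF c] by simp
  have [measurable]: "(\<lambda>x. H (x + h)) \<in> borel_measurable borel" for h
    by (rule measurable_compose[OF _ H]) simp
  have int: "integrable lborel (\<lambda>x. H (x + h) * cis (a * x))" if "\<bar>h\<bar> \<le> 1" for h a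
    by (rule integrable_exp_bounded[OF _ c, where C="C * exp c"]) (simp_all add: norm_mult bound'[OF that, simplified])
  have half: "(LBINT x. H x * cis (A n * x)) = (LBINT x. (H x - H (x + \<delta> n)) * cis (A n * x)) / 2" for n
  proof -
    have "(LBINT x. H x * cis (A n * x)) = (LBINT x. H (\<delta> n + 1 * x) * cis (A n * (\<delta> n + 1 * x)))"
      by (subst lborel_integral_real_affine[where c=1 and t="\<delta> n"]) auto
    also have "\<dots> = (LBINT x. - (H (x + \<delta> n) * cis (A n * x)))"
      using A0[of n] by (intro Bochner_Integration.integral_cong)
        (auto simp: \<delta>_def ring_distribs add.commute simp flip: cis_mult)
    also have "\<dots> = - (LBINT x. H (x + \<delta> n) * cis (A n * x))" by simp
    finally have *: "(LBINT x. H x * cis (A n * x)) = - (LBINT x. H (x + \<delta> n) * cis (A n * x))" .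
    have "(LBINT x. (H x - H (x + \<delta> n)) * cis (A n * x)) =
       (LBINT x. H x * cis (A n * x)) - (LBINT x. H (x + \<delta> n) * cis (A n * x))"
      using int[of 0 "A n"] int[OF \<delta>1, of n "A n"]
      by (subst Bochner_Integration.integral_diff[symmetric]) (auto simp: algebra_simps)
    then show ?thesis using * by simp
  qed
  have "(\<lambda>n. LBINT x. (H x - H (x + \<delta> n)) * cis (A n * x)) \<longlonglongrightarrow> (LBINT x::real. 0)"
  proof (rule integral_dominated_convergence[where w="\<lambda>x. 2 * ?w x"])
    show "integrable lborel (\<lambda>x. 2 * ?w x)" using w by simp
    show "AE x in lborel. norm ((H x - H (x + \<delta> n)) * cis (A n * x)) \<le> 2 * ?w x" for n
    proof (intro AE_I2)
      fix x
      have "norm (H x - H (x + \<delta> n)) \<le> norm (H x) + norm (H (x + \<delta> n))" by (rule norm_triangle_ineq4)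
      then show "norm ((H x - H (x + \<delta> n)) * cis (A n * x)) \<le> 2 * ?w x"
        using bound'[of 0 x] bound'[OF \<delta>1, of x n] by (simp add: norm_mult)
    qed
    show "AE x in lborel. (\<lambda>n. (H x - H (x + \<delta> n)) * cis (A n * x)) \<longlonglongrightarrow> 0"
      using cont
    proof eventually_elim
      case (elim x)
      have "(\<lambda>n. x + \<delta> n) \<longlonglongrightarrow> x" using tendsto_add[OF tendsto_const[of x] \<delta>0] by simp
      with elim have "(\<lambda>n. H (x + \<delta> n)) \<longlonglongrightarrow> H x" by (rule isCont_tendsto_compose)
      then have "(\<lambda>n. H x - H (x + \<delta> n)) \<longlonglongrightarrow> 0"
        using tendsto_diff[OF tendsto_const[of "H x"]] by fastforce
      then have "(\<lambda>n. norm ((H x - H (x + \<delta> n)) * cis (A n * x))) \<longlonglongrightarrow> 0"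
        by (simp add: norm_mult tendsto_norm_zero_iff)
      then show ?case by (simp only: tendsto_norm_zero_iff)
    qed
  qed auto
  then show ?thesis unfolding half by (intro tendsto_eq_intros) auto
qed

text \<open>The cubic Taylor bound leaves an error of at most \<open>\<bar>x\<bar> ^ 3 / 6\<close>,
  and \<open>\<bar>x\<bar> ^ 2 \<le> 3\<close> on this range makes that at most half of
  \<open>\<bar>x\<bar>\<close>.\<close>

lemma abs_sin_ge_half_abs:
  fixes x :: real
  assumes "\<bar>x\<bar> \<le> pi / 2"
  shows "\<bar>sin x\<bar> \<ge> \<bar>x\<bar> / 2"
proof -
  have "\<bar>sin x - (\<Sum>m<3. sin_coeff m * x ^ m)\<bar> \<le> inverse (fact 3) * \<bar>x\<bar> ^ 3"
    by (rule Maclaurin_sin_bound)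
  then have 1: "\<bar>sin x - x\<bar> \<le> \<bar>x\<bar> ^ 3 / 6"
    by (simp add: sin_coeff_def eval_nat_numeral fact_numeral)
  have "\<bar>x\<bar> \<le> 1.6" using assms pi_less_4 pi_approx by simp
  then have "\<bar>x\<bar> ^ 2 \<le> 1.6 ^ 2" by (intro power_mono) auto
  then have "\<bar>x\<bar> * \<bar>x\<bar> ^ 2 \<le> \<bar>x\<bar> * 3" by (intro mult_left_mono) (auto simp: power2_eq_square)
  then have "\<bar>x\<bar> ^ 3 \<le> \<bar>x\<bar> * 3" by (simp add: eval_nat_numeral)
  with 1 show ?thesis by linarith
qed

text \<open>Orthogonality of the characters over one period: for a nonzero frequency the primitive
  has period 1.\<close>

lemma integral_cis_unit_interval:
  fixes a :: real and m :: int
  shows "(LBINT x. indicator {a..a + 1} x *\<^sub>R cis (2 * pi * of_int m * x)) = (if m = 0 then 1 else 0)"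
proof (cases "m = 0")
  case False
  let ?F = "\<lambda>x. cis (2 * pi * of_int m * x) / (\<i> * of_real (2 * pi * of_int m))"
  have "(LBINT x. indicator {a..a + 1} x *\<^sub>R cis (2 * pi * of_int m * x)) = ?F (a + 1) - ?F a"
  proof (rule integral_FTC_Icc)
    show "(?F has_vector_derivative cis (2 * pi * of_int m * x)) (at x within {a..a + 1})" for x
      unfolding cis_conv_exp using False
      by (auto intro!: derivative_eq_intros has_vector_derivative_real_field simp: field_simps)
  qed (auto intro!: continuous_intros)
  also have "\<dots> = 0"
  proof -
    have "cis (2 * pi * of_int m) = 1" by (rule cis_multiple_2pi) auto
    then have "cis (2 * pi * of_int m * a) = cis (2 * pi * of_int m * a) * cis (2 * pi * of_int m)" by simp
    also have "\<dots> = cis (2 * pi * of_int m * (a + 1))" unfolding cis_mult by (simp add: ring_distribs)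
    finally show ?thesis by simp
  qed
  finally show ?thesis using False by simp
qed simp

text \<open>Subtract from \<open>g\<close> the step function \<open>g (rd x)\<close>, where \<open>rd\<close> rounds to the nearest integer: its
  transform vanishes at the nonzero integers and is \<open>\<Sum> g(j)\<close> at \<open>0\<close>. The difference is
  \<open>H x * (1 - cis (2\<pi>x))\<close> with an integrable \<open>H\<close>, so that the sum of its transform over
  \<open>{-N..N}\<close> telescopes.\<close>

lemma Poisson_summation_symmetric:
  fixes g :: "real \<Rightarrow> complex"
  assumes c: "c > 0" and bound: "\<And>x. norm (g x) \<le> C * exp (- c * \<bar>x\<bar>)"
    and lip: "\<And>x h. \<bar>h\<bar> \<le> 1 / 2 \<Longrightarrow> norm (g (x + h) - g x) \<le> C * exp (- c * \<bar>x\<bar>) * \<bar>h\<bar>"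
  shows "(\<lambda>N. \<Sum>m\<in>{- int N..int N}. LBINT x. g x * cis (2 * pi * of_int m * x))
           \<longlonglongrightarrow> (\<Sum>\<^sub>\<infinity>j. g (of_int j))"
proof -
  have C: "C \<ge> 0" using bound[of 0] norm_ge_zero[of "g 0"] by (simp del: norm_ge_zero)
  have cont: "isCont g x" for x
  proof -
    have "((\<lambda>h. g (x + h) - g x) \<longlongrightarrow> 0) (at 0)"
    proof (rule Lim_null_comparison)
      show "((\<lambda>h. C * exp (- c * \<bar>x\<bar>) * \<bar>h\<bar>) \<longlongrightarrow> 0) (at 0)"
        by (rule tendsto_eq_intros refl | simp)+
      show "\<forall>\<^sub>F h in at 0. norm (g (x + h) - g x) \<le> C * exp (- c * \<bar>x\<bar>) * \<bar>h\<bar>"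
        unfolding eventually_at using lip[of _ x] by (intro exI[of _ "1/2"]) auto
    qed
    then show ?thesis unfolding isCont_iff by (rule LIM_zero_cancel)
  qed
  have g_meas[measurable]: "g \<in> borel_measurable borel"
    using cont by (intro borel_measurable_continuous_onI) (simp add: continuous_at_imp_continuous_on)
  define rd where "rd x = real_of_int \<lfloor>x + 1 / 2\<rfloor>" for x :: real
  have rd_meas[measurable]: "rd \<in> borel_measurable borel" unfolding rd_def by measurable
  have rd: "\<bar>x - rd x\<bar> \<le> 1 / 2" for x unfolding rd_def by linarith
  have exp_rd: "exp (- c * \<bar>rd x\<bar>) \<le> exp (c / 2) * exp (- c * \<bar>x\<bar>)" for x
  proof -
    have "c * \<bar>x\<bar> \<le> c * (1 / 2 + \<bar>rd x\<bar>)" using rd[of x] c by (intro mult_left_mono) linarith+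
    then show ?thesis by (simp add: algebra_simps flip: exp_add)
  qed
  let ?w = "\<lambda>x. C * exp (c / 2) * exp (- c * \<bar>x\<bar>)"
  have w: "integrable lborel ?w" using integrable_exp_minus_abs[OF c] by simp
  have bound_rd: "norm (g (rd x)) \<le> ?w x" for x
    using order_trans[OF bound mult_left_mono[OF exp_rd C]] by (simp add: mult_ac)
  have int_rd: "integrable lborel (\<lambda>x. g (rd x) * cis (a * x))" for a
    by (rule integrable_exp_bounded[OF _ c, where C="C * exp (c / 2)"]) (simp_all add: norm_mult bound_rd[simplified])
  have int_g: "integrable lborel (\<lambda>x. g x * cis (a * x))" for a
    by (rule integrable_exp_bounded[OF _ c, where C=C]) (simp_all add: norm_mult bound[simplified])
  have sum_g: "(\<lambda>j. g (of_int j)) summable_on UNIV"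
    by (rule abs_summable_summable,
        rule summable_on_comparison_test[OF summable_on_cmult_right[OF summable_on_exp_minus_abs_int[OF c], of C]])
       (simp_all only: bound norm_ge_zero)
  define G where "G x = g x - g (rd x)" for x
  define H where "H x = G x / (1 - cis (2 * pi * x))" for x
  have [measurable]: "G \<in> borel_measurable borel" "H \<in> borel_measurable borel"
    unfolding H_def[abs_def] G_def[abs_def] by measurable
  \<comment> \<open>With the integer \<open>rd x\<close> as base point of the Lipschitz bound,
    \<open>G\<close> vanishes linearly at the integers, exactly where
    \<open>1 - cis (2 * pi * x)\<close> has its simple zeros; the quotient \<open>H\<close> stays
    bounded.\<close>
  have G_le: "norm (G x) \<le> ?w x * \<bar>x - rd x\<bar>" for x
  proof -
    have "norm (G x) \<le> C * exp (- c * \<bar>rd x\<bar>) * \<bar>x - rd x\<bar>"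
      using lip[of "x - rd x" "rd x"] rd[of x] by (simp add: G_def)
    also have "\<dots> \<le> ?w x * \<bar>x - rd x\<bar>"
      using mult_left_mono[OF exp_rd C] by (intro mult_right_mono) (simp_all add: mult_ac)
    finally show ?thesis .
  qed
  have cis_rd: "cis (2 * pi * x) = cis (2 * pi * (x - rd x))" for x
  proof -
    have "cis (2 * pi * rd x) = 1" unfolding rd_def by (rule cis_multiple_2pi) auto
    then show ?thesis by (simp add: right_diff_distrib flip: cis_divide)
  qed
  have den: "norm (1 - cis (2 * pi * x)) \<ge> 2 * \<bar>x - rd x\<bar>" for x
  proof -
    have "norm (1 - cis (2 * pi * x)) = norm (exp (\<i> * of_real (2 * pi * (x - rd x))) - 1)"
      by (subst cis_rd) (simp add: cis_conv_exp norm_minus_commute)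
    also have "\<dots> = 2 * \<bar>sin (pi * (x - rd x))\<bar>"
      by (subst dist_exp_i_1) simp
    also have "\<dots> \<ge> 2 * (\<bar>pi * (x - rd x)\<bar> / 2)"
      using rd[of x] by (intro mult_left_mono abs_sin_ge_half_abs) (auto simp: abs_mult)
    also have "2 * (\<bar>pi * (x - rd x)\<bar> / 2) = pi * \<bar>x - rd x\<bar>" by (simp add: abs_mult)
    also have "pi * \<bar>x - rd x\<bar> \<ge> 2 * \<bar>x - rd x\<bar>"
      using pi_ge_two by (intro mult_right_mono) auto
    finally show ?thesis .
  qed
  have H_le: "norm (H x) \<le> (C * exp (c / 2)) * exp (- c * \<bar>x\<bar>)" for x
  proof (cases "x = rd x")
    case True
    then show ?thesis using C by (simp add: H_def G_def)
  next
    case False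
    have "norm (H x) \<le> (?w x * \<bar>x - rd x\<bar>) / (2 * \<bar>x - rd x\<bar>)"
      unfolding H_def norm_divide using False den[of x] G_le[of x] C
      by (intro frac_le) auto
    also have "\<dots> = ?w x / 2" using False by simp
    also have "\<dots> \<le> ?w x" using C by simp
    finally show ?thesis by simp
  qed
  \<comment> \<open>At the integers both sides are 0: \<open>G\<close> vanishes, and
    \<open>H\<close> is 0 by the convention on division by 0.\<close>
  have GH: "G x = H x * (1 - cis (2 * pi * x))" for x
  proof (cases "x = rd x")
    case True
    then show ?thesis by (simp add: H_def G_def)
  next
    case False
    then have "1 - cis (2 * pi * x) \<noteq> 0" using den[of x] by auto
    then show ?thesis by (simp add: H_def)
  qed
  have int_H: "integrable lborel (\<lambda>x. H x * cis (a * x))" for a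
    by (rule integrable_exp_bounded[OF _ c, where C="C * exp (c / 2)"]) (simp_all add: norm_mult H_le[simplified])
  define \<Phi> where "\<Phi> m = (LBINT x. H x * cis (2 * pi * of_int m * x))" for m :: int
  \<comment> \<open>Continuity can fail only at the zeros of the denominator, the integers, and at
    the jumps of \<open>rd\<close>, the odd multiples of 1/2; both lie in the countable set of
    halves of integers.\<close>
  have contH: "AE x in lborel. isCont H x"
  proof (rule AE_I')
    show "range (\<lambda>n::int. of_int n / 2 :: real) \<in> null_sets lborel"
      by (intro countable_imp_null_set_lborel countable_image) auto
    show "{x \<in> space lborel. \<not> isCont H x} \<subseteq> range (\<lambda>n::int. of_int n / 2 :: real)"
    proof (intro subsetI, rule ccontr)
      fix x assume x: "x \<in> {x \<in> space lborel. \<not> isCont H x}" "x \<notin> range (\<lambda>n::int. of_int n / 2 :: real)"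
      have x1: "x + 1 / 2 \<notin> \<int>"
      proof
        assume "x + 1 / 2 \<in> \<int>"
        then obtain n where "x + 1 / 2 = of_int n" by (auto elim: Ints_cases)
        then have "x = of_int (2 * n - 1) / 2" by simp
        with x(2) show False by blast
      qed
      have x2: "x \<noteq> rd x"
      proof
        assume "x = rd x"
        then have "x = of_int (2 * \<lfloor>x + 1 / 2\<rfloor>) / 2" by (simp add: rd_def)
        with x(2) show False by blast
      qed
      have ev: "\<forall>\<^sub>F y in nhds x. rd y = rd x"
      proof -
        have "((\<lambda>y. y + 1 / 2) \<longlongrightarrow> x + 1 / 2) (nhds x)"
          by (intro tendsto_intros) (simp add: tendsto_ident_at filterlim_ident)
        from eventually_floor_eq[OF this x1] show ?thesis by (simp add: rd_def)
      qed
      have "1 - cis (2 * pi * x) \<noteq> 0" using den[of x] x2 by auto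
      then have "isCont (\<lambda>y. (g y - g (rd x)) / (1 - cis (2 * pi * y))) x"
        unfolding cis_conv_exp by (intro continuous_intros cont) auto
      moreover have *: "\<forall>\<^sub>F y in nhds x. H y = (g y - g (rd x)) / (1 - cis (2 * pi * y))"
        using ev by eventually_elim (simp add: H_def G_def)
      ultimately have "isCont H x" by (simp only: isCont_cong[OF *])
      with x(1) show False by simp
    qed
  qed
  have lim: "LIM n sequentially. 2 * pi * (real n + 1) :> at_top"
  proof (rule filterlim_at_top_mono[OF filterlim_real_sequentially], intro always_eventually allI)
    fix n
    have "1 * (real n + 1) \<le> 2 * pi * (real n + 1)" using pi_ge_two by (intro mult_right_mono) auto
    then show "real n \<le> 2 * pi * (real n + 1)" by (rule order_trans[rotated]) simp
  qed
  have nle: "pi \<le> 2 * pi * (real n + 1)" for n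
    using mult_left_mono[of 1 "2 * (real n + 1)" pi] pi_ge_zero by simp
  \<comment> \<open>The successor skips frequency 0, which would violate the lower bound
    \<open>pi\<close> required by \<open>Riemann_Lebesgue_exp_bounded\<close>.\<close>
  have "(\<lambda>n. \<Phi> (- int (Suc n))) \<longlonglongrightarrow> 0"
    unfolding \<Phi>_def by (rule Riemann_Lebesgue_exp_bounded[OF _ c H_le contH]) (use lim nle in \<open>auto simp: filterlim_at_infinity_conv_norm_at_top abs_mult add.commute[of 1]\<close>)
  then have \<Phi>1: "(\<lambda>n. \<Phi> (- int n)) \<longlonglongrightarrow> 0" by (rule LIMSEQ_imp_Suc)
  have \<Phi>2: "(\<lambda>n. \<Phi> (int n + 1)) \<longlonglongrightarrow> 0"
    unfolding \<Phi>_def by (rule Riemann_Lebesgue_exp_bounded[OF _ c H_le contH]) (use lim nle in \<open>auto simp: filterlim_at_infinity_conv_norm_at_top abs_mult add.commute[of 1]\<close>)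
  have G_int: "(LBINT x. G x * cis (2 * pi * of_int m * x)) = \<Phi> m - \<Phi> (m + 1)" for m
  proof -
    have "(LBINT x. G x * cis (2 * pi * of_int m * x)) =
      (LBINT x. H x * cis (2 * pi * of_int m * x) - H x * cis (2 * pi * of_int (m + 1) * x))"
    proof (intro Bochner_Integration.integral_cong refl)
      fix x
      have "cis (2 * pi * of_int (m + 1) * x) = cis (2 * pi * x) * cis (2 * pi * of_int m * x)"
        unfolding cis_mult by (simp add: ring_distribs add.commute)
      then show "G x * cis (2 * pi * of_int m * x) = 
          H x * cis (2 * pi * of_int m * x) - H x * cis (2 * pi * of_int (m + 1) * x)"
        by (simp only: GH ring_distribs mult_1_right mult.assoc)
    qed
    then show ?thesis unfolding \<Phi>_def
      by (subst (asm) Bochner_Integration.integral_diff) (auto intro: int_H)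
  qed
  \<comment> \<open>The step function is constant on each cell \<open>rd x = of_int j\<close>, and
    \<open>?P j\<close> is its restriction to that cell. Each cell has length 1, so only frequency 0
    survives; the cells are put together by dominated convergence.\<close>
  have S_int: "(LBINT x. g (rd x) * cis (2 * pi * of_int m * x)) = (if m = 0 then \<Sum>\<^sub>\<infinity>j. g (of_int j) else 0)" for m
  proof -
    let ?P = "\<lambda>j x. if rd x = of_int j then g (rd x) * cis (2 * pi * of_int m * x) else 0"
    have eq: "(\<Sum>j\<in>{- int N..int N}. ?P j x) =
        (if rd x \<in> {- real N..real N} then g (rd x) * cis (2 * pi * of_int m * x) else 0)" for N x
    proof -
      have "(\<Sum>j\<in>{- int N..int N}. ?P j x) = (\<Sum>j\<in>{- int N..int N}. if \<lfloor>x + 1 / 2\<rfloor> = j then g (rd x) * cis (2 * pi * of_int m * x) else 0)"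
        by (intro sum.cong refl) (simp add: rd_def)
      also have "\<dots> = (if \<lfloor>x + 1 / 2\<rfloor> \<in> {- int N..int N} then g (rd x) * cis (2 * pi * of_int m * x) else 0)"
        by (subst sum.delta') auto
      also have "\<lfloor>x + 1 / 2\<rfloor> \<in> {- int N..int N} \<longleftrightarrow> rd x \<in> {- real N..real N}"
        unfolding rd_def atLeastAtMost_iff by linarith
      finally show ?thesis .
    qed
    have P_int: "integrable lborel (?P j)" for j
      by (rule Bochner_Integration.integrable_bound[OF int_rd[of "2 * pi * of_int m"]]) auto
    have P_val: "(LBINT x. ?P j x) = (if m = 0 then g (of_int j) else 0)" for j
    proof -
      have "(LBINT x. ?P j x) = (LBINT x. g (of_int j) * (indicator {of_int j - 1 / 2..of_int j - 1 / 2 + 1} x *\<^sub>R cis (2 * pi * of_int m * x)))"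
      proof (rule integral_cong_AE)
        \<comment> \<open>The cell is half-open and the interval closed; they differ in this one
          point.\<close>
        have "AE x in lborel. x \<noteq> of_int j + 1 / 2" by (rule AE_lborel_singleton)
        then show "AE x in lborel. ?P j x = g (of_int j) * (indicator {of_int j - 1 / 2..of_int j - 1 / 2 + 1} x *\<^sub>R cis (2 * pi * of_int m * x))"
        proof eventually_elim
          case (elim x)
          have "rd x = of_int j \<longleftrightarrow> x \<in> {of_int j - 1 / 2..of_int j - 1 / 2 + 1}"
            using elim unfolding rd_def atLeastAtMost_iff of_int_eq_iff floor_eq_iff by linarith
          then show ?case by (auto simp: indicator_def)
        qed
      qed auto
      then show ?thesis by (simp only: integral_mult_right_zero integral_cis_unit_interval) simp
    qed
    have "(\<lambda>N. LBINT x. \<Sum>j\<in>{- int N..int N}. ?P j x) \<longlonglongrightarrow> (LBINT x. g (rd x) * cis (2 * pi * of_int m * x))"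
    proof (rule integral_dominated_convergence[OF _ _ w])
      show "AE x in lborel. (\<lambda>N. \<Sum>j\<in>{- int N..int N}. ?P j x) \<longlonglongrightarrow> g (rd x) * cis (2 * pi * of_int m * x)"
      proof (intro AE_I2 tendsto_eventually)
        fix x
        have "(\<Sum>j\<in>{- int N..int N}. ?P j x) = g (rd x) * cis (2 * pi * of_int m * x)" if "N \<ge> nat \<lceil>\<bar>rd x\<bar>\<rceil>" for N
          unfolding eq using that by (auto; linarith)
        then show "\<forall>\<^sub>F N in sequentially. (\<Sum>j\<in>{- int N..int N}. ?P j x) = g (rd x) * cis (2 * pi * of_int m * x)"
          unfolding eventually_sequentially by blast
      qed
      show "AE x in lborel. norm (\<Sum>j\<in>{- int N..int N}. ?P j x) \<le> ?w x" for N
        unfolding eq using bound_rd C by (auto simp: norm_mult)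
    qed measurable
    moreover have "(LBINT x. \<Sum>j\<in>{- int N..int N}. ?P j x) = (\<Sum>j\<in>{- int N..int N}. if m = 0 then g (of_int j) else 0)" for N
      using P_int by (subst Bochner_Integration.integral_sum) (auto simp only: P_val)
    moreover have "(\<lambda>N. \<Sum>j\<in>{- int N..int N}. if m = 0 then g (of_int j) else 0) \<longlonglongrightarrow>
        (if m = 0 then \<Sum>\<^sub>\<infinity>j. g (of_int j) else 0)"
      using has_sum_int_symmetric_limit[OF has_sum_infsum[OF sum_g]] by auto
    ultimately show ?thesis using LIMSEQ_unique by fastforce
  qed
  have "(\<Sum>m\<in>{- int N..int N}. LBINT x. g x * cis (2 * pi * of_int m * x)) =
     (\<Phi> (- int N) - \<Phi> (int N + 1)) + (\<Sum>\<^sub>\<infinity>j. g (of_int j))" for N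
  proof -
    have "(LBINT x. g x * cis (2 * pi * of_int m * x)) = (\<Phi> m - \<Phi> (m + 1)) + (if m = 0 then \<Sum>\<^sub>\<infinity>j. g (of_int j) else 0)" for m
      unfolding G_int[symmetric] S_int[symmetric]
      by (subst Bochner_Integration.integral_add[symmetric])
         (auto simp: G_def left_diff_distrib intro!: int_g int_rd)
    then show ?thesis
      by (simp add: sum.distrib sum_int_telescope)
  qed
  then show ?thesis
    using tendsto_add[OF tendsto_diff[OF \<Phi>1 \<Phi>2] tendsto_const[of "\<Sum>\<^sub>\<infinity>j. g (of_int j)"]] by simp
qed

lemma norm_cis_diff_le: "norm (cis a - cis b) \<le> \<bar>a - b\<bar>"
proof -
  have "cis a - cis b = cis b * (exp (\<i> * of_real (a - b)) - 1)"
    by (simp add: right_diff_distrib cis_conv_exp flip: exp_add)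
  then have "norm (cis a - cis b) = norm (exp (\<i> * of_real (a - b)) - 1)"
    by (simp add: norm_mult)
  also have "\<dots> = 2 * \<bar>sin ((a - b) / 2)\<bar>" by (rule dist_exp_i_1)
  also have "\<dots> \<le> \<bar>a - b\<bar>" using abs_sin_x_le_abs_x[of "(a - b) / 2"] by simp
  finally show ?thesis .
qed

text \<open>Rescaling the frequency by \<open>w = 2 * pi / d\<close> reduces this to the unit
  lattice, with the phase \<open>cis (w * k * x)\<close> absorbed into the density. Symmetric
  partial sums identify the value, and \<open>summable\<close> makes it the value of the unordered
  sum.\<close>

theorem Poisson_summation:
  fixes h :: "real \<Rightarrow> complex" and d :: real
  assumes d: "d > 0" and c: "c > 0"
    and bound: "\<And>k. norm (h k) \<le> C * exp (- c * \<bar>k\<bar>)"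
    and lip: "\<And>k t. \<bar>t\<bar> \<le> pi / d \<Longrightarrow> norm (h (k + t) - h k) \<le> C * exp (- c * \<bar>k\<bar>) * \<bar>t\<bar>"
    and summable: "(\<lambda>m::int. LBINT k. h k * cis (k * (x - of_int m * d))) summable_on UNIV"
  shows "(\<lambda>j::int. h (2 * pi * of_int j / d) * cis (2 * pi * of_int j / d * x)) summable_on UNIV"
    and "((\<lambda>m::int. LBINT k. h k * cis (k * (x - of_int m * d))) has_sum
            of_real (2 * pi / d) * (\<Sum>\<^sub>\<infinity>j::int. h (2 * pi * of_int j / d) * cis (2 * pi * of_int j / d * x))) UNIV"
proof -
  have C: "C \<ge> 0" using bound[of 0] norm_ge_zero[of "h 0"] by (simp del: norm_ge_zero)
  define w where "w = 2 * pi / d"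
  have w: "w > 0" using d by (simp add: w_def)
  define g where "g k = h (w * k) * cis (w * k * x)" for k
  \<comment> \<open>In the product rule, \<open>w\<close> comes from rescaling the Lipschitz bound
    of \<open>h\<close> and \<open>w * \<bar>x\<bar>\<close> from the phase; the 1 covers the plain
    bound.\<close>
  define C' where "C' = C * (1 + w + w * \<bar>x\<bar>)"
  have CC: "C \<le> C'" unfolding C'_def using C w by (simp add: mult_le_cancel_left1)
  have g_bound: "norm (g k) \<le> C' * exp (- (c * w) * \<bar>k\<bar>)" for k
  proof -
    have "norm (g k) = norm (h (w * k))" by (simp add: g_def norm_mult)
    also have "\<dots> \<le> C * exp (- c * \<bar>w * k\<bar>)" by (rule bound)
    also have "\<dots> \<le> C' * exp (- c * \<bar>w * k\<bar>)" using CC by (intro mult_right_mono) auto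
    finally show ?thesis using w by (simp add: abs_mult mult_ac)
  qed
  have g_lip: "norm (g (k + t) - g k) \<le> C' * exp (- (c * w) * \<bar>k\<bar>) * \<bar>t\<bar>" if t: "\<bar>t\<bar> \<le> 1 / 2" for k t
  proof -
    have "g (k + t) - g k = (h (w * k + w * t) - h (w * k)) * cis (w * (k + t) * x) +
        h (w * k) * (cis (w * (k + t) * x) - cis (w * k * x))"
      by (simp add: g_def algebra_simps)
    also have "norm \<dots> \<le> norm (h (w * k + w * t) - h (w * k)) +
        norm (h (w * k)) * norm (cis (w * (k + t) * x) - cis (w * k * x))"
      using norm_triangle_ineq[of "(h (w * k + w * t) - h (w * k)) * cis (w * (k + t) * x)"
        "h (w * k) * (cis (w * (k + t) * x) - cis (w * k * x))"]
      by (simp add: norm_mult)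
    also have "\<dots> \<le> C * exp (- c * \<bar>w * k\<bar>) * \<bar>w * t\<bar> + C * exp (- c * \<bar>w * k\<bar>) * \<bar>w * (k + t) * x - w * k * x\<bar>"
    proof (intro add_mono mult_mono lip bound norm_cis_diff_le)
      show "\<bar>w * t\<bar> \<le> pi / d"
        using mult_left_mono[OF t, of w] w d by (simp add: abs_mult w_def)
    qed (use C in auto)
    also have "\<dots> = C * (w + w * \<bar>x\<bar>) * exp (- c * \<bar>w * k\<bar>) * \<bar>t\<bar>"
    proof -
      have "w * (k + t) * x - w * k * x = w * t * x" by (simp add: algebra_simps)
      then show ?thesis using w by (simp add: abs_mult algebra_simps)
    qed
    also have "\<dots> \<le> C' * exp (- c * \<bar>w * k\<bar>) * \<bar>t\<bar>"
      using C by (intro mult_right_mono) (auto simp: C'_def intro!: mult_left_mono)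
    finally show ?thesis using w by (simp add: abs_mult mult_ac)
  qed
  have cw: "c * w > 0" using c w by simp
  have g_int: "(\<lambda>j::int. g (of_int j)) = (\<lambda>j. h (2 * pi * of_int j / d) * cis (2 * pi * of_int j / d * x))"
    by (simp add: g_def w_def)
  have "(\<lambda>j::int. g (of_int j)) summable_on UNIV"
    by (rule abs_summable_summable,
        rule summable_on_comparison_test[OF summable_on_cmult_right[OF summable_on_exp_minus_abs_int[OF cw], of C']])
       (simp_all only: g_bound norm_ge_zero)
  then show "(\<lambda>j::int. h (2 * pi * of_int j / d) * cis (2 * pi * of_int j / d * x)) summable_on UNIV"
    by (simp only: g_int)
  \<comment> \<open>Lattice index \<open>m\<close> becomes frequency \<open>- m\<close>; this is
    harmless because the intervals of summation are symmetric.\<close>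
  have transform: "(LBINT k. h k * cis (k * (x - of_int m * d))) =
      of_real w * (LBINT k. g k * cis (2 * pi * of_int (- m) * k))" for m
  proof -
    have "(LBINT k. h k * cis (k * (x - of_int m * d))) =
       \<bar>w\<bar> *\<^sub>R (LBINT k. h (0 + w * k) * cis ((0 + w * k) * (x - of_int m * d)))"
      using w by (intro lborel_integral_real_affine) auto
    also have "(LBINT k. h (0 + w * k) * cis ((0 + w * k) * (x - of_int m * d))) =
       (LBINT k. g k * cis (2 * pi * of_int (- m) * k))"
    proof (intro Bochner_Integration.integral_cong refl)
      fix k
      have "(0 + w * k) * (x - of_int m * d) = w * k * x + 2 * pi * of_int (- m) * k"
        using d by (simp add: w_def field_simps)
      then show "h (0 + w * k) * cis ((0 + w * k) * (x - of_int m * d)) = g k * cis (2 * pi * of_int (- m) * k)"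
        by (simp only: g_def mult.assoc cis_mult add_0)
    qed
    finally show ?thesis using w by (simp add: scaleR_conv_of_real)
  qed
  obtain S where S: "((\<lambda>m::int. LBINT k. h k * cis (k * (x - of_int m * d))) has_sum S) UNIV"
    using summable by (auto simp: summable_on_def)
  have "(\<lambda>N. \<Sum>m\<in>{- int N..int N}. LBINT k. h k * cis (k * (x - of_int m * d))) \<longlonglongrightarrow> S"
    by (rule has_sum_int_symmetric_limit[OF S])
  moreover have "(\<lambda>N. \<Sum>m\<in>{- int N..int N}. LBINT k. h k * cis (k * (x - of_int m * d))) =
      (\<lambda>N. of_real w * (\<Sum>m\<in>{- int N..int N}. LBINT k. g k * cis (2 * pi * of_int m * k)))"
    unfolding transform sum_distrib_left
    by (intro ext sum.reindex_bij_witness[of _ uminus uminus]) auto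
  moreover have "(\<lambda>N. of_real w * (\<Sum>m\<in>{- int N..int N}. LBINT k. g k * cis (2 * pi * of_int m * k)))
      \<longlonglongrightarrow> of_real w * (\<Sum>\<^sub>\<infinity>j. g (of_int j))"
    by (intro tendsto_mult tendsto_const Poisson_summation_symmetric[OF cw g_bound g_lip])
  ultimately have "S = of_real w * (\<Sum>\<^sub>\<infinity>j. g (of_int j))"
    by (simp only: LIMSEQ_unique)
  with S show "((\<lambda>m::int. LBINT k. h k * cis (k * (x - of_int m * d))) has_sum
            of_real (2 * pi / d) * (\<Sum>\<^sub>\<infinity>j::int. h (2 * pi * of_int j / d) * cis (2 * pi * of_int j / d * x))) UNIV"
    by (simp only: g_int w_def)
qed

section \<open>The Bessel function on a rotated contour\<close>

text \<open>The integrand of \<open>2 K\<^sub>a(b r) = \<integral> exp (a u - b r cosh u) du\<close> with \<open>u\<close> replaced by \<open>u - \<i>\<phi>\<close>, up to the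
  constant \<open>cis (a \<phi>)\<close>, where \<open>(x, y) = (r sin \<phi>, r cos \<phi>)\<close>.\<close>

definition bessel_kernel :: "real \<Rightarrow> real \<Rightarrow> real \<Rightarrow> real \<Rightarrow> real \<Rightarrow> complex" where
  "bessel_kernel b a x y u = of_real (exp (a * u - b * y * cosh u)) * cis (b * x * sinh u)"

definition bessel_T :: "real \<Rightarrow> real \<Rightarrow> real \<Rightarrow> real \<Rightarrow> complex" where
  "bessel_T b a x y = (LBINT u. bessel_kernel b a x y u)"

lemma norm_bessel_kernel: "norm (bessel_kernel b a x y u) = exp (a * u - b * y * cosh u)"
  by (simp add: bessel_kernel_def norm_mult)

lemma bessel_kernel_measurable[measurable]: "bessel_kernel b a x y \<in> borel_measurable borel"
  unfolding bessel_kernel_def[abs_def] cis_conv_exp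
  by (intro borel_measurable_continuous_onI continuous_intros)

lemma cosh_ge_quadratic: "cosh u \<ge> u\<^sup>2 / 4" for u :: real
proof -
  have "u\<^sup>2 / 2 \<le> exp \<bar>u\<bar>"
    using exp_lower_Taylor_quadratic[of "\<bar>u\<bar>"] by simp
  also have "\<dots> \<le> exp u + exp (- u)"
    by (cases "u \<ge> 0") auto
  finally show ?thesis by (simp add: cosh_field_def)
qed

text \<open>Completing the square: the quadratic lower bound for \<open>cosh\<close> beats the
  linear term with slope \<open>\<bar>a\<bar> + 1\<close>, one more than needed, which leaves the
  factor \<open>exp (- 1 * \<bar>u\<bar>)\<close> over.\<close>

lemma exp_cosh_bound:
  fixes a g u :: real
  assumes "g > 0"
  shows "exp (a * u - g * cosh u) \<le> exp ((\<bar>a\<bar> + 1)\<^sup>2 / g) * exp (- 1 * \<bar>u\<bar>)"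
proof -
  have "g * (u\<^sup>2 / 4) \<le> g * cosh u"
    using assms by (intro mult_left_mono cosh_ge_quadratic) auto
  moreover have "a * u \<le> \<bar>a\<bar> * \<bar>u\<bar>" by (metis abs_ge_self abs_mult)
  moreover have "A * \<bar>u\<bar> \<le> A\<^sup>2 / g + g * (u\<^sup>2 / 4)" for A
  proof -
    have "0 \<le> (g * \<bar>u\<bar> / 2 - A)\<^sup>2 / g" using assms by simp
    then show ?thesis using assms by (simp add: power2_eq_square field_simps)
  qed
  from this[of "\<bar>a\<bar> + 1"]
  have "\<bar>a\<bar> * \<bar>u\<bar> + \<bar>u\<bar> \<le> (\<bar>a\<bar> + 1)\<^sup>2 / g + g * (u\<^sup>2 / 4)" by (simp add: algebra_simps)
  ultimately have "a * u - g * cosh u \<le> (\<bar>a\<bar> + 1)\<^sup>2 / g + - 1 * \<bar>u\<bar>" by linarith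
  then show ?thesis by (simp flip: exp_add)
qed

lemma integrable_exp_cosh:
  fixes a g :: real
  assumes "g > 0"
  shows "integrable lborel (\<lambda>u. exp (a * u - g * cosh u))"
proof (rule integrable_exp_bounded[where c=1])
  show "(\<lambda>u. exp (a * u - g * cosh u)) \<in> borel_measurable borel"
    by (intro borel_measurable_continuous_onI continuous_intros)
  show "norm (exp (a * u - g * cosh u)) \<le> exp ((\<bar>a\<bar> + 1)\<^sup>2 / g) * exp (- 1 * \<bar>u\<bar>)" for u
    using exp_cosh_bound[OF assms, of a u] by (simp only: real_norm_def abs_exp_cancel)
qed simp

lemma integrable_bessel_kernel:
  assumes "b > 0" "y > 0"
  shows "integrable lborel (bessel_kernel b a x y)"
  by (rule Bochner_Integration.integrable_bound[OF integrable_exp_cosh[of "b * y" a]])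
     (use assms in \<open>simp_all add: norm_bessel_kernel\<close>)

section \<open>Ladder relations and derivatives of the Bessel integrals\<close>

lemma exp_shift_up: "exp ((a + 1) * u - c) = exp u * exp (a * u - c)" for a u c :: real
  by (simp add: algebra_simps flip: exp_add)

lemma exp_shift_down: "exp ((a - 1) * u - c) = exp (- u) * exp (a * u - c)" for a u c :: real
  by (simp add: algebra_simps flip: exp_add)

lemma cosh_times_exp:
  "cosh u * exp (a * u - c) = (exp ((a + 1) * u - c) + exp ((a - 1) * u - c)) / 2" for a u c :: real
  unfolding exp_shift_up exp_shift_down cosh_field_def by (simp add: field_simps)

lemma sinh_times_exp:
  "sinh u * exp (a * u - c) = (exp ((a + 1) * u - c) - exp ((a - 1) * u - c)) / 2" for a u c :: real
  unfolding exp_shift_up exp_shift_down sinh_field_def by (simp add: field_simps)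

text \<open>Multiplication by \<open>cosh u\<close> or \<open>sinh u\<close> moves the index
  \<open>a\<close> by one in both directions, so every derivative of \<open>bessel_T\<close> is
  again a combination of such integrals. After integration this is the recurrence 2 K_a' = -
  (K_(a+1) + K_(a-1)).\<close>

lemma bessel_kernel_cosh:
  "of_real (cosh u) * bessel_kernel b a x y u = (bessel_kernel b (a + 1) x y u + bessel_kernel b (a - 1) x y u) / 2"
  unfolding bessel_kernel_def mult.assoc[symmetric] of_real_mult[symmetric] cosh_times_exp
  by (simp add: algebra_simps)

lemma bessel_kernel_sinh:
  "of_real (sinh u) * bessel_kernel b a x y u = (bessel_kernel b (a + 1) x y u - bessel_kernel b (a - 1) x y u) / 2"
  unfolding bessel_kernel_def mult.assoc[symmetric] of_real_mult[symmetric] sinh_times_exp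
  by (simp add: algebra_simps)

lemma bessel_kernel_exp:
  "bessel_kernel b a x y u = exp (of_real (a * u - b * y * cosh u) + \<i> * of_real (b * x * sinh u))"
  unfolding bessel_kernel_def cis_conv_exp exp_of_real[symmetric] exp_add[symmetric] by (rule refl)

lemma has_vector_derivative_exp_Complex:
  assumes "(p has_real_derivative p') (at t)" "(q has_real_derivative q') (at t)"
  shows "((\<lambda>t. exp (of_real (p t) + \<i> * of_real (q t)) :: complex) has_vector_derivative
           (of_real p' + \<i> * of_real q') * exp (of_real (p t) + \<i> * of_real (q t))) (at t)"
proof -
  have "((\<lambda>t. of_real (p t) + \<i> * of_real (q t) :: complex) has_vector_derivative (of_real p' + \<i> * of_real q')) (at t)"
    by (intro has_vector_derivative_add has_vector_derivative_mult_right has_vector_derivative_of_real assms)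
  from field_vector_diff_chain_at[OF this DERIV_exp] show ?thesis by (simp add: o_def)
qed

lemma bessel_kernel_deriv_y:
  "((\<lambda>y. bessel_kernel b a x y u) has_vector_derivative
     - of_real b / 2 * (bessel_kernel b (a + 1) x y u + bessel_kernel b (a - 1) x y u)) (at y)"
proof -
  have "((\<lambda>y. bessel_kernel b a x y u) has_vector_derivative
     (of_real (- b * cosh u) + \<i> * of_real 0) * bessel_kernel b a x y u) (at y)"
    unfolding bessel_kernel_exp
    by (rule has_vector_derivative_exp_Complex) (auto intro!: derivative_eq_intros)
  also have "(of_real (- b * cosh u) + \<i> * of_real 0) * bessel_kernel b a x y u =
     - of_real b * (of_real (cosh u) * bessel_kernel b a x y u)" by simp
  finally show ?thesis by (simp only: bessel_kernel_cosh) simp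
qed

lemma bessel_kernel_deriv_x:
  "((\<lambda>x. bessel_kernel b a x y u) has_vector_derivative
     \<i> * of_real b / 2 * (bessel_kernel b (a + 1) x y u - bessel_kernel b (a - 1) x y u)) (at x)"
proof -
  have "((\<lambda>x. bessel_kernel b a x y u) has_vector_derivative
     (of_real 0 + \<i> * of_real (b * sinh u)) * bessel_kernel b a x y u) (at x)"
    unfolding bessel_kernel_exp
    by (rule has_vector_derivative_exp_Complex) (auto intro!: derivative_eq_intros)
  also have "(of_real 0 + \<i> * of_real (b * sinh u)) * bessel_kernel b a x y u =
     \<i> * of_real b * (of_real (sinh u) * bessel_kernel b a x y u)" by simp
  finally show ?thesis by (simp only: bessel_kernel_sinh) simp
qed

lemma abs_sinh_le_cosh: "\<bar>sinh u\<bar> \<le> cosh u" for u :: real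
  unfolding cosh_field_def sinh_field_def abs_le_iff by (simp add: field_simps)

lemma tendsto_exp_minus_abs:
  "((\<lambda>u::real. K * exp (- 1 * \<bar>u\<bar>)) \<longlongrightarrow> 0) at_top" "((\<lambda>u::real. K * exp (- 1 * \<bar>u\<bar>)) \<longlongrightarrow> 0) at_bot"
proof -
  have "((\<lambda>u::real. exp (- \<bar>u\<bar>)) \<longlongrightarrow> 0) at_top"
    by (rule filterlim_compose[OF exp_at_bot], rule filterlim_compose[OF filterlim_uminus_at_bot_at_top], rule filterlim_abs_real)
  from tendsto_mult[OF tendsto_const[of K] this]
  show "((\<lambda>u::real. K * exp (- 1 * \<bar>u\<bar>)) \<longlongrightarrow> 0) at_top" "((\<lambda>u::real. K * exp (- 1 * \<bar>u\<bar>)) \<longlongrightarrow> 0) at_bot"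
    by (simp_all add: filterlim_at_bot_mirror)
qed

lemma bessel_T_deriv_y:
  assumes "b > 0" "y > 0"
  shows "((\<lambda>y. bessel_T b a x y) has_vector_derivative
           - of_real b / 2 * (bessel_T b (a + 1) x y + bessel_T b (a - 1) x y)) (at y)"
proof -
  let ?f' = "\<lambda>y u. - of_real b / 2 * (bessel_kernel b (a + 1) x y u + bessel_kernel b (a - 1) x y u)"
  have "((\<lambda>y. LBINT u. bessel_kernel b a x y u) has_vector_derivative (LBINT u. ?f' y u)) (at y)"
  \<comment> \<open>On the ball of radius \<open>y / 2\<close> the height stays above
    \<open>y / 2\<close>, so the exponentials at height \<open>y / 2\<close> dominate.\<close>
  proof (rule has_vector_derivative_integral[where \<delta>="y / 2" and
        g="\<lambda>u. b / 2 * (exp ((a + 1) * u - b * (y / 2) * cosh u) + exp ((a - 1) * u - b * (y / 2) * cosh u))"])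
    fix p u assume p: "p \<in> ball y (y / 2)"
    then have "\<bar>y - p\<bar> < y / 2" by (simp add: dist_real_def)
    then have p': "p \<ge> y / 2" by linarith
    have "exp (e * u - b * p * cosh u) \<le> exp (e * u - b * (y / 2) * cosh u)" for e
      using p' assms by (simp add: mult_mono)
    then have "norm (bessel_kernel b (a + 1) x p u + bessel_kernel b (a - 1) x p u) \<le>
        exp ((a + 1) * u - b * (y / 2) * cosh u) + exp ((a - 1) * u - b * (y / 2) * cosh u)"
      by (intro norm_triangle_le add_mono) (simp_all only: norm_bessel_kernel)
    then have "b / 2 * norm (bessel_kernel b (a + 1) x p u + bessel_kernel b (a - 1) x p u) \<le> b / 2 * (
        exp ((a + 1) * u - b * (y / 2) * cosh u) + exp ((a - 1) * u - b * (y / 2) * cosh u))"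
      using assms by (intro mult_left_mono) auto
    then show "norm (?f' p u) \<le> b / 2 * (exp ((a + 1) * u - b * (y / 2) * cosh u) + exp ((a - 1) * u - b * (y / 2) * cosh u))"
      using assms by (simp add: norm_mult norm_divide)
  next
    fix p assume "p \<in> ball y (y / 2)"
    then have "\<bar>y - p\<bar> < y / 2" by (simp add: dist_real_def)
    then have "p > 0" by linarith
    then show "integrable lborel (bessel_kernel b a x p)" using assms by (intro integrable_bessel_kernel)
  next
    show "integrable lborel (\<lambda>u. b / 2 * (exp ((a + 1) * u - b * (y / 2) * cosh u) + exp ((a - 1) * u - b * (y / 2) * cosh u)))"
      using assms by (intro integrable_mult_right Bochner_Integration.integrable_add integrable_exp_cosh) auto
  qed (use assms in \<open>simp, intro bessel_kernel_deriv_y\<close>)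
  also have "(LBINT u. ?f' y u) = - of_real b / 2 * (bessel_T b (a + 1) x y + bessel_T b (a - 1) x y)"
    unfolding bessel_T_def using integrable_bessel_kernel[OF assms]
    by (simp only: integral_mult_right_zero Bochner_Integration.integral_add)
  finally show ?thesis by (simp only: bessel_T_def)
qed

lemma bessel_T_deriv_x:
  assumes "b > 0" "y > 0"
  shows "((\<lambda>x. bessel_T b a x y) has_vector_derivative
           \<i> * of_real b / 2 * (bessel_T b (a + 1) x y - bessel_T b (a - 1) x y)) (at x)"
proof -
  let ?f' = "\<lambda>x u. \<i> * of_real b / 2 * (bessel_kernel b (a + 1) x y u - bessel_kernel b (a - 1) x y u)"
  have "((\<lambda>x. LBINT u. bessel_kernel b a x y u) has_vector_derivative (LBINT u. ?f' x u)) (at x)"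
  proof (rule has_vector_derivative_integral[where \<delta>=1 and
        g="\<lambda>u. b / 2 * (exp ((a + 1) * u - b * y * cosh u) + exp ((a - 1) * u - b * y * cosh u))"])
    fix p u
    have "norm (bessel_kernel b (a + 1) p y u - bessel_kernel b (a - 1) p y u) \<le>
        exp ((a + 1) * u - b * y * cosh u) + exp ((a - 1) * u - b * y * cosh u)"
      by (rule order_trans[OF norm_triangle_ineq4]) (simp only: norm_bessel_kernel)
    then have "b / 2 * norm (bessel_kernel b (a + 1) p y u - bessel_kernel b (a - 1) p y u) \<le> b / 2 * (
        exp ((a + 1) * u - b * y * cosh u) + exp ((a - 1) * u - b * y * cosh u))"
      using assms by (intro mult_left_mono) auto
    then show "norm (?f' p u) \<le> b / 2 * (exp ((a + 1) * u - b * y * cosh u) + exp ((a - 1) * u - b * y * cosh u))"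
      using assms by (simp add: norm_mult norm_divide)
    show "integrable lborel (\<lambda>u. b / 2 * (exp ((a + 1) * u - b * y * cosh u) + exp ((a - 1) * u - b * y * cosh u)))"
      using assms by (intro integrable_mult_right Bochner_Integration.integrable_add integrable_exp_cosh) auto
    show "integrable lborel (bessel_kernel b a p y)" using assms by (rule integrable_bessel_kernel)
  qed (simp, intro bessel_kernel_deriv_x)
  also have "(LBINT u. ?f' x u) = \<i> * of_real b / 2 * (bessel_T b (a + 1) x y - bessel_T b (a - 1) x y)"
    unfolding bessel_T_def using integrable_bessel_kernel[OF assms]
    by (simp only: integral_mult_right_zero Bochner_Integration.integral_diff)
  finally show ?thesis by (simp only: bessel_T_def)
qed

text \<open>The derivative of the rotated integrand in the angle is \<open>-\<i>\<close> times its derivative in \<open>u\<close>, so the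
  integral does not depend on the angle.\<close>

lemma bessel_T_rotate:
  assumes b: "b > 0" and r: "r > 0" and \<phi>: "\<bar>\<phi>\<bar> < pi / 2"
  shows "bessel_T b a (r * sin \<phi>) (r * cos \<phi>) = cis (a * \<phi>) * bessel_T b a 0 r"
proof -
  \<comment> \<open>The factor \<open>cis (- a * p)\<close> restores the constant dropped from
    \<open>bessel_kernel\<close>: \<open>F p u\<close> is g(u - ip) for the entire function g(z) =
    exp(az - b r cosh z). This gives the relation between the derivatives in \<open>p\<close> and in
    \<open>u\<close>.\<close>
  define F where "F p u = cis (- a * p) * bessel_kernel b a (r * sin p) (r * cos p) u" for p u
  define F' where "F' p u = (of_real a - of_real (b * r * cos p * sinh u) + \<i> * of_real (b * r * sin p * cosh u)) * F p u" for p u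
  have F_exp: "F p u = exp (of_real (a * u - b * r * cos p * cosh u) + \<i> * of_real (b * r * sin p * sinh u - a * p))" for p u
    by (simp add: F_def bessel_kernel_exp cis_conv_exp algebra_simps flip: exp_add)
  have norm_F: "norm (F p u) = exp (a * u - b * (r * cos p) * cosh u)" for p u
    by (simp add: F_def norm_mult norm_bessel_kernel)
  have deriv_u: "((\<lambda>u. F p u) has_vector_derivative F' p u) (at u)" for p u
  proof -
    have "((\<lambda>u. F p u) has_vector_derivative
       (of_real (a - b * r * cos p * sinh u) + \<i> * of_real (b * r * sin p * cosh u)) * F p u) (at u)"
      unfolding F_exp by (rule has_vector_derivative_exp_Complex) (auto intro!: derivative_eq_intros)
    then show ?thesis by (simp only: F'_def of_real_diff)
  qed
  have deriv_p: "((\<lambda>p. F p u) has_vector_derivative (- \<i> * F' p u)) (at p)" for p u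
  proof -
    have "((\<lambda>p. F p u) has_vector_derivative
       (of_real (b * r * sin p * cosh u) + \<i> * of_real (b * r * cos p * sinh u - a)) * F p u) (at p)"
      unfolding F_exp by (rule has_vector_derivative_exp_Complex) (auto intro!: derivative_eq_intros)
    also have "(of_real (b * r * sin p * cosh u) + \<i> * of_real (b * r * cos p * sinh u - a)) * F p u = - \<i> * F' p u"
      unfolding F'_def by (simp add: algebra_simps)
    finally show ?thesis .
  qed
  have norm_F': "norm (F' p u) \<le> (\<bar>a\<bar> + 2 * (b * r) * cosh u) * exp (a * u - b * (r * cos p) * cosh u)" for p u
  proof -
    have "norm (of_real a - of_real (b * r * cos p * sinh u) + \<i> * of_real (b * r * sin p * cosh u) :: complex)
       \<le> \<bar>a\<bar> + \<bar>b * r * cos p * sinh u\<bar> + \<bar>b * r * sin p * cosh u\<bar>"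
      by (intro norm_triangle_le norm_triangle_le_diff add_mono) (simp_all add: norm_mult abs_mult)
    also have "\<bar>b * r * cos p * sinh u\<bar> \<le> b * r * 1 * cosh u"
      unfolding abs_mult using b r abs_sinh_le_cosh by (intro mult_mono) auto
    also have "\<bar>b * r * sin p * cosh u\<bar> \<le> b * r * 1 * cosh u"
      unfolding abs_mult using b r by (intro mult_mono) auto
    also have "\<bar>a\<bar> + b * r * 1 * cosh u + b * r * 1 * cosh u = \<bar>a\<bar> + 2 * (b * r) * cosh u" by simp
    finally show ?thesis
      unfolding F'_def norm_mult norm_F by (intro mult_right_mono) auto
  qed
  have dom: "integrable lborel (\<lambda>u. (\<bar>a\<bar> + 2 * (b * r) * cosh u) * exp (a * u - b * (r * \<kappa>) * cosh u))" if "\<kappa> > 0" for \<kappa>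
  proof -
    have "integrable lborel (\<lambda>u. \<bar>a\<bar> * exp (a * u - b * (r * \<kappa>) * cosh u) +
      b * r * (exp ((a + 1) * u - b * (r * \<kappa>) * cosh u) + exp ((a - 1) * u - b * (r * \<kappa>) * cosh u)))"
      using b r that by (intro Bochner_Integration.integrable_add integrable_mult_right integrable_exp_cosh) auto
    also have "(\<lambda>u. \<bar>a\<bar> * exp (a * u - b * (r * \<kappa>) * cosh u) +
      b * r * (exp ((a + 1) * u - b * (r * \<kappa>) * cosh u) + exp ((a - 1) * u - b * (r * \<kappa>) * cosh u))) =
      (\<lambda>u. \<bar>a\<bar> * exp (a * u - b * (r * \<kappa>) * cosh u) + 2 * (b * r) * (cosh u * exp (a * u - b * (r * \<kappa>) * cosh u)))"
      unfolding cosh_times_exp by (simp add: mult.assoc)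
    finally show ?thesis by (simp add: algebra_simps)
  qed
  have cont: "continuous_on UNIV (F' p)" for p
    unfolding F'_def F_exp by (intro continuous_intros)
  have cos_pos: "cos p > 0" if "\<bar>p\<bar> < pi / 2" for p
    using that by (intro cos_gt_zero_pi) auto
  have int_F: "integrable lborel (F p)" if "\<bar>p\<bar> < pi / 2" for p
    unfolding F_def using cos_pos[OF that] b r by (intro integrable_mult_right integrable_bessel_kernel) auto
  have int_F': "integrable lborel (F' p)" if "\<bar>p\<bar> < pi / 2" for p
    by (rule Bochner_Integration.integrable_bound[OF dom[OF cos_pos[OF that]]])
       (use norm_F'[of p] cont[of p] order_trans[OF norm_F' abs_ge_self] in \<open>auto intro: borel_measurable_continuous_onI\<close>)
  have F_le: "\<forall>\<^sub>F u in A. norm (F p u) \<le> exp ((\<bar>a\<bar> + 1)\<^sup>2 / (b * (r * cos p))) * exp (- 1 * \<bar>u\<bar>)"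
    if "\<bar>p\<bar> < pi / 2" for p A
    unfolding norm_F using b r cos_pos[OF that] by (intro always_eventually allI exp_cosh_bound) auto
  have F_lim: "(F p \<longlongrightarrow> 0) at_top" "(F p \<longlongrightarrow> 0) at_bot" if "\<bar>p\<bar> < pi / 2" for p
    by (rule Lim_null_comparison[OF F_le[OF that] tendsto_exp_minus_abs(1)],
        rule Lim_null_comparison[OF F_le[OF that] tendsto_exp_minus_abs(2)])
  have zero: "(LBINT u. F' p u) = 0" if "\<bar>p\<bar> < pi / 2" for p
    by (rule integral_deriv_vanishing_at_infinity[OF deriv_u cont int_F'[OF that] F_lim[OF that]])
  have "((\<lambda>p. LBINT u. F p u) has_vector_derivative 0) (at p within {- (pi / 2)<..<pi / 2})" if "p \<in> {- (pi / 2)<..<pi / 2}" for p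
  proof -
    have p: "\<bar>p\<bar> < pi / 2" using that by auto
    \<comment> \<open>Halfway between \<open>\<bar>p\<bar>\<close> and \<open>pi / 2\<close>: on the
      ball around \<open>p\<close> the cosine stays above \<open>cos p1 > 0\<close>, so one
      integrable function dominates all these angles.\<close>
    define p1 where "p1 = (\<bar>p\<bar> + pi / 2) / 2"
    have p1: "\<bar>p\<bar> < p1" "p1 < pi / 2" "0 \<le> p1" using p by (auto simp: p1_def)
    have q: "\<bar>q\<bar> < p1" if "q \<in> ball p (p1 - \<bar>p\<bar>)" for q
      using that by (auto simp: dist_real_def)
    have "((\<lambda>p. LBINT u. F p u) has_vector_derivative (LBINT u. - \<i> * F' p u)) (at p)"
    proof (rule has_vector_derivative_integral[where \<delta>="p1 - \<bar>p\<bar>" and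
         g="\<lambda>u. (\<bar>a\<bar> + 2 * (b * r) * cosh u) * exp (a * u - b * (r * cos p1) * cosh u)"])
      show "integrable lborel (F q)" if "q \<in> ball p (p1 - \<bar>p\<bar>)" for q
        using q[OF that] p1 by (intro int_F) auto
      show "norm (- \<i> * F' q u) \<le> (\<bar>a\<bar> + 2 * (b * r) * cosh u) * exp (a * u - b * (r * cos p1) * cosh u)"
        if "q \<in> ball p (p1 - \<bar>p\<bar>)" for q u
      proof -
        have "cos p1 \<le> cos \<bar>q\<bar>" using q[OF that] p1 by (intro cos_monotone_0_pi_le) auto
        then have "b * (r * cos p1) * cosh u \<le> b * (r * cos q) * cosh u"
          using b r by (intro mult_right_mono mult_left_mono) auto
        then have "exp (a * u - b * (r * cos q) * cosh u) \<le> exp (a * u - b * (r * cos p1) * cosh u)" by simp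
        then have "(\<bar>a\<bar> + 2 * (b * r) * cosh u) * exp (a * u - b * (r * cos q) * cosh u)
           \<le> (\<bar>a\<bar> + 2 * (b * r) * cosh u) * exp (a * u - b * (r * cos p1) * cosh u)"
          using b r by (intro mult_left_mono) auto
        then show ?thesis using norm_F'[of q u] by (simp add: norm_mult)
      qed
      show "integrable lborel (\<lambda>u. (\<bar>a\<bar> + 2 * (b * r) * cosh u) * exp (a * u - b * (r * cos p1) * cosh u))"
        using p1 by (intro dom cos_pos) auto
    qed (use p1 deriv_p in auto)
    also have "(LBINT u. - \<i> * F' p u) = 0" using zero[OF p] by simp
    finally show ?thesis by (rule has_vector_derivative_at_within)
  qed
  then obtain c where c: "\<And>p. p \<in> {- (pi / 2)<..<pi / 2} \<Longrightarrow> (LBINT u. F p u) = c"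
    using has_vector_derivative_zero_constant[of "{- (pi / 2)<..<pi / 2}"] by (metis convex_real_interval(8))
  have "(LBINT u. F \<phi> u) = (LBINT u. F 0 u)"
  proof -
    have "\<phi> \<in> {- (pi / 2)<..<pi / 2}" using \<phi> unfolding greaterThanLessThan_iff by linarith
    then show ?thesis using c[of \<phi>] c[of 0] by simp
  qed
  then have "cis (- a * \<phi>) * bessel_T b a (r * sin \<phi>) (r * cos \<phi>) = bessel_T b a 0 r"
    by (simp add: F_def bessel_T_def)
  then have "cis (a * \<phi>) * cis (- a * \<phi>) * bessel_T b a (r * sin \<phi>) (r * cos \<phi>) = cis (a * \<phi>) * bessel_T b a 0 r"
    by (simp add: mult.assoc)
  then show ?thesis by (simp add: cis_mult)
qed

text \<open>The existence of some angle suffices below, since the phase disappears under the norm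
  and for \<open>a = 0\<close>.\<close>

lemma bessel_T_polar:
  assumes "b > 0" "y > 0"
  shows "\<exists>\<phi>. bessel_T b a x y = cis (a * \<phi>) * bessel_T b a 0 (sqrt (x\<^sup>2 + y\<^sup>2))"
proof -
  define \<phi> where "\<phi> = arctan (x / y)"
  define r where "r = sqrt (x\<^sup>2 + y\<^sup>2)"
  have \<phi>: "\<bar>\<phi>\<bar> < pi / 2" using arctan_bounded[of "x / y"] unfolding \<phi>_def by linarith
  have r: "r > 0" using assms by (simp add: r_def add_nonneg_pos)
  have "sqrt (1 + (x / y)\<^sup>2) = r / y"
    using assms by (simp add: r_def real_sqrt_divide[symmetric] power_divide field_simps)
       (simp add: real_sqrt_divide)
  then have "r * sin \<phi> = x" "r * cos \<phi> = y"
    unfolding \<phi>_def sin_arctan cos_arctan using assms r by (simp_all add: field_simps)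
  then show ?thesis using bessel_T_rotate[OF assms(1) r \<phi>, of a] by (auto simp: r_def)
qed

text \<open>On the rotated contour the oscillation has become the decay
  \<open>exp (- (b * r * cosh u))\<close>. Half of this exponent yields
  \<open>exp (- (b * r / 2))\<close>, the other half keeps the integral finite uniformly in
  \<open>x\<close>. The inequality exp(s) >= s^2 / 2 at s = b r / 2 then gives the inverse square
  with constant 8 / b^2, which matches the decay of the logarithmic part.\<close>

lemma bessel_T_decay:
  assumes "b > 0" "y > 0"
  shows "\<exists>K. \<forall>x. norm (bessel_T b a x y) \<le> K / (x\<^sup>2 + y\<^sup>2)"
proof (intro exI allI)
  fix x
  let ?I = "LBINT u. exp (a * u - (b * y / 2) * cosh u)"
  let ?r = "sqrt (x\<^sup>2 + y\<^sup>2)"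
  have r: "?r > 0" "?r \<ge> y" using assms by (auto simp: add_nonneg_pos real_le_rsqrt)
  have int: "integrable lborel (\<lambda>u. exp (a * u - (b * y / 2) * cosh u))"
    using assms by (intro integrable_exp_cosh) auto
  have exp_le: "exp (- (b * ?r / 2)) \<le> 8 / b\<^sup>2 / (x\<^sup>2 + y\<^sup>2)"
  proof -
    have "0 \<le> b * ?r / 2" using assms r by simp
    with exp_lower_Taylor_quadratic[of "b * ?r / 2"]
    have "(b * ?r / 2)\<^sup>2 / 2 \<le> exp (b * ?r / 2)" by linarith
    moreover have "(b * ?r / 2)\<^sup>2 / 2 = b\<^sup>2 * (x\<^sup>2 + y\<^sup>2) / 8"
      by (simp add: power_mult_distrib power_divide)
    moreover have "b\<^sup>2 * (x\<^sup>2 + y\<^sup>2) / 8 > 0" using assms by (simp add: add_nonneg_pos)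
    ultimately have "inverse (exp (b * ?r / 2)) \<le> inverse (b\<^sup>2 * (x\<^sup>2 + y\<^sup>2) / 8)"
      by (intro le_imp_inverse_le) auto
    then show ?thesis by (simp add: exp_minus field_simps)
  qed
  obtain \<phi> where "bessel_T b a x y = cis (a * \<phi>) * bessel_T b a 0 ?r"
    using bessel_T_polar[OF assms] by blast
  then have "norm (bessel_T b a x y) = norm (LBINT u. bessel_kernel b a 0 ?r u)"
    by (simp add: norm_mult bessel_T_def)
  also have "\<dots> \<le> (LBINT u. exp (- (b * ?r / 2)) * exp (a * u - (b * y / 2) * cosh u))"
  proof (rule Bochner_Integration.integral_norm_bound_integral)
    show "norm (bessel_kernel b a 0 ?r u) \<le> exp (- (b * ?r / 2)) * exp (a * u - (b * y / 2) * cosh u)" for u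
    proof -
      have "b * ?r * 1 \<le> b * ?r * cosh u"
        using assms r cosh_real_ge_1[of u] by (intro mult_left_mono) auto
      moreover have "b * y * cosh u \<le> b * ?r * cosh u"
        using assms r cosh_real_pos[of u] by (intro mult_right_mono mult_left_mono) auto
      moreover have "b * y / 2 * cosh u = b * y * cosh u / 2" by simp
      ultimately have "a * u - b * ?r * cosh u \<le> - (b * ?r / 2) + (a * u - (b * y / 2) * cosh u)" by linarith
      then show ?thesis by (simp only: norm_bessel_kernel exp_le_cancel_iff exp_add[symmetric])
    qed
  qed (use int assms r in \<open>auto intro: integrable_bessel_kernel\<close>)
  also have "\<dots> = exp (- (b * ?r / 2)) * ?I" by simp
  also have "\<dots> \<le> 8 / b\<^sup>2 / (x\<^sup>2 + y\<^sup>2) * ?I"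
    by (intro mult_right_mono exp_le Bochner_Integration.integral_nonneg) auto
  finally show "norm (bessel_T b a x y) \<le> (8 / b\<^sup>2 * ?I) / (x\<^sup>2 + y\<^sup>2)" by simp
qed

section \<open>Link to \<open>Bessel_K0\<close> and passage to the frequency variable\<close>

lemma integral_even_half_line:
  fixes f :: "real \<Rightarrow> real"
  assumes f: "integrable lborel f" and even: "\<And>x. f (- x) = f x"
  shows "(LBINT x. f x) = 2 * (LBINT x:{0..}. f x)"
proof -
  have int: "integrable lborel (\<lambda>x. indicator {0..} x *\<^sub>R f x)" "integrable lborel (\<lambda>x. indicator {..0} x *\<^sub>R f x)"
    by (intro integrable_mult_indicator f, simp)+
  have "(LBINT x. f x) = (LBINT x. indicator {0..} x *\<^sub>R f x + indicator {..0} x *\<^sub>R f x)"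
  proof (rule integral_cong_AE)
    show "AE x in lborel. f x = indicator {0..} x *\<^sub>R f x + indicator {..0} x *\<^sub>R f x"
      using AE_lborel_singleton[of "0::real"] by eventually_elim (auto simp: indicator_def)
  qed (use f int in auto)
  also have "\<dots> = (LBINT x. indicator {0..} x *\<^sub>R f x) + (LBINT x. indicator {..0} x *\<^sub>R f x)"
    using int by simp
  also have "(LBINT x. indicator {..0} x *\<^sub>R f x) = (LBINT x. indicator {..0} (0 + - 1 * x) *\<^sub>R f (0 + - 1 * x))"
    by (subst lborel_integral_real_affine[where c="-1" and t=0]) auto
  also have "\<dots> = (LBINT x. indicator {0..} x *\<^sub>R f x)"
    by (intro Bochner_Integration.integral_cong refl) (simp add: even indicator_def)
  finally show ?thesis by (simp add: set_lebesgue_integral_def)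
qed

text \<open>Rotation to (0, r) removes the oscillation, and evenness in \<open>u\<close> folds the
  line onto the half line of the definition. From here on K_0 is accessible as an integral that can
  be differentiated in \<open>x\<close> and \<open>y\<close> separately.\<close>

lemma Bessel_K0_eq_bessel_T:
  assumes "b > 0" "y > 0"
  shows "complex_of_real (Bessel_K0 (b * sqrt (x\<^sup>2 + y\<^sup>2))) = bessel_T b 0 x y / 2"
proof -
  let ?r = "sqrt (x\<^sup>2 + y\<^sup>2)"
  have r: "?r > 0" using assms by (simp add: add_nonneg_pos)
  have int: "integrable lborel (\<lambda>u. exp (- (b * ?r) * cosh u))"
    using integrable_exp_cosh[of "b * ?r" 0] assms r by simp
  obtain \<phi> where "bessel_T b 0 x y = cis (0 * \<phi>) * bessel_T b 0 0 ?r"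
    using bessel_T_polar[OF assms] by blast
  then have "bessel_T b 0 x y = (LBINT u. complex_of_real (exp (- (b * ?r) * cosh u)))"
    by (simp add: bessel_T_def bessel_kernel_def)
  also have "\<dots> = of_real (LBINT u. exp (- (b * ?r) * cosh u))"
    by (rule integral_complex_of_real)
  also have "(LBINT u. exp (- (b * ?r) * cosh u)) = 2 * Bessel_K0 (b * ?r)"
    unfolding Bessel_K0_def by (rule integral_even_half_line[OF int]) simp
  finally show ?thesis by simp
qed

text \<open>The map \<open>\<lambda>u. b * sinh u\<close> is an increasing bijection of the line.
  Integrability has to be transferred together with the value, because it is known on the
  \<open>u\<close> side and wanted on the \<open>k\<close> side.\<close>

lemma integral_substitution_sinh:
  fixes f :: "real \<Rightarrow> complex"
  assumes b: "b > 0" and cont: "continuous_on UNIV f"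
    and int: "integrable lborel (\<lambda>u. (b * cosh u) *\<^sub>R f (b * sinh u))"
  shows "integrable lborel f" and "(LBINT k. f k) = (LBINT u. (b * cosh u) *\<^sub>R f (b * sinh u))"
proof -
  let ?g = "\<lambda>u. (b * cosh u) *\<^sub>R f (b * sinh u)"
  have meas: "f \<in> borel_measurable lborel" "?g \<in> borel_measurable lborel"
    using cont int by (auto intro: borel_measurable_continuous_onI)
  have abs: "\<bar>b * cosh u\<bar> *\<^sub>R f (b * sinh u) = ?g u" for u
    using b cosh_real_pos[of u] by simp
  have range: "range (\<lambda>u. b * sinh u) = UNIV"
  proof (intro set_eqI iffI UNIV_I)
    fix k :: real
    have "k = b * sinh (arsinh (k / b))" using b by simp
    then show "k \<in> range (\<lambda>u. b * sinh u)" by blast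
  qed
  have iff: "(?g absolutely_integrable_on UNIV \<and> integral UNIV ?g = s) \<longleftrightarrow>
      (f absolutely_integrable_on UNIV \<and> integral UNIV f = s)" for s
  proof -
    have D: "((\<lambda>u. b * sinh u) has_real_derivative b * cosh u) (at u within UNIV)" for u
      by (auto intro!: derivative_eq_intros)
    have inj: "inj (\<lambda>u. b * sinh u)" using b by (simp add: inj_on_def)
    show ?thesis
      using has_absolute_integral_change_of_variables_real[OF _ D inj, of f s] by (simp add: abs range)
  qed
  \<comment> \<open>The change of variables concerns the completed Lebesgue measure; for Borel
    functions the integrals with respect to \<open>lborel\<close> agree with it.\<close>
  have conv: "q absolutely_integrable_on UNIV \<longleftrightarrow> integrable lborel q"
      "q absolutely_integrable_on UNIV \<Longrightarrow> (LBINT u. q u) = integral UNIV q"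
    if "q \<in> borel_measurable lborel" for q :: "real \<Rightarrow> complex"
  proof -
    show "q absolutely_integrable_on UNIV \<longleftrightarrow> integrable lborel q"
      using integrable_completion[OF that] by (simp add: set_integrable_def)
    assume "q absolutely_integrable_on UNIV"
    from set_lebesgue_integral_eq_integral(2)[OF this] show "(LBINT u. q u) = integral UNIV q"
      using integral_completion[OF that] by (simp add: set_lebesgue_integral_def)
  qed
  have "f absolutely_integrable_on UNIV" "integral UNIV f = integral UNIV ?g"
    using iff[of "integral UNIV ?g"] conv(1)[OF meas(2)] int by auto
  then show "integrable lborel f" "(LBINT k. f k) = (LBINT u. ?g u)"
    using conv[OF meas(1)] conv[OF meas(2)] int by auto
qed

section \<open>Fourier representation of the Stokeslet\<close>

text \<open>\<open>symbol 0 0 = 0\<close>, because \<open>0 / 0 = 0\<close>; this is what makes the block \<open>D\<^bsup>south\<^esup>(0,0)\<close> vanish.\<close>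

definition freq :: "real \<Rightarrow> real \<Rightarrow> real" where
  "freq b k = sqrt (k\<^sup>2 + b\<^sup>2)"

definition symbol :: "real \<Rightarrow> real \<Rightarrow> complex^2^2" where
  "symbol b k = mat2 (of_real (freq b k)) (\<i> * of_real k) (\<i> * of_real k) (of_real (- k\<^sup>2 / freq b k))"

lemma mat2_nth [simp]:
  "mat2 a b c d $ 1 $ 1 = a" "mat2 a b c d $ 1 $ 2 = b"
  "mat2 a b c d $ 2 $ 1 = c" "mat2 a b c d $ 2 $ 2 = d"
  by (simp_all add: mat2_def)

section \<open>Size and Lipschitz estimates for \<open>freq\<close>, \<open>symbol\<close> and
  \<open>mode\<close>\<close>

lemma freq_0 [simp]: "freq 0 k = \<bar>k\<bar>"
  by (simp add: freq_def)

lemma freq_nonneg [simp]: "freq b k \<ge> 0"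
  by (simp add: freq_def)

lemma freq_ge_abs: "\<bar>k\<bar> \<le> freq b k"
  unfolding freq_def by (rule real_le_rsqrt) simp

lemma freq_ge: "b \<ge> 0 \<Longrightarrow> b \<le> freq b k"
  unfolding freq_def by (rule real_le_rsqrt) simp

lemma freq_le: "b \<ge> 0 \<Longrightarrow> freq b k \<le> \<bar>k\<bar> + b"
  unfolding freq_def using sqrt_add_le_add_sqrt[of "k\<^sup>2" "b\<^sup>2"] by simp

lemma freq_power2: "(freq b k)\<^sup>2 = k\<^sup>2 + b\<^sup>2"
  by (simp add: freq_def)

text \<open>\<open>freq b k\<close> is the Euclidean norm of the pair \<open>(k, b)\<close>, so this
  is the reverse triangle inequality.\<close>

lemma freq_lipschitz: "\<bar>freq b k - freq b l\<bar> \<le> \<bar>k - l\<bar>"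
proof -
  have "\<bar>norm (k, b) - norm (l, b)\<bar> \<le> norm ((k, b) - (l, b))" by (rule norm_triangle_ineq3)
  then show ?thesis by (simp add: norm_Pair freq_def)
qed

text \<open>Replaces the quotient of two growing terms by two functions with evident Lipschitz
  bounds; the degenerate case \<open>freq b k = 0\<close> is consistent with 0 / 0 = 0.\<close>

lemma symbol_22: "of_real (- k\<^sup>2 / freq b k) = (of_real (b\<^sup>2 / freq b k - freq b k) :: complex)"
proof (cases "freq b k = 0")
  case True
  then have "k = 0" using freq_ge_abs[of k b] by simp
  then show ?thesis using True by simp
next
  case False
  then have "b\<^sup>2 / freq b k - freq b k = - k\<^sup>2 / freq b k"
    using freq_power2[of b k] by (simp add: field_simps power2_eq_square)
  then show ?thesis by simp
qed

text \<open>The constant 2 is due to the last entry, a difference of two 1-Lipschitz functions; for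
  \<open>b\<^sup>2 / freq b k\<close> this uses \<open>freq b k \<ge> b\<close>.\<close>

lemma symbol_lipschitz:
  assumes "b \<ge> 0"
  shows "norm (symbol b k $ p $ q - symbol b l $ p $ q) \<le> 2 * \<bar>k - l\<bar>"
proof -
  have 1: "\<bar>b\<^sup>2 / freq b k - b\<^sup>2 / freq b l\<bar> \<le> \<bar>k - l\<bar>"
  proof (cases "b = 0")
    case False
    with assms have b: "b > 0" by simp
    then have f: "freq b k \<ge> b" "freq b l \<ge> b" "freq b k > 0" "freq b l > 0"
      using freq_ge[of b k] freq_ge[of b l] by auto
    have "b\<^sup>2 / freq b k - b\<^sup>2 / freq b l = (b\<^sup>2 / (freq b k * freq b l)) * (freq b l - freq b k)"
      using f by (simp add: field_simps)
    also have "\<bar>\<dots>\<bar> = (b\<^sup>2 / (freq b k * freq b l)) * \<bar>freq b l - freq b k\<bar>"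
      using f by (simp add: abs_mult)
    also have "\<dots> \<le> 1 * \<bar>l - k\<bar>"
      using f b by (intro mult_mono freq_lipschitz) (auto simp: power2_eq_square intro!: mult_mono)
    finally show ?thesis by (simp add: abs_minus_commute)
  qed simp
  have "\<bar>b\<^sup>2 / freq b k - freq b k - (b\<^sup>2 / freq b l - freq b l)\<bar> \<le> 2 * \<bar>k - l\<bar>"
  proof -
    have "\<bar>b\<^sup>2 / freq b k - freq b k - (b\<^sup>2 / freq b l - freq b l)\<bar> =
        \<bar>(b\<^sup>2 / freq b k - b\<^sup>2 / freq b l) - (freq b k - freq b l)\<bar>" by (simp add: algebra_simps)
    also have "\<dots> \<le> \<bar>b\<^sup>2 / freq b k - b\<^sup>2 / freq b l\<bar> + \<bar>freq b k - freq b l\<bar>" by (rule abs_triangle_ineq4)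
    also have "\<dots> \<le> \<bar>k - l\<bar> + \<bar>k - l\<bar>" by (intro add_mono 1 freq_lipschitz)
    finally show ?thesis by simp
  qed
  then have 22: "norm (symbol b k $ 2 $ 2 - symbol b l $ 2 $ 2) \<le> 2 * \<bar>k - l\<bar>"
    unfolding symbol_def mat2_nth symbol_22 of_real_diff[symmetric] norm_of_real .
  have 11: "norm (symbol b k $ 1 $ 1 - symbol b l $ 1 $ 1) \<le> 2 * \<bar>k - l\<bar>"
    unfolding symbol_def mat2_nth of_real_diff[symmetric] norm_of_real by (rule order_trans[OF freq_lipschitz]) simp
  have 12: "norm (\<i> * of_real k - \<i> * of_real l) \<le> 2 * \<bar>k - l\<bar>"
    unfolding right_diff_distrib[symmetric] of_real_diff[symmetric] norm_mult norm_of_real by simp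
  show ?thesis
    using exhaust_2[of p] exhaust_2[of q] 11 12 22 by (auto simp: symbol_def)
qed

lemma norm_symbol_le:
  "norm (symbol b k $ p $ q) \<le> freq b k"
proof -
  have "k\<^sup>2 / freq b k \<le> freq b k"
  proof (cases "freq b k = 0")
    case False
    then have "freq b k > 0" using freq_nonneg[of b k] by linarith
    then show ?thesis using freq_power2[of b k] by (simp add: divide_le_eq power2_eq_square[symmetric])
  qed simp
  moreover have "k\<^sup>2 / freq b k \<ge> 0" by simp
  ultimately have "norm (of_real (- k\<^sup>2 / freq b k) :: complex) \<le> freq b k"
    unfolding norm_of_real by simp
  then show ?thesis
    using exhaust_2[of p] exhaust_2[of q] freq_ge_abs[of k b] by (auto simp: symbol_def norm_mult)
qed

text \<open>On the wave exp(ikx - freq y) / freq the derivative in x acts as ik and the one in y as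
  -freq. The matrix of second derivatives ((yy, -xy), (-xy, xx)) then produces precisely the entries
  of \<open>symbol\<close>.\<close>

definition mode :: "real \<Rightarrow> real \<Rightarrow> real \<Rightarrow> complex^2^2" where
  "mode b y k = (\<chi> p q. symbol b k $ p $ q * of_real (exp (- freq b k * y)))"

text \<open>Half of the exponent absorbs the linear factor, by s <= exp(s) at s = y \<bar>k\<bar> /
  2.\<close>

lemma abs_times_exp_le:
  fixes A B y :: real
  assumes "y > 0" "A \<ge> 0" "B \<ge> 0"
  shows "(A + B * \<bar>k\<bar>) * exp (- y * \<bar>k\<bar>) \<le> (A + 2 * B / y) * exp (- (y / 2) * \<bar>k\<bar>)"
proof -
  have "y / 2 * \<bar>k\<bar> \<le> exp (y / 2 * \<bar>k\<bar>)"
    by (rule order_trans[OF _ exp_ge_add_one_self]) simp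
  then have k: "\<bar>k\<bar> \<le> 2 / y * exp (y / 2 * \<bar>k\<bar>)" using assms by (simp add: field_simps)
  have "A + B * \<bar>k\<bar> \<le> A * exp (y / 2 * \<bar>k\<bar>) + B * (2 / y * exp (y / 2 * \<bar>k\<bar>))"
    using assms by (intro add_mono mult_left_mono k) (auto simp: mult_le_cancel_left1)
  then have "(A + B * \<bar>k\<bar>) * exp (- y * \<bar>k\<bar>) \<le>
      (A * exp (y / 2 * \<bar>k\<bar>) + B * (2 / y * exp (y / 2 * \<bar>k\<bar>))) * exp (- y * \<bar>k\<bar>)"
    by (intro mult_right_mono) auto
  also have "\<dots> = (A + 2 * B / y) * (exp (y / 2 * \<bar>k\<bar>) * exp (- y * \<bar>k\<bar>))"
    by (simp add: algebra_simps)
  also have "exp (y / 2 * \<bar>k\<bar>) * exp (- y * \<bar>k\<bar>) = exp (- (y / 2) * \<bar>k\<bar>)"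
    by (simp flip: exp_add)
  finally show ?thesis .
qed

lemma norm_mode_le:
  assumes "b \<ge> 0" "y > 0"
  shows "norm (mode b y k $ p $ q) \<le> (b + 2 / y) * exp (- (y / 2) * \<bar>k\<bar>)"
proof -
  have "norm (mode b y k $ p $ q) = norm (symbol b k $ p $ q) * exp (- freq b k * y)"
    by (simp add: mode_def norm_mult)
  also have "\<dots> \<le> (b + 1 * \<bar>k\<bar>) * exp (- y * \<bar>k\<bar>)"
    using norm_symbol_le[of b k p q] freq_le[of b k] freq_ge_abs[of k b] assms
    by (intro mult_mono) (auto simp: mult.commute)
  also have "\<dots> \<le> (b + 2 * 1 / y) * exp (- (y / 2) * \<bar>k\<bar>)"
    using assms by (intro abs_times_exp_le) auto
  finally show ?thesis by simp
qed

text \<open>Convexity: the tangent at the larger argument lies below the exponential.\<close>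

lemma abs_exp_diff_le: "\<bar>exp s - exp t\<bar> \<le> \<bar>s - t\<bar> * exp (max s t)" for s t :: real
proof -
  have *: "exp t - exp s \<le> (t - s) * exp t" for s t :: real
  proof -
    have "(1 + (s - t)) * exp t \<le> exp (s - t) * exp t"
      by (intro mult_right_mono exp_ge_add_one_self) auto
    then show ?thesis by (simp add: algebra_simps flip: exp_add)
  qed
  show ?thesis
    using *[of s t] *[of t s] by (cases "s \<le> t") (auto simp: max_def)
qed

text \<open>For \<open>b = 0\<close> the diagonal entries have a corner at \<open>k = 0\<close>, so
  a Lipschitz bound takes the place of a derivative. Moving the frequency by at most
  \<open>R\<close> costs the factor \<open>exp (R * y)\<close>.\<close>

lemma mode_lipschitz:
  assumes b: "b \<ge> 0" and y: "y > 0" and t: "\<bar>t\<bar> \<le> R"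
  shows "norm (mode b y (k + t) $ p $ q - mode b y k $ p $ q) \<le>
     (2 + b * y + 2) * exp (R * y) * exp (- (y / 2) * \<bar>k\<bar>) * \<bar>t\<bar>"
proof -
  let ?s = "symbol b k $ p $ q" and ?s' = "symbol b (k + t) $ p $ q"
  let ?e = "exp (- freq b k * y)" and ?e' = "exp (- freq b (k + t) * y)"
  have R: "R \<ge> 0" using t by linarith
  have lip: "\<bar>freq b (k + t) - freq b k\<bar> \<le> \<bar>t\<bar>" using freq_lipschitz[of b "k + t" k] by simp
  have f: "- freq b (k + t) * y \<le> R * y + - y * \<bar>k\<bar>" "- freq b k * y \<le> R * y + - y * \<bar>k\<bar>"
  proof -
    have "(\<bar>k\<bar> - R) * y \<le> freq b (k + t) * y" "(\<bar>k\<bar> - R) * y \<le> freq b k * y"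
      using lip t R freq_ge_abs[of k b] y by (intro mult_right_mono; linarith)+
    then show "- freq b (k + t) * y \<le> R * y + - y * \<bar>k\<bar>" "- freq b k * y \<le> R * y + - y * \<bar>k\<bar>"
      by (simp_all add: algebra_simps)
  qed
  have e': "?e' \<le> exp (R * y) * exp (- y * \<bar>k\<bar>)" using f by (simp flip: exp_add)
  have ee: "\<bar>?e' - ?e\<bar> \<le> (\<bar>t\<bar> * y) * (exp (R * y) * exp (- y * \<bar>k\<bar>))"
  proof -
    have "\<bar>?e' - ?e\<bar> \<le> \<bar>- freq b (k + t) * y - - freq b k * y\<bar> * exp (max (- freq b (k + t) * y) (- freq b k * y))"
      by (rule abs_exp_diff_le)
    also have "\<dots> \<le> (\<bar>t\<bar> * y) * exp (R * y + - y * \<bar>k\<bar>)"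
    proof (intro mult_mono)
      have "\<bar>- freq b (k + t) * y - - freq b k * y\<bar> = \<bar>freq b (k + t) - freq b k\<bar> * y"
        using y by (subst abs_minus_commute) (simp add: abs_mult flip: left_diff_distrib)
      then show "\<bar>- freq b (k + t) * y - - freq b k * y\<bar> \<le> \<bar>t\<bar> * y"
        using lip y by (simp add: mult_right_mono)
    qed (use f y in auto)
    finally show ?thesis by (simp only: exp_add)
  qed
  have "mode b y (k + t) $ p $ q - mode b y k $ p $ q = (?s' - ?s) * of_real ?e' + ?s * of_real (?e' - ?e)"
    by (simp add: mode_def algebra_simps)
  also have "norm \<dots> \<le> norm (?s' - ?s) * ?e' + norm ?s * \<bar>?e' - ?e\<bar>"
    by (rule order_trans[OF norm_triangle_ineq]) (simp only: norm_mult norm_of_real abs_exp_cancel order_refl)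
  also have "\<dots> \<le> (2 * \<bar>t\<bar>) * (exp (R * y) * exp (- y * \<bar>k\<bar>)) + (\<bar>k\<bar> + b) * ((\<bar>t\<bar> * y) * (exp (R * y) * exp (- y * \<bar>k\<bar>)))"
    using symbol_lipschitz[OF b, of "k + t" p q k] order_trans[OF norm_symbol_le freq_le[OF b], of k p q] e' ee b
    by (intro add_mono mult_mono) auto
  also have "\<dots> = ((2 + b * y) + y * \<bar>k\<bar>) * exp (- y * \<bar>k\<bar>) * (exp (R * y) * \<bar>t\<bar>)"
    by (simp add: algebra_simps)
  also have "\<dots> \<le> ((2 + b * y) + 2 * y / y) * exp (- (y / 2) * \<bar>k\<bar>) * (exp (R * y) * \<bar>t\<bar>)"
    using b y by (intro mult_right_mono abs_times_exp_le) auto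
  finally show ?thesis using y by (simp add: mult_ac)
qed

lemma continuous_on_symbol: "b > 0 \<Longrightarrow> continuous_on UNIV (\<lambda>k. symbol b k $ p $ q)"
proof -
  assume b: "b > 0"
  then have "freq b k \<noteq> 0" for k using freq_ge[of b k] by simp
  then have "continuous_on UNIV (\<lambda>k. symbol b k $ 1 $ 1)" "continuous_on UNIV (\<lambda>k. symbol b k $ 1 $ 2)"
    "continuous_on UNIV (\<lambda>k. symbol b k $ 2 $ 1)" "continuous_on UNIV (\<lambda>k. symbol b k $ 2 $ 2)"
    unfolding symbol_def mat2_nth freq_def by (auto intro!: continuous_intros)
  then show ?thesis using exhaust_2[of p] exhaust_2[of q] by auto
qed

lemma freq_sinh: "b > 0 \<Longrightarrow> freq b (b * sinh u) = b * cosh u"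
proof -
  assume "b > 0"
  have "(b * sinh u)\<^sup>2 + b\<^sup>2 = (b * cosh u)\<^sup>2"
    by (simp add: power_mult_distrib cosh_square_eq algebra_simps)
  then show ?thesis using \<open>b > 0\<close> by (simp add: freq_def)
qed

text \<open>\<open>bessel_hessian\<close> and \<open>log_hessian\<close> are twice the matrix
  \<open>((\<partial>\<^sub>y\<^sub>y, -\<partial>\<^sub>x\<^sub>y), (-\<partial>\<^sub>x\<^sub>y, \<partial>\<^sub>x\<^sub>x))\<close> applied to \<open>K\<^sub>0(b r)\<close> and to \<open>-ln r\<close>.\<close>

definition bessel_hessian :: "real \<Rightarrow> real \<Rightarrow> real \<Rightarrow> complex^2^2" where
  "bessel_hessian b x y = mat2
     (of_real (b\<^sup>2 / 4) * (bessel_T b 2 x y + 2 * bessel_T b 0 x y + bessel_T b (- 2) x y))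
     (\<i> * of_real (b\<^sup>2 / 4) * (bessel_T b 2 x y - bessel_T b (- 2) x y))
     (\<i> * of_real (b\<^sup>2 / 4) * (bessel_T b 2 x y - bessel_T b (- 2) x y))
     (- of_real (b\<^sup>2 / 4) * (bessel_T b 2 x y - 2 * bessel_T b 0 x y + bessel_T b (- 2) x y))"

text \<open>Under \<open>k = b * sinh u\<close> both \<open>freq b k\<close> and the Jacobian become
  \<open>b * cosh u\<close>, so the integrand is a product of two hyperbolic functions and the
  kernel with \<open>a = 0\<close>. Applying the ladder relations twice gives the indices 2, 0 and
  -2.\<close>

lemma bessel_mode_transform:
  assumes b: "b > 0" and y: "y > 0"
  shows "integrable lborel (\<lambda>k. mode b y k $ p $ q * cis (k * x))"
    and "(LBINT k. mode b y k $ p $ q * cis (k * x)) = bessel_hessian b x y $ p $ q"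
proof -
  have kernel0: "of_real (exp (- freq b (b * sinh u) * y)) * cis (b * sinh u * x) = bessel_kernel b 0 x y u" for u
    using b by (simp add: bessel_kernel_def freq_sinh mult_ac)
  note T = integrable_bessel_kernel[OF b y]
  have c: "of_real (cosh u) * bessel_kernel b 0 x y u = (bessel_kernel b 1 x y u + bessel_kernel b (- 1) x y u) / 2"
    "of_real (cosh u) * bessel_kernel b 1 x y u = (bessel_kernel b 2 x y u + bessel_kernel b 0 x y u) / 2"
    "of_real (cosh u) * bessel_kernel b (- 1) x y u = (bessel_kernel b 0 x y u + bessel_kernel b (- 2) x y u) / 2" for u
    using bessel_kernel_cosh[of u b 0 x y] bessel_kernel_cosh[of u b 1 x y] bessel_kernel_cosh[of u b "- 1" x y] by simp_all
  have s: "of_real (sinh u) * bessel_kernel b 0 x y u = (bessel_kernel b 1 x y u - bessel_kernel b (- 1) x y u) / 2"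
    "of_real (sinh u) * bessel_kernel b 1 x y u = (bessel_kernel b 2 x y u - bessel_kernel b 0 x y u) / 2"
    "of_real (sinh u) * bessel_kernel b (- 1) x y u = (bessel_kernel b 0 x y u - bessel_kernel b (- 2) x y u) / 2" for u
    using bessel_kernel_sinh[of u b 0 x y] bessel_kernel_sinh[of u b 1 x y] bessel_kernel_sinh[of u b "- 1" x y] by simp_all
  have CC: "of_real (cosh u) * (of_real (cosh u) * bessel_kernel b 0 x y u) =
      (bessel_kernel b 2 x y u + 2 * bessel_kernel b 0 x y u + bessel_kernel b (- 2) x y u) / 4" for u
    by (simp only: c(1) times_divide_eq_right distrib_left c(2,3)) (simp add: field_simps)
  have CS: "of_real (cosh u) * (of_real (sinh u) * bessel_kernel b 0 x y u) =
      (bessel_kernel b 2 x y u - bessel_kernel b (- 2) x y u) / 4" for u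
    by (simp only: s(1) times_divide_eq_right right_diff_distrib c(2,3)) (simp add: field_simps)
  have SS: "of_real (sinh u) * (of_real (sinh u) * bessel_kernel b 0 x y u) =
      (bessel_kernel b 2 x y u - 2 * bessel_kernel b 0 x y u + bessel_kernel b (- 2) x y u) / 4" for u
    by (simp only: s(1) times_divide_eq_right right_diff_distrib s(2,3)) (simp add: field_simps)
  let ?f = "\<lambda>p q k. mode b y k $ p $ q * cis (k * x)"
  have cont: "continuous_on UNIV (?f p q)" for p q
    unfolding mode_def freq_def cis_conv_exp using continuous_on_symbol[OF b, of p q]
    by (auto intro!: continuous_intros)
  have unf: "(b * cosh u) *\<^sub>R ?f p q (b * sinh u) =
      of_real (b * cosh u) * (symbol b (b * sinh u) $ p $ q * bessel_kernel b 0 x y u)" for p q u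
    unfolding kernel0[symmetric] by (simp add: mode_def scaleR_conv_of_real mult_ac)
  have s11: "(b * cosh u) *\<^sub>R ?f 1 1 (b * sinh u) =
      of_real (b\<^sup>2 / 4) * (bessel_kernel b 2 x y u + 2 * bessel_kernel b 0 x y u + bessel_kernel b (- 2) x y u)" for u
  proof -
    have "(b * cosh u) *\<^sub>R ?f 1 1 (b * sinh u) = of_real (b\<^sup>2) * (of_real (cosh u) * (of_real (cosh u) * bessel_kernel b 0 x y u))"
      unfolding unf using b by (simp add: symbol_def freq_sinh power2_eq_square mult_ac)
    then show ?thesis unfolding CC by simp
  qed
  have s12: "(b * cosh u) *\<^sub>R ?f 1 2 (b * sinh u) =
      \<i> * of_real (b\<^sup>2 / 4) * (bessel_kernel b 2 x y u - bessel_kernel b (- 2) x y u)" for u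
  proof -
    have "(b * cosh u) *\<^sub>R ?f 1 2 (b * sinh u) = \<i> * of_real (b\<^sup>2) * (of_real (cosh u) * (of_real (sinh u) * bessel_kernel b 0 x y u))"
      unfolding unf using b by (simp add: symbol_def power2_eq_square mult_ac)
    then show ?thesis unfolding CS by simp
  qed
  have s22: "(b * cosh u) *\<^sub>R ?f 2 2 (b * sinh u) =
      - of_real (b\<^sup>2 / 4) * (bessel_kernel b 2 x y u - 2 * bessel_kernel b 0 x y u + bessel_kernel b (- 2) x y u)" for u
  proof -
    have "of_real (b * cosh u) * of_real (- (b * sinh u)\<^sup>2 / freq b (b * sinh u)) = (- of_real (b\<^sup>2) * of_real (sinh u) * of_real (sinh u) :: complex)"
      using b cosh_real_pos[of u] by (simp add: freq_sinh power2_eq_square)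
    then have "(b * cosh u) *\<^sub>R ?f 2 2 (b * sinh u) = - of_real (b\<^sup>2) * (of_real (sinh u) * (of_real (sinh u) * bessel_kernel b 0 x y u))"
      unfolding unf symbol_def mat2_nth by (simp only: mult.assoc[symmetric])
    then show ?thesis unfolding SS by simp
  qed
  have I11: "integrable lborel (\<lambda>u. (b * cosh u) *\<^sub>R ?f 1 1 (b * sinh u))"
    unfolding s11 by (intro integrable_mult_right Bochner_Integration.integrable_add T)
  have I12: "integrable lborel (\<lambda>u. (b * cosh u) *\<^sub>R ?f 1 2 (b * sinh u))"
    unfolding s12 by (intro integrable_mult_right Bochner_Integration.integrable_diff T)
  have I22: "integrable lborel (\<lambda>u. (b * cosh u) *\<^sub>R ?f 2 2 (b * sinh u))"
    unfolding s22 by (intro integrable_mult_right Bochner_Integration.integrable_diff Bochner_Integration.integrable_add T)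
  have sym: "?f 2 1 = ?f 1 2" by (simp add: mode_def symbol_def)
  note S11 = integral_substitution_sinh[OF b cont I11]
  note S12 = integral_substitution_sinh[OF b cont I12]
  note S22 = integral_substitution_sinh[OF b cont I22]
  have "integrable lborel (?f p q) \<and> (LBINT k. ?f p q k) = bessel_hessian b x y $ p $ q"
    if "p \<in> {1, 2}" "q \<in> {1, 2}" for p q
    using that S11(1) S12(1) S22(1) unfolding bessel_hessian_def
    by (auto simp: S11(2) S12(2) S22(2) s11 s12 s22 bessel_T_def T sym)
  then show "integrable lborel (?f p q)" "(LBINT k. ?f p q k) = bessel_hessian b x y $ p $ q"
    using exhaust_2[of p] exhaust_2[of q] by auto
qed

text \<open>The value is read off from the primitive -(k / w + 1 / w^2) exp(-kw), which vanishes at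
  infinity.\<close>

lemma half_line_transform:
  fixes w :: complex
  assumes w: "Re w > 0"
  defines "F \<equiv> \<lambda>k::real. indicator {0<..} k *\<^sub>R (of_real k * exp (- of_real k * w))"
  shows "integrable lborel F" "(LBINT k. F k) = 1 / w\<^sup>2"
proof -
  have le: "\<bar>k\<bar> * exp (- Re w * \<bar>k\<bar>) \<le> 2 / Re w * exp (- (Re w / 2) * \<bar>k\<bar>)" for k
    using abs_times_exp_le[of "Re w" 0 1 k] w by simp
  show int: "integrable lborel F"
  proof (rule integrable_exp_bounded[where c="Re w / 2" and C="2 / Re w"])
    show "norm (F k) \<le> 2 / Re w * exp (- (Re w / 2) * \<bar>k\<bar>)" for k
    proof (cases "k > 0")
      case True
      then show ?thesis using le[of k] by (simp add: F_def norm_mult mult.commute)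
    qed (use w in \<open>simp add: F_def\<close>)
    have "(\<lambda>k. of_real k * exp (- of_real k * w)) \<in> borel_measurable borel"
      by (intro borel_measurable_continuous_onI continuous_intros)
    then show "F \<in> borel_measurable borel" unfolding F_def by measurable
  qed (use w in simp)
  have w0: "w \<noteq> 0" using w by auto
  let ?\<Phi> = "\<lambda>k::real. - ((of_real k / w + 1 / w\<^sup>2) * exp (- of_real k * w))"
  have "(LBINT k=0..\<infinity>. of_real k * exp (- of_real k * w)) = 0 - (- (1 / w\<^sup>2))"
  proof (rule interval_integral_FTC_integrable)
    show "(?\<Phi> has_vector_derivative of_real k * exp (- of_real k * w)) (at k)" for k
    proof -
      have "((\<lambda>z. - ((z / w + 1 / w\<^sup>2) * exp (- z * w))) has_field_derivative of_real k * exp (- of_real k * w)) (at (of_real k))"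
        using w0 by (auto intro!: derivative_eq_intros simp: field_simps power2_eq_square)
      from has_vector_derivative_real_field[OF this] show ?thesis .
    qed
    show "isCont (\<lambda>k. of_real k * exp (- of_real k * w)) k" for k by (intro continuous_intros)
    show "set_integrable lborel (einterval 0 \<infinity>) (\<lambda>k. of_real k * exp (- of_real k * w))"
      using int by (simp add: set_integrable_def F_def zero_ereal_def)
    have "isCont ?\<Phi> 0" using w0 by (intro continuous_intros) auto
    then have "(?\<Phi> \<longlongrightarrow> ?\<Phi> 0) (at_right 0)" by (simp add: isCont_def filterlim_at_split)
    then show "((?\<Phi> \<circ> real_of_ereal) \<longlongrightarrow> - (1 / w\<^sup>2)) (at_right 0)"
      unfolding zero_ereal_def ereal_tendsto_simps1 by simp
    have "(?\<Phi> \<longlongrightarrow> 0) at_top"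
    proof (rule Lim_null_comparison)
      let ?K = "1 / norm (w\<^sup>2) + 2 * (1 / norm w) / Re w"
      show "\<forall>\<^sub>F k in at_top. norm (?\<Phi> k) \<le> ?K * exp (- (Re w / 2) * k)"
        using eventually_ge_at_top[of 0]
      proof eventually_elim
        case (elim k)
        have "norm (?\<Phi> k) = norm (of_real k / w + 1 / w\<^sup>2) * exp (- Re w * \<bar>k\<bar>)"
          using elim by (simp add: norm_mult mult.commute)
        also have "\<dots> \<le> (1 / norm (w\<^sup>2) + 1 / norm w * \<bar>k\<bar>) * exp (- Re w * \<bar>k\<bar>)"
          by (intro mult_right_mono order_trans[OF norm_triangle_ineq]) (auto simp: norm_divide)
        also have "\<dots> \<le> ?K * exp (- (Re w / 2) * \<bar>k\<bar>)"
          using w by (intro abs_times_exp_le) auto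
        finally show ?case using elim by simp
      qed
      have "((\<lambda>k. exp (- (Re w / 2) * k)) \<longlongrightarrow> 0) at_top"
        by (rule filterlim_compose[OF exp_at_bot], rule filterlim_tendsto_neg_mult_at_bot[OF tendsto_const _ filterlim_ident])
           (use w in simp)
      from tendsto_mult[OF tendsto_const[of ?K] this]
      show "((\<lambda>k. ?K * exp (- (Re w / 2) * k)) \<longlongrightarrow> 0) at_top" by simp
    qed
    then show "((?\<Phi> \<circ> real_of_ereal) \<longlongrightarrow> 0) (at_left \<infinity>)"
      unfolding ereal_tendsto_simps1 .
  qed simp
  then show "(LBINT k. F k) = 1 / w\<^sup>2"
    by (simp add: F_def interval_lebesgue_integral_0_infty set_lebesgue_integral_def)
qed

definition log_hessian :: "real \<Rightarrow> real \<Rightarrow> real^2^2" where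
  "log_hessian x y = mat2 (2 * (y\<^sup>2 - x\<^sup>2) / (x\<^sup>2 + y\<^sup>2)\<^sup>2) (- 4 * x * y / (x\<^sup>2 + y\<^sup>2)\<^sup>2)
     (- 4 * x * y / (x\<^sup>2 + y\<^sup>2)\<^sup>2) (- 2 * (y\<^sup>2 - x\<^sup>2) / (x\<^sup>2 + y\<^sup>2)\<^sup>2)"

text \<open>With w = y - ix the integrand is a multiple of k exp(-kw) for positive k, and of its
  conjugate mirror image for negative k. The entries are thus built from the sum and the difference
  of 1 / w^2 and its conjugate.\<close>

lemma log_mode_transform:
  assumes y: "y > 0"
  shows "integrable lborel (\<lambda>k. mode 0 y k $ p $ q * cis (k * x))"
    and "(LBINT k. mode 0 y k $ p $ q * cis (k * x)) = of_real (log_hessian x y $ p $ q)"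
proof -
  define w where "w = Complex y (- x)"
  define F where "F w k = indicator {0<..} k *\<^sub>R (of_real k * exp (- of_real k * w))" for w :: complex and k :: real
  have Re: "Re w > 0" "Re (cnj w) > 0" using y by (simp_all add: w_def)
  have I: "integrable lborel (F w)" "(LBINT k. F w k) = 1 / w\<^sup>2"
    using half_line_transform[OF Re(1)] unfolding F_def by auto
  have J: "integrable lborel (F (cnj w))" "(LBINT k. F (cnj w) k) = 1 / (cnj w)\<^sup>2"
    using half_line_transform[OF Re(2)] unfolding F_def by auto
  have J': "integrable lborel (\<lambda>k. F (cnj w) (- k))" "(LBINT k. F (cnj w) (- k)) = 1 / (cnj w)\<^sup>2"
  proof -
    show "integrable lborel (\<lambda>k. F (cnj w) (- k))"
      using lborel_integrable_real_affine[OF J(1), of "-1" 0] by simp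
    show "(LBINT k. F (cnj w) (- k)) = 1 / (cnj w)\<^sup>2"
      using lborel_integral_real_affine[of "-1" "F (cnj w)" 0] J(2) by simp
  qed
  have kern: "of_real (exp (- \<bar>k\<bar> * y)) * cis (k * x) = (if k \<ge> 0 then exp (- of_real k * w) else exp (of_real k * cnj w))" for k
    by (auto simp: w_def exp_eq_polar Re_exp Im_exp complex_eq_iff cis.ctr exp_of_real)
  have e11: "mode 0 y k $ 1 $ 1 * cis (k * x) = F w k + F (cnj w) (- k)" for k
    using kern[of k] unfolding mode_def symbol_def F_def
    by (cases "k = 0"; cases "k > 0") (auto simp: indicator_def mult.assoc)
  have e12: "mode 0 y k $ 1 $ 2 * cis (k * x) = \<i> * (F w k - F (cnj w) (- k))" for k
    using kern[of k] unfolding mode_def symbol_def F_def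
    by (cases "k = 0"; cases "k > 0") (auto simp: indicator_def mult.assoc)
  have e22: "mode 0 y k $ 2 $ 2 * cis (k * x) = - (F w k + F (cnj w) (- k))" for k
  proof -
    have "mode 0 y k $ 2 $ 2 = - mode 0 y k $ 1 $ 1"
      by (simp add: mode_def symbol_def power2_eq_square) (simp add: abs_if)
    then show ?thesis using e11[of k] by simp
  qed
  have e21: "mode 0 y k $ 2 $ 1 * cis (k * x) = \<i> * (F w k - F (cnj w) (- k))" for k
    using e12[of k] by (simp add: mode_def symbol_def)
  have r: "x\<^sup>2 + y\<^sup>2 > 0" using y by (simp add: add_nonneg_pos)
  have inv: "1 / w\<^sup>2 = Complex ((y\<^sup>2 - x\<^sup>2) / (x\<^sup>2 + y\<^sup>2)\<^sup>2) (2 * x * y / (x\<^sup>2 + y\<^sup>2)\<^sup>2)"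
  proof -
    define N where "N = (x\<^sup>2 + y\<^sup>2)\<^sup>2"
    have N: "N \<noteq> 0" using r unfolding N_def by (metis less_irrefl power_not_zero)
    have w2: "w\<^sup>2 = Complex (y\<^sup>2 - x\<^sup>2) (- 2 * x * y)"
      by (simp add: w_def complex_eq_iff power2_eq_square)
    have "(y\<^sup>2 - x\<^sup>2) * (y\<^sup>2 - x\<^sup>2) + 2 * x * y * (2 * x * y) = N" unfolding N_def by algebra
    then have "(y\<^sup>2 - x\<^sup>2) * ((y\<^sup>2 - x\<^sup>2) / N) - (- 2 * x * y) * (2 * x * y / N) = 1"
      using N by (simp add: add_divide_distrib[symmetric])
    then have "w\<^sup>2 * Complex ((y\<^sup>2 - x\<^sup>2) / N) (2 * x * y / N) = 1"
      unfolding w2 complex_eq_iff by simp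
    moreover have "w\<^sup>2 \<noteq> 0" using Re by auto
    ultimately show ?thesis by (simp add: divide_eq_eq mult.commute N_def)
  qed
  have inv': "1 / (cnj w)\<^sup>2 = cnj (1 / w\<^sup>2)" by simp
  have sum: "1 / w\<^sup>2 + 1 / (cnj w)\<^sup>2 = of_real (2 * (y\<^sup>2 - x\<^sup>2) / (x\<^sup>2 + y\<^sup>2)\<^sup>2)"
    unfolding inv' inv by (simp add: complex_eq_iff)
  have diff: "\<i> * (1 / w\<^sup>2 - 1 / (cnj w)\<^sup>2) = of_real (- 4 * x * y / (x\<^sup>2 + y\<^sup>2)\<^sup>2)"
    unfolding inv' inv by (simp add: complex_eq_iff)
  have i11: "integrable lborel (\<lambda>k. F w k + F (cnj w) (- k))" "(LBINT k. F w k + F (cnj w) (- k)) = of_real (2 * (y\<^sup>2 - x\<^sup>2) / (x\<^sup>2 + y\<^sup>2)\<^sup>2)"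
    using I J' sum by auto
  have i12: "integrable lborel (\<lambda>k. \<i> * (F w k - F (cnj w) (- k)))" "(LBINT k. \<i> * (F w k - F (cnj w) (- k))) = of_real (- 4 * x * y / (x\<^sup>2 + y\<^sup>2)\<^sup>2)"
    using I J' diff by auto
  have i22: "integrable lborel (\<lambda>k. - (F w k + F (cnj w) (- k)))" "(LBINT k. - (F w k + F (cnj w) (- k))) = of_real (- 2 * (y\<^sup>2 - x\<^sup>2) / (x\<^sup>2 + y\<^sup>2)\<^sup>2)"
    by (rule Bochner_Integration.integrable_minus[OF i11(1)])
       (simp only: Bochner_Integration.integral_minus i11(2) of_real_minus[symmetric] minus_divide_left mult_minus_left)
  have "integrable lborel (\<lambda>k. mode 0 y k $ p $ q * cis (k * x)) \<and>
     (LBINT k. mode 0 y k $ p $ q * cis (k * x)) = of_real (log_hessian x y $ p $ q)"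
    using exhaust_2[of p] exhaust_2[of q] i11 i12 i22
    by (elim disjE) (simp_all only: e11 e12 e21 e22 log_hessian_def mat2_nth)
  then show "integrable lborel (\<lambda>k. mode 0 y k $ p $ q * cis (k * x))"
    "(LBINT k. mode 0 y k $ p $ q * cis (k * x)) = of_real (log_hessian x y $ p $ q)" by auto
qed

text \<open>Replacing \<open>u\<close> by \<open>- u\<close> reverses both \<open>a\<close> and the
  phase. This makes \<open>bessel_hessian\<close> real, so that taking real parts in
  \<open>stokes_hessian\<close> loses nothing.\<close>

lemma cnj_bessel_T: "cnj (bessel_T b a x y) = bessel_T b (- a) x y"
proof -
  have "bessel_T b (- a) x y = (LBINT u. bessel_kernel b (- a) x y (0 + - 1 * u))"
    unfolding bessel_T_def by (subst lborel_integral_real_affine[where c="-1" and t=0]) auto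
  also have "\<dots> = (LBINT u. cnj (bessel_kernel b a x y u))"
    by (intro Bochner_Integration.integral_cong refl) (simp add: bessel_kernel_def cis_cnj)
  also have "\<dots> = cnj (bessel_T b a x y)" unfolding bessel_T_def by (rule Bochner_Integration.integral_cnj)
  finally show ?thesis by simp
qed

lemma bessel_hessian_real: "of_real (Re (bessel_hessian b x y $ p $ q)) = bessel_hessian b x y $ p $ q"
proof -
  have "Im (bessel_T b 0 x y) = 0" "Re (bessel_T b (- 2) x y) = Re (bessel_T b 2 x y)"
    "Im (bessel_T b (- 2) x y) = - Im (bessel_T b 2 x y)"
    using cnj_bessel_T[of b 0 x y] cnj_bessel_T[of b 2 x y] by (simp_all add: complex_eq_iff)
  then have "Im (bessel_hessian b x y $ p $ q) = 0"
    using exhaust_2[of p] exhaust_2[of q] by (auto simp: bessel_hessian_def)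
  then show ?thesis by (simp add: complex_eq_iff)
qed

section \<open>Second derivatives of \<open>G_MB\<close> in the two half planes\<close>

lemma has_real_derivative_Re:
  assumes "(f has_vector_derivative D) (at x)"
  shows "((\<lambda>x. Re (f x)) has_real_derivative Re D) (at x)"
  using bounded_linear.has_vector_derivative[OF bounded_linear_Re assms]
  by (simp add: has_real_derivative_iff_has_vector_derivative)

text \<open>\<open>G_MB\<close> in Cartesian coordinates for \<open>y > 0\<close>, with K_0 replaced
  by the rotated integral; \<open>gmb_x\<close> and \<open>gmb_y\<close> are the closed forms of its
  first derivatives.\<close>

definition gmb :: "real \<Rightarrow> real \<Rightarrow> real \<Rightarrow> real" where
  "gmb b x y = - 1 / (2 * pi * b\<^sup>2) * (Re (bessel_T b 0 x y) / 2 + ln (x\<^sup>2 + y\<^sup>2) / 2)"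

definition gmb_x :: "real \<Rightarrow> real \<Rightarrow> real \<Rightarrow> real" where
  "gmb_x b x y = - 1 / (2 * pi * b\<^sup>2) *
     (Re (\<i> * of_real b / 2 * (bessel_T b 1 x y - bessel_T b (- 1) x y)) / 2 + x / (x\<^sup>2 + y\<^sup>2))"

definition gmb_y :: "real \<Rightarrow> real \<Rightarrow> real \<Rightarrow> real" where
  "gmb_y b x y = - 1 / (2 * pi * b\<^sup>2) *
     (Re (- of_real b / 2 * (bessel_T b 1 x y + bessel_T b (- 1) x y)) / 2 + y / (x\<^sup>2 + y\<^sup>2))"

text \<open>The prefactor of \<open>G_MB\<close> is halved because both Hessians carry a factor 2.
  The minus sign appears because \<open>log_hessian\<close> refers to -ln r, while
  \<open>G_MB\<close> contains +ln r.\<close>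

definition stokes_hessian :: "real \<Rightarrow> real \<Rightarrow> real \<Rightarrow> real^2^2" where
  "stokes_hessian b x y = (\<chi> p q. 1 / (4 * pi * b\<^sup>2) * (Re (bessel_hessian b x y $ p $ q) - log_hessian x y $ p $ q))"

context
  fixes b x y :: real
  assumes b: "b > 0" and y: "y > 0"
begin

lemma r2_pos: "x\<^sup>2 + y\<^sup>2 > 0"
  using y by (simp add: add_nonneg_pos)

lemma gmb_deriv_x: "((\<lambda>x. gmb b x y) has_real_derivative gmb_x b x y) (at x)"
proof -
  have "((\<lambda>x. Re (bessel_T b 0 x y)) has_real_derivative
      Re (\<i> * of_real b / 2 * (bessel_T b 1 x y - bessel_T b (- 1) x y))) (at x)"
    using has_real_derivative_Re[OF bessel_T_deriv_x[OF b y, of 0 x]] by simp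
  moreover have "((\<lambda>x. ln (x\<^sup>2 + y\<^sup>2) / 2) has_real_derivative x / (x\<^sup>2 + y\<^sup>2)) (at x)"
    using r2_pos y by (auto intro!: derivative_eq_intros simp: field_simps)
  ultimately show ?thesis unfolding gmb_def gmb_x_def
    by (intro DERIV_cmult DERIV_add DERIV_cdivide)
qed

lemma gmb_deriv_y: "((\<lambda>y. gmb b x y) has_real_derivative gmb_y b x y) (at y)"
proof -
  have "((\<lambda>y. Re (bessel_T b 0 x y)) has_real_derivative
      Re (- of_real b / 2 * (bessel_T b 1 x y + bessel_T b (- 1) x y))) (at y)"
    using has_real_derivative_Re[OF bessel_T_deriv_y[OF b y, of 0 x]] by simp
  moreover have "((\<lambda>y. ln (x\<^sup>2 + y\<^sup>2) / 2) has_real_derivative y / (x\<^sup>2 + y\<^sup>2)) (at y)"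
    using r2_pos y by (auto intro!: derivative_eq_intros simp: field_simps)
  ultimately show ?thesis unfolding gmb_def gmb_y_def
    by (intro DERIV_cmult DERIV_add DERIV_cdivide)
qed

lemma gmb_x_deriv_x: "((\<lambda>x. gmb_x b x y) has_real_derivative - stokes_hessian b x y $ 2 $ 2) (at x)"
proof -
  have "((\<lambda>x. \<i> * of_real b / 2 * (bessel_T b 1 x y - bessel_T b (- 1) x y)) has_vector_derivative
     \<i> * of_real b / 2 * (\<i> * of_real b / 2 * (bessel_T b (1 + 1) x y - bessel_T b (1 - 1) x y)
       - \<i> * of_real b / 2 * (bessel_T b (- 1 + 1) x y - bessel_T b (- 1 - 1) x y))) (at x)"
    by (intro has_vector_derivative_mult_right has_vector_derivative_diff bessel_T_deriv_x[OF b y])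
  also have "\<i> * of_real b / 2 * (\<i> * of_real b / 2 * (bessel_T b (1 + 1) x y - bessel_T b (1 - 1) x y)
       - \<i> * of_real b / 2 * (bessel_T b (- 1 + 1) x y - bessel_T b (- 1 - 1) x y)) = bessel_hessian b x y $ 2 $ 2"
    by (simp add: bessel_hessian_def field_simps power2_eq_square)
  finally have 1: "((\<lambda>x. Re (\<i> * of_real b / 2 * (bessel_T b 1 x y - bessel_T b (- 1) x y))) has_real_derivative
     Re (bessel_hessian b x y $ 2 $ 2)) (at x)"
    by (rule has_real_derivative_Re)
  have 2: "((\<lambda>x. x / (x\<^sup>2 + y\<^sup>2)) has_real_derivative - log_hessian x y $ 2 $ 2 / 2) (at x)"
  proof (rule DERIV_cong)
    show "((\<lambda>x. x / (x\<^sup>2 + y\<^sup>2)) has_real_derivative (1 * (x\<^sup>2 + y\<^sup>2) - x * (2 * x)) / ((x\<^sup>2 + y\<^sup>2) * (x\<^sup>2 + y\<^sup>2))) (at x)"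
      using y by (intro DERIV_divide) (auto intro!: derivative_eq_intros)
    have "1 * (x\<^sup>2 + y\<^sup>2) - x * (2 * x) = y\<^sup>2 - x\<^sup>2" by (simp add: power2_eq_square)
    moreover have "A / (N * N) = - (- 2 * A / N\<^sup>2) / 2" for A N :: real by (simp add: power2_eq_square)
    ultimately show "(1 * (x\<^sup>2 + y\<^sup>2) - x * (2 * x)) / ((x\<^sup>2 + y\<^sup>2) * (x\<^sup>2 + y\<^sup>2)) = - log_hessian x y $ 2 $ 2 / 2"
      unfolding log_hessian_def mat2_nth by metis
  qed
  have "((\<lambda>x. gmb_x b x y) has_real_derivative - 1 / (2 * pi * b\<^sup>2) *
      (Re (bessel_hessian b x y $ 2 $ 2) / 2 + - log_hessian x y $ 2 $ 2 / 2)) (at x)"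
    unfolding gmb_x_def by (intro DERIV_cmult DERIV_add DERIV_cdivide 1 2)
  then show ?thesis using b by (simp add: stokes_hessian_def field_simps)
qed

lemma gmb_y_deriv_x: "((\<lambda>x. gmb_y b x y) has_real_derivative stokes_hessian b x y $ 1 $ 2) (at x)"
proof -
  have "((\<lambda>x. - of_real b / 2 * (bessel_T b 1 x y + bessel_T b (- 1) x y)) has_vector_derivative
     - of_real b / 2 * (\<i> * of_real b / 2 * (bessel_T b (1 + 1) x y - bessel_T b (1 - 1) x y)
       + \<i> * of_real b / 2 * (bessel_T b (- 1 + 1) x y - bessel_T b (- 1 - 1) x y))) (at x)"
    by (intro has_vector_derivative_mult_right has_vector_derivative_add bessel_T_deriv_x[OF b y])
  also have "- of_real b / 2 * (\<i> * of_real b / 2 * (bessel_T b (1 + 1) x y - bessel_T b (1 - 1) x y)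
       + \<i> * of_real b / 2 * (bessel_T b (- 1 + 1) x y - bessel_T b (- 1 - 1) x y)) = - bessel_hessian b x y $ 1 $ 2"
    by (simp add: bessel_hessian_def field_simps power2_eq_square)
  finally have 1: "((\<lambda>x. Re (- of_real b / 2 * (bessel_T b 1 x y + bessel_T b (- 1) x y))) has_real_derivative
     Re (- bessel_hessian b x y $ 1 $ 2)) (at x)"
    by (rule has_real_derivative_Re)
  have 2: "((\<lambda>x. y / (x\<^sup>2 + y\<^sup>2)) has_real_derivative log_hessian x y $ 1 $ 2 / 2) (at x)"
  proof (rule DERIV_cong)
    show "((\<lambda>x. y / (x\<^sup>2 + y\<^sup>2)) has_real_derivative (0 * (x\<^sup>2 + y\<^sup>2) - y * (2 * x)) / ((x\<^sup>2 + y\<^sup>2) * (x\<^sup>2 + y\<^sup>2))) (at x)"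
      using y by (intro DERIV_divide) (auto intro!: derivative_eq_intros)
    have "0 * (x\<^sup>2 + y\<^sup>2) - y * (2 * x) = - 2 * x * y" by (simp add: power2_eq_square)
    moreover have "(- 2 * x * y) / (N * N) = (- 4 * x * y / N\<^sup>2) / 2" for A N :: real by (simp add: power2_eq_square)
    ultimately show "(0 * (x\<^sup>2 + y\<^sup>2) - y * (2 * x)) / ((x\<^sup>2 + y\<^sup>2) * (x\<^sup>2 + y\<^sup>2)) = log_hessian x y $ 1 $ 2 / 2"
      unfolding log_hessian_def mat2_nth by metis
  qed
  have "((\<lambda>x. gmb_y b x y) has_real_derivative - 1 / (2 * pi * b\<^sup>2) *
      (Re (- bessel_hessian b x y $ 1 $ 2) / 2 + log_hessian x y $ 1 $ 2 / 2)) (at x)"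
    unfolding gmb_y_def by (intro DERIV_cmult DERIV_add DERIV_cdivide 1 2)
  also have "- 1 / (2 * pi * b\<^sup>2) * (Re (- bessel_hessian b x y $ 1 $ 2) / 2 + log_hessian x y $ 1 $ 2 / 2) =
      stokes_hessian b x y $ 1 $ 2"
  proof -
    have "- 1 / (2 * c) * (- R / 2 + L / 2) = 1 / (4 * c) * (R - L)" for R L c :: real
      by (simp add: algebra_simps diff_divide_distrib)
    from this[of "pi * b\<^sup>2"] show ?thesis by (simp add: stokes_hessian_def mult.assoc)
  qed
  finally show ?thesis .
qed

lemma gmb_y_deriv_y: "((\<lambda>y. gmb_y b x y) has_real_derivative - stokes_hessian b x y $ 1 $ 1) (at y)"
proof -
  have "((\<lambda>y. - of_real b / 2 * (bessel_T b 1 x y + bessel_T b (- 1) x y)) has_vector_derivative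
     - of_real b / 2 * (- of_real b / 2 * (bessel_T b (1 + 1) x y + bessel_T b (1 - 1) x y)
       + - of_real b / 2 * (bessel_T b (- 1 + 1) x y + bessel_T b (- 1 - 1) x y))) (at y)"
    by (intro has_vector_derivative_mult_right has_vector_derivative_add bessel_T_deriv_y[OF b y])
  also have "- of_real b / 2 * (- of_real b / 2 * (bessel_T b (1 + 1) x y + bessel_T b (1 - 1) x y)
       + - of_real b / 2 * (bessel_T b (- 1 + 1) x y + bessel_T b (- 1 - 1) x y)) = bessel_hessian b x y $ 1 $ 1"
    by (simp add: bessel_hessian_def field_simps power2_eq_square)
  finally have 1: "((\<lambda>y. Re (- of_real b / 2 * (bessel_T b 1 x y + bessel_T b (- 1) x y))) has_real_derivative
     Re (bessel_hessian b x y $ 1 $ 1)) (at y)"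
    by (rule has_real_derivative_Re)
  have 2: "((\<lambda>y. y / (x\<^sup>2 + y\<^sup>2)) has_real_derivative - log_hessian x y $ 1 $ 1 / 2) (at y)"
  proof (rule DERIV_cong)
    show "((\<lambda>y. y / (x\<^sup>2 + y\<^sup>2)) has_real_derivative (1 * (x\<^sup>2 + y\<^sup>2) - y * (2 * y)) / ((x\<^sup>2 + y\<^sup>2) * (x\<^sup>2 + y\<^sup>2))) (at y)"
      using y by (intro DERIV_divide) (auto intro!: derivative_eq_intros)
    have "1 * (x\<^sup>2 + y\<^sup>2) - y * (2 * y) = - (y\<^sup>2 - x\<^sup>2)" by (simp add: power2_eq_square)
    moreover have "- A / (N * N) = - (2 * A / N\<^sup>2) / 2" for A N :: real by (simp add: power2_eq_square)
    ultimately show "(1 * (x\<^sup>2 + y\<^sup>2) - y * (2 * y)) / ((x\<^sup>2 + y\<^sup>2) * (x\<^sup>2 + y\<^sup>2)) = - log_hessian x y $ 1 $ 1 / 2"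
      unfolding log_hessian_def mat2_nth by metis
  qed
  have "((\<lambda>y. gmb_y b x y) has_real_derivative - 1 / (2 * pi * b\<^sup>2) *
      (Re (bessel_hessian b x y $ 1 $ 1) / 2 + - log_hessian x y $ 1 $ 1 / 2)) (at y)"
    unfolding gmb_y_def by (intro DERIV_cmult DERIV_add DERIV_cdivide 1 2)
  then show ?thesis using b by (simp add: stokes_hessian_def field_simps)
qed

end

text \<open>The closed forms hold in a half plane only, upper or lower according to the sign of
  \<open>\<sigma>\<close>. A horizontal line stays inside it, whereas in the vertical direction the
  functions agree only near \<open>h = 0\<close>, which suffices for a derivative.\<close>

lemma pderiv_at_half_plane:
  fixes F :: "real \<Rightarrow> real \<Rightarrow> real" and \<sigma> :: real
  assumes f: "\<And>t. \<sigma> * t $ 2 > 0 \<Longrightarrow> f t = F (t $ 1) (t $ 2)" and t: "\<sigma> * t $ 2 > 0"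
  shows "((\<lambda>x. F x (t $ 2)) has_real_derivative D) (at (t $ 1)) \<Longrightarrow> pderiv_at 1 f t = D"
    and "((\<lambda>y. F (t $ 1) y) has_real_derivative D) (at (t $ 2)) \<Longrightarrow> pderiv_at 2 f t = D"
proof -
  have ax: "(t + h *\<^sub>R axis 1 1) $ 1 = h + t $ 1" "(t + h *\<^sub>R axis 1 1) $ 2 = t $ 2"
    "(t + h *\<^sub>R axis 2 1) $ 1 = t $ 1" "(t + h *\<^sub>R axis 2 1) $ 2 = h + t $ 2" for h
    by (simp_all add: axis_def)
  assume "((\<lambda>x. F x (t $ 2)) has_real_derivative D) (at (t $ 1))"
  then have "((\<lambda>h. F (h + t $ 1) (t $ 2)) has_real_derivative D) (at 0)"
    using DERIV_shift[of "\<lambda>x. F x (t $ 2)" D 0 "t $ 1"] by simp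
  also have "(\<lambda>h. F (h + t $ 1) (t $ 2)) = (\<lambda>h. f (t + h *\<^sub>R axis 1 1))"
    by (intro ext, subst f) (use t in \<open>simp_all only: ax\<close>)
  finally show "pderiv_at 1 f t = D" unfolding pderiv_at_def by (rule DERIV_imp_deriv)
next
  have ax: "(t + h *\<^sub>R axis 2 1) $ 1 = t $ 1" "(t + h *\<^sub>R axis 2 1) $ 2 = h + t $ 2" for h
    by (simp_all add: axis_def)
  assume "((\<lambda>y. F (t $ 1) y) has_real_derivative D) (at (t $ 2))"
  then have D: "((\<lambda>h. F (t $ 1) (h + t $ 2)) has_real_derivative D) (at 0)"
    using DERIV_shift[of "\<lambda>y. F (t $ 1) y" D 0 "t $ 2"] by simp
  have "((\<lambda>h. f (t + h *\<^sub>R axis 2 1)) has_real_derivative D) (at 0)"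
  proof (rule has_field_derivative_transform_within_open[OF D])
    show "open {h. \<sigma> * (h + t $ 2) > 0}" by (intro open_Collect_less continuous_intros)
    show "F (t $ 1) (h + t $ 2) = f (t + h *\<^sub>R axis 2 1)" if "h \<in> {h. \<sigma> * (h + t $ 2) > 0}" for h
      using f[of "t + h *\<^sub>R axis 2 1"] that by (simp only: ax mem_Collect_eq)
  qed (use t in simp)
  then show "pderiv_at 2 f t = D" unfolding pderiv_at_def by (rule DERIV_imp_deriv)
qed

lemma G_MB_upper:
  assumes "b > 0" "t $ 2 > 0"
  shows "G_MB b t = gmb b (t $ 1) (t $ 2)"
proof -
  have n: "norm t = sqrt ((t $ 1)\<^sup>2 + (t $ 2)\<^sup>2)" by (simp add: norm_vec_def L2_set_def sum_2)
  have "(t $ 1)\<^sup>2 + (t $ 2)\<^sup>2 > 0" using assms by (simp add: add_nonneg_pos)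
  then have l: "ln (1 / norm t) = - (ln ((t $ 1)\<^sup>2 + (t $ 2)\<^sup>2) / 2)"
    unfolding n by (simp add: ln_div ln_sqrt)
  have "complex_of_real (Bessel_K0 (b * norm t)) = bessel_T b 0 (t $ 1) (t $ 2) / 2"
    unfolding n by (rule Bessel_K0_eq_bessel_T[OF assms])
  from arg_cong[OF this, of Re] show ?thesis unfolding G_MB_def gmb_def l by simp
qed

lemma G_MB_minus: "G_MB b (- t) = G_MB b t"
  by (simp add: G_MB_def)

lemma G_MS_upper:
  assumes b: "b > 0" and t: "t $ 2 > 0"
  shows "G_MS b t = stokes_hessian b (t $ 1) (t $ 2)"
proof -
  have x: "pderiv_at 1 (G_MB b) t = gmb_x b (t $ 1) (t $ 2)" if "1 * t $ 2 > 0" for t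
    by (rule pderiv_at_half_plane(1)[where \<sigma>=1 and F="gmb b"])
       (use that b in \<open>simp_all add: G_MB_upper gmb_deriv_x\<close>)
  have y: "pderiv_at 2 (G_MB b) t = gmb_y b (t $ 1) (t $ 2)" if "1 * t $ 2 > 0" for t
    by (rule pderiv_at_half_plane(2)[where \<sigma>=1 and F="gmb b"])
       (use that b in \<open>simp_all add: G_MB_upper gmb_deriv_y\<close>)
  have t': "1 * t $ 2 > 0" using t by simp
  have "pderiv_at 2 (pderiv_at 2 (G_MB b)) t = - stokes_hessian b (t $ 1) (t $ 2) $ 1 $ 1"
    by (rule pderiv_at_half_plane(2)[OF y t' gmb_y_deriv_y[OF b t]])
  moreover have "pderiv_at 1 (pderiv_at 2 (G_MB b)) t = stokes_hessian b (t $ 1) (t $ 2) $ 1 $ 2"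
    by (rule pderiv_at_half_plane(1)[OF y t' gmb_y_deriv_x[OF b t]])
  moreover have "pderiv_at 1 (pderiv_at 1 (G_MB b)) t = - stokes_hessian b (t $ 1) (t $ 2) $ 2 $ 2"
    by (rule pderiv_at_half_plane(1)[OF x t' gmb_x_deriv_x[OF b t]])
  moreover have "stokes_hessian b (t $ 1) (t $ 2) $ 1 $ 2 = stokes_hessian b (t $ 1) (t $ 2) $ 2 $ 1"
    by (simp add: stokes_hessian_def bessel_hessian_def log_hessian_def)
  ultimately show ?thesis
    by (simp add: G_MS_def vec_eq_iff forall_2)
qed

text \<open>\<open>G_MB\<close> is even, and each derivative contributes a sign. The two rounds of
  derivatives are computed in the lower half plane from the reflected closed forms, which also
  provides differentiability there.\<close>

lemma G_MS_minus:
  assumes b: "b > 0" and t: "t $ 2 > 0"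
  shows "G_MS b (- t) = G_MS b t"
proof -
  have low: "G_MB b t = gmb b (- (t $ 1)) (- (t $ 2))" if "- 1 * t $ 2 > 0" for t
    using G_MB_upper[OF b, of "- t"] that by (simp add: G_MB_minus)
  have x: "pderiv_at 1 (G_MB b) t = - gmb_x b (- (t $ 1)) (- (t $ 2))" if "- 1 * t $ 2 > 0" for t
  proof (rule pderiv_at_half_plane(1)[where F="\<lambda>x y. gmb b (- x) (- y)", OF low that])
    show "((\<lambda>x. gmb b (- x) (- t $ 2)) has_real_derivative - gmb_x b (- (t $ 1)) (- (t $ 2))) (at (t $ 1))"
      using that by (intro DERIV_mirror[THEN iffD1] gmb_deriv_x b) simp
  qed
  have y: "pderiv_at 2 (G_MB b) t = - gmb_y b (- (t $ 1)) (- (t $ 2))" if "- 1 * t $ 2 > 0" for t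
  proof (rule pderiv_at_half_plane(2)[where F="\<lambda>x y. gmb b (- x) (- y)", OF low that])
    show "((\<lambda>y. gmb b (- (t $ 1)) (- y)) has_real_derivative - gmb_y b (- (t $ 1)) (- (t $ 2))) (at (t $ 2))"
      using that by (intro DERIV_mirror[THEN iffD1] gmb_deriv_y b) simp
  qed
  have t': "- 1 * (- t) $ 2 > 0" using t by simp
  have neg: "((\<lambda>x. - f (- x)) has_real_derivative D) (at (- x))" if "(f has_real_derivative D) (at x)" for f D and x :: real
  proof -
    have "((\<lambda>x. f (- x)) has_real_derivative - D) (at (- x))"
      using that by (simp flip: DERIV_mirror)
    from DERIV_minus[OF this] show ?thesis by simp
  qed
  have "pderiv_at 2 (pderiv_at 2 (G_MB b)) (- t) = - stokes_hessian b (t $ 1) (t $ 2) $ 1 $ 1"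
    by (rule pderiv_at_half_plane(2)[where F="\<lambda>x y. - gmb_y b (- x) (- y)", OF y t'])
       (use neg[OF gmb_y_deriv_y[OF b t, of "t $ 1"]] in simp_all)
  moreover have "pderiv_at 1 (pderiv_at 2 (G_MB b)) (- t) = stokes_hessian b (t $ 1) (t $ 2) $ 1 $ 2"
    by (rule pderiv_at_half_plane(1)[where F="\<lambda>x y. - gmb_y b (- x) (- y)", OF y t'])
       (use neg[OF gmb_y_deriv_x[OF b t, of "t $ 1"]] in simp_all)
  moreover have "pderiv_at 1 (pderiv_at 1 (G_MB b)) (- t) = - stokes_hessian b (t $ 1) (t $ 2) $ 2 $ 2"
    by (rule pderiv_at_half_plane(1)[where F="\<lambda>x y. - gmb_x b (- x) (- y)", OF x t'])
       (use neg[OF gmb_x_deriv_x[OF b t, of "t $ 1"]] in simp_all)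
  moreover have "stokes_hessian b (t $ 1) (t $ 2) $ 1 $ 2 = stokes_hessian b (t $ 1) (t $ 2) $ 2 $ 1"
    by (simp add: stokes_hessian_def bessel_hessian_def log_hessian_def)
  ultimately show ?thesis
    by (simp add: G_MS_upper[OF b t]) (simp add: G_MS_def vec_eq_iff forall_2)
qed

definition stokes_mode :: "real \<Rightarrow> real \<Rightarrow> real \<Rightarrow> complex^2^2" where
  "stokes_mode b y k = mode b y k - mode 0 y k"

lemma stokes_mode_transform:
  assumes b: "b > 0" and y: "y > 0"
  shows "(LBINT k. stokes_mode b y k $ p $ q * cis (k * x)) =
     bessel_hessian b x y $ p $ q - of_real (log_hessian x y $ p $ q)"
  unfolding bessel_mode_transform(2)[OF b y, symmetric] log_mode_transform(2)[OF y, symmetric]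
  by (subst Bochner_Integration.integral_diff[symmetric])
     (auto intro: bessel_mode_transform(1)[OF b y] log_mode_transform(1)[OF y] simp: stokes_mode_def left_diff_distrib)

lemma G_MS_transform:
  assumes b: "b > 0" and t: "t $ 2 > 0"
  shows "complex_of_real (G_MS b t $ p $ q) =
     of_real (1 / (4 * pi * b\<^sup>2)) * (LBINT k. stokes_mode b (t $ 2) k $ p $ q * cis (k * t $ 1))"
  unfolding stokes_mode_transform[OF b t] G_MS_upper[OF b t] stokes_hessian_def
  by (simp add: bessel_hessian_real)

text \<open>The rate is what the logarithmic part has, and it is enough for absolute convergence
  along a row. It is read off from the closed forms, since the corner of the density obstructs
  repeated integration by parts.\<close>

lemma stokes_transform_decay:
  assumes b: "b > 0" and y: "y > 0"
  shows "\<exists>K. \<forall>x. norm (LBINT k. stokes_mode b y k $ p $ q * cis (k * x)) \<le> K / (x\<^sup>2 + y\<^sup>2)"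
proof -
  obtain K where K: "\<And>a x. a \<in> {2, 0, - 2} \<Longrightarrow> norm (bessel_T b a x y) \<le> K / (x\<^sup>2 + y\<^sup>2)"
  proof -
    obtain K1 K2 K3 where K: "\<And>x. norm (bessel_T b 2 x y) \<le> K1 / (x\<^sup>2 + y\<^sup>2)"
       "\<And>x. norm (bessel_T b 0 x y) \<le> K2 / (x\<^sup>2 + y\<^sup>2)" "\<And>x. norm (bessel_T b (- 2) x y) \<le> K3 / (x\<^sup>2 + y\<^sup>2)"
      using bessel_T_decay[OF b y] by metis
    show ?thesis
    proof (rule that[of "max K1 (max K2 K3)"])
      fix a x :: real assume "a \<in> {2, 0, - 2}"
      moreover have "L / (x\<^sup>2 + y\<^sup>2) \<le> max K1 (max K2 K3) / (x\<^sup>2 + y\<^sup>2)" if "L \<in> {K1, K2, K3}" for L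
        using that by (intro divide_right_mono) auto
      ultimately show "norm (bessel_T b a x y) \<le> max K1 (max K2 K3) / (x\<^sup>2 + y\<^sup>2)"
        using K[of x] by (auto intro: order_trans)
    qed
  qed
  show ?thesis
  proof (intro exI allI)
    fix x
    let ?r = "x\<^sup>2 + y\<^sup>2"
    have r: "?r > 0" using y by (simp add: add_nonneg_pos)
    have T: "norm (bessel_T b 2 x y) \<le> K / ?r" "norm (bessel_T b 0 x y) \<le> K / ?r" "norm (bessel_T b (- 2) x y) \<le> K / ?r"
      using K by auto
    have tri: "norm (u + v + w) \<le> norm u + norm v + norm w" "norm (u - v + w) \<le> norm u + norm v + norm w" for u v w :: complex
      using norm_triangle_ineq[of "u + v" w] norm_triangle_ineq[of u v]
        norm_triangle_ineq[of "u - v" w] norm_triangle_ineq4[of u v] by linarith+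
    have K0: "0 \<le> K / ?r" using T(1) norm_ge_zero order_trans by blast
    have "norm (bessel_T b 2 x y + 2 * bessel_T b 0 x y + bessel_T b (- 2) x y) \<le> 4 * (K / ?r)"
      "norm (bessel_T b 2 x y - 2 * bessel_T b 0 x y + bessel_T b (- 2) x y) \<le> 4 * (K / ?r)"
      "norm (bessel_T b 2 x y - bessel_T b (- 2) x y) \<le> 4 * (K / ?r)"
      using tri[of "bessel_T b 2 x y" "2 * bessel_T b 0 x y" "bessel_T b (- 2) x y"]
        norm_triangle_ineq4[of "bessel_T b 2 x y" "bessel_T b (- 2) x y"] T K0 unfolding norm_mult by simp_all
    then have "norm (of_real (b\<^sup>2 / 4) :: complex) * norm (bessel_T b 2 x y + 2 * bessel_T b 0 x y + bessel_T b (- 2) x y) \<le> b\<^sup>2 / 4 * (4 * (K / ?r))"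
      "norm (of_real (b\<^sup>2 / 4) :: complex) * norm (bessel_T b 2 x y - 2 * bessel_T b 0 x y + bessel_T b (- 2) x y) \<le> b\<^sup>2 / 4 * (4 * (K / ?r))"
      "norm (of_real (b\<^sup>2 / 4) :: complex) * norm (bessel_T b 2 x y - bessel_T b (- 2) x y) \<le> b\<^sup>2 / 4 * (4 * (K / ?r))"
      unfolding norm_of_real by (intro mult_mono; simp)+
    then have bh: "norm (bessel_hessian b x y $ p $ q) \<le> b\<^sup>2 / 4 * (4 * (K / ?r))"
      using exhaust_2[of p] exhaust_2[of q] unfolding bessel_hessian_def
      by (elim disjE) (simp_all only: mat2_nth norm_mult norm_minus_cancel norm_ii mult_1_left)
    have "\<bar>2 * (y\<^sup>2 - x\<^sup>2)\<bar> \<le> 2 * ?r" by (simp add: abs_le_iff)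
    moreover have "\<bar>4 * x * y\<bar> \<le> 2 * ?r"
      using sum_squares_ge_zero[of "x - y" 0] sum_squares_ge_zero[of "x + y" 0]
      unfolding abs_le_iff by (simp add: power2_eq_square algebra_simps)
    ultimately have "\<bar>2 * (y\<^sup>2 - x\<^sup>2)\<bar> / ?r\<^sup>2 \<le> 2 * ?r / ?r\<^sup>2" "\<bar>4 * x * y\<bar> / ?r\<^sup>2 \<le> 2 * ?r / ?r\<^sup>2"
      by (intro divide_right_mono; simp)+
    moreover have "2 * N / N\<^sup>2 = 2 / N" for N :: real by (simp add: power2_eq_square)
    ultimately have lh: "\<bar>log_hessian x y $ p $ q\<bar> \<le> 2 / ?r"
      using exhaust_2[of p] exhaust_2[of q] unfolding log_hessian_def
      by (elim disjE) (simp_all only: mat2_nth abs_divide abs_power2 mult_minus_left abs_minus_cancel)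
    have "(LBINT k. stokes_mode b y k $ p $ q * cis (k * x)) =
       bessel_hessian b x y $ p $ q - of_real (log_hessian x y $ p $ q)"
      by (rule stokes_mode_transform[OF b y])
    also have "norm \<dots> \<le> b\<^sup>2 / 4 * (4 * (K / ?r)) + 2 / ?r"
      by (rule order_trans[OF norm_triangle_ineq4], intro add_mono bh) (use lh in simp)
    also have "\<dots> = (b\<^sup>2 * K + 2) / ?r" by (simp add: add_divide_distrib)
    finally show "norm (LBINT k. stokes_mode b y k $ p $ q * cis (k * x)) \<le> (b\<^sup>2 * K + 2) / ?r" .
  qed
qed

section \<open>Row sums and truncation\<close>

lemma summable_on_inverse_shifted_squares:
  fixes d x y :: real
  assumes d: "d > 0" and y: "y > 0"
  shows "(\<lambda>m::int. 1 / ((x - of_int m * d)\<^sup>2 + y\<^sup>2)) summable_on UNIV"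
proof -
  have "summable (\<lambda>n::nat. 1 / (1 + real n ^ 2))"
  proof (rule summable_comparison_test'[where N=1])
    show "summable (\<lambda>n::nat. inverse (real n ^ 2))"
      by (rule inverse_power_summable) simp
    show "norm (1 / (1 + real n ^ 2)) \<le> inverse (real n ^ 2)" if "n \<ge> 1" for n
      using that frac_le[of 1 1 "real n ^ 2" "1 + real n ^ 2"] by (simp add: inverse_eq_divide)
  qed
  from summable_on_int_even[OF this]
  have sum: "(\<lambda>m::int. 1 / (1 + (of_int m)\<^sup>2) :: real) summable_on UNIV" by simp
  \<comment> \<open>With v = x - m d one has (m d)^2 <= 2 x^2 + 2 v^2. The first summand of
    \<open>C\<close> takes care of v^2; the second turns the remaining constant into a multiple of
    \<open>y\<^sup>2\<close>.\<close>
  define C where "C = 2 / d\<^sup>2 + (1 + 2 * x\<^sup>2 / d\<^sup>2) / y\<^sup>2"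
  have "1 / ((x - of_int m * d)\<^sup>2 + y\<^sup>2) \<le> C * (1 / (1 + (of_int m)\<^sup>2))" for m :: int
  proof -
    let ?m = "of_int m :: real" and ?v = "x - of_int m * d"
    have "(?m)\<^sup>2 * d\<^sup>2 = (x - ?v)\<^sup>2" by (simp add: power_mult_distrib)
    also have "\<dots> \<le> 2 * x\<^sup>2 + 2 * ?v\<^sup>2"
    proof -
      have "(x - v)\<^sup>2 + (x + v)\<^sup>2 = 2 * x\<^sup>2 + 2 * v\<^sup>2" for v
        by (simp add: power2_eq_square algebra_simps)
      then show ?thesis using zero_le_power2[of "x + ?v"] by (metis le_add_same_cancel1)
    qed
    finally have *: "(?m)\<^sup>2 \<le> (2 * x\<^sup>2 + 2 * ?v\<^sup>2) / d\<^sup>2" using d by (simp add: pos_le_divide_eq)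
    have "1 + (?m)\<^sup>2 \<le> 2 / d\<^sup>2 * ?v\<^sup>2 + (1 + 2 * x\<^sup>2 / d\<^sup>2) / y\<^sup>2 * y\<^sup>2"
    proof -
      have "(1 + 2 * x\<^sup>2 / d\<^sup>2) / y\<^sup>2 * y\<^sup>2 = 1 + 2 * x\<^sup>2 / d\<^sup>2" using y by simp
      moreover have "(2 * x\<^sup>2 + 2 * ?v\<^sup>2) / d\<^sup>2 = 2 * x\<^sup>2 / d\<^sup>2 + 2 / d\<^sup>2 * ?v\<^sup>2" by (simp add: add_divide_distrib)
      ultimately show ?thesis using * by linarith
    qed
    also have "\<dots> \<le> C * ?v\<^sup>2 + C * y\<^sup>2"
      unfolding C_def using d y by (intro add_mono mult_right_mono) auto
    also have "\<dots> = C * (?v\<^sup>2 + y\<^sup>2)" by (simp add: algebra_simps)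
    finally have **: "1 + (?m)\<^sup>2 \<le> C * (?v\<^sup>2 + y\<^sup>2)" .
    have "?v\<^sup>2 + y\<^sup>2 > 0" "1 + (?m)\<^sup>2 > 0" using y by (simp_all add: add_nonneg_pos add_pos_nonneg)
    with ** show ?thesis by (simp add: divide_le_eq pos_le_divide_eq mult_ac)
  qed
  then show ?thesis
    by (intro summable_on_comparison_test[OF summable_on_cmult_right[OF sum, of C]]) auto
qed

lemma stokes_row_sum:
  assumes b: "b > 0" and d: "d > 0" and y: "y > 0"
  shows "(\<lambda>j. stokes_mode b y (alpha d j) $ p $ q * cis (alpha d j * x)) summable_on UNIV"
    and "((\<lambda>m::int. complex_of_real (G_MS b (vector [x - of_int m * d, y]) $ p $ q)) has_sum
       of_real (1 / (2 * b\<^sup>2 * d)) * (\<Sum>\<^sub>\<infinity>j. stokes_mode b y (alpha d j) $ p $ q * cis (alpha d j * x))) UNIV"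
proof -
  let ?h = "\<lambda>k. stokes_mode b y k $ p $ q"
  let ?E = "\<lambda>k. exp (- (y / 2) * \<bar>k\<bar>)"
  \<comment> \<open>\<open>C1\<close> bounds the density and \<open>C2\<close> its increments, with
    \<open>R = pi / d\<close>, the range demanded by \<open>Poisson_summation\<close>. That result
    uses a single constant, hence the sum \<open>C1 + C2\<close> below.\<close>
  define C1 where "C1 = (b + 2 / y) + (0 + 2 / y)"
  define C2 where "C2 = (2 + b * y + 2) * exp (pi / d * y) + (2 + 0 * y + 2) * exp (pi / d * y)"
  have C: "C1 \<ge> 0" "C2 \<ge> 0" using b y by (simp_all add: C1_def C2_def)
  have bound: "norm (?h k) \<le> (C1 + C2) * ?E k" for k
  proof -
    have "norm (?h k) \<le> norm (mode b y k $ p $ q) + norm (mode 0 y k $ p $ q)"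
      unfolding stokes_mode_def vector_minus_component by (rule norm_triangle_ineq4)
    also have "\<dots> \<le> (b + 2 / y) * ?E k + (0 + 2 / y) * ?E k"
      using b y by (intro add_mono norm_mode_le) auto
    also have "\<dots> = C1 * ?E k" by (simp add: C1_def algebra_simps)
    also have "\<dots> \<le> (C1 + C2) * ?E k" using C by (intro mult_right_mono) auto
    finally show ?thesis .
  qed
  have lip: "norm (?h (k + t) - ?h k) \<le> (C1 + C2) * ?E k * \<bar>t\<bar>" if t: "\<bar>t\<bar> \<le> pi / d" for k t
  proof -
    have "?h (k + t) - ?h k = (mode b y (k + t) $ p $ q - mode b y k $ p $ q) - (mode 0 y (k + t) $ p $ q - mode 0 y k $ p $ q)"
      by (simp add: stokes_mode_def)
    also have "norm \<dots> \<le> norm (mode b y (k + t) $ p $ q - mode b y k $ p $ q) + norm (mode 0 y (k + t) $ p $ q - mode 0 y k $ p $ q)"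
      by (rule norm_triangle_ineq4)
    also have "\<dots> \<le> (2 + b * y + 2) * exp (pi / d * y) * ?E k * \<bar>t\<bar> + (2 + 0 * y + 2) * exp (pi / d * y) * ?E k * \<bar>t\<bar>"
      using b y t by (intro add_mono mode_lipschitz) auto
    also have "\<dots> = C2 * ?E k * \<bar>t\<bar>" by (simp add: C2_def algebra_simps)
    also have "\<dots> \<le> (C1 + C2) * ?E k * \<bar>t\<bar>" using C by (intro mult_right_mono) auto
    finally show ?thesis .
  qed
  obtain K where K: "\<And>x. norm (LBINT k. ?h k * cis (k * x)) \<le> K / (x\<^sup>2 + y\<^sup>2)"
    using stokes_transform_decay[OF b y] by blast
  have dom: "(\<lambda>m::int. K * (1 / ((x - of_int m * d)\<^sup>2 + y\<^sup>2))) summable_on UNIV"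
    by (intro summable_on_cmult_right summable_on_inverse_shifted_squares d y)
  have summable: "(\<lambda>m::int. LBINT k. ?h k * cis (k * (x - of_int m * d))) summable_on UNIV"
    by (rule abs_summable_summable, rule summable_on_comparison_test[OF dom]) (use K in auto)
  have y2: "y / 2 > 0" using y by simp
  have alpha: "2 * pi * of_int j / d = alpha d j" for j by (simp add: alpha_def)
  note P = Poisson_summation[where h="?h" and C="C1 + C2" and x=x, OF d y2 bound lip summable, unfolded alpha]
  show "(\<lambda>j. stokes_mode b y (alpha d j) $ p $ q * cis (alpha d j * x)) summable_on UNIV" by (rule P(1))
  have eq: "complex_of_real (G_MS b (vector [x - of_int m * d, y]) $ p $ q) =
      of_real (1 / (4 * pi * b\<^sup>2)) * (LBINT k. ?h k * cis (k * (x - of_int m * d)))" for m :: int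
    using G_MS_transform[OF b, of "vector [x - of_int m * d, y]" p q] y by simp
  have "of_real (1 / (4 * pi * b\<^sup>2)) * (of_real (2 * pi / d) * S) = of_real (1 / (2 * b\<^sup>2 * d)) * (S :: complex)" for S
  proof -
    have "1 / (4 * pi * b\<^sup>2) * (2 * pi / d) = 1 / (2 * b\<^sup>2 * d)" by simp
    then show ?thesis by (metis mult.assoc of_real_mult)
  qed
  with has_sum_cmult_right[OF P(2), of "of_real (1 / (4 * pi * b\<^sup>2))"]
  show "((\<lambda>m::int. complex_of_real (G_MS b (vector [x - of_int m * d, y]) $ p $ q)) has_sum
       of_real (1 / (2 * b\<^sup>2 * d)) * (\<Sum>\<^sub>\<infinity>j. stokes_mode b y (alpha d j) $ p $ q * cis (alpha d j * x))) UNIV"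
    unfolding eq by simp
qed

text \<open>The factor \<open>freq b k\<close> of either part cancels here, which is needed for \<open>O(\<epsilon>)\<close> without a logarithm.\<close>

lemma norm_stokes_mode_le:
  assumes b: "b > 0" and z: "z > 0" and a: "a > 0" and k: "\<bar>k\<bar> \<ge> a"
  shows "norm (stokes_mode b z k $ p $ q) \<le> b\<^sup>2 * (1 / a + z) * exp (- \<bar>k\<bar> * z)"
proof -
  define \<delta> where "\<delta> = freq b k - \<bar>k\<bar>"
  have k0: "\<bar>k\<bar> > 0" using a k by linarith
  have f0: "freq b k > 0" using k0 freq_ge_abs[of k b] by linarith
  have \<delta>0: "\<delta> \<ge> 0" using freq_ge_abs[of k b] by (simp add: \<delta>_def)
  \<comment> \<open>This identity gives both bounds that are used:
    \<open>\<delta> * \<bar>k\<bar> \<le> b\<^sup>2\<close>, which cancels the growth of the symbol,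
    and \<open>\<delta> \<le> b\<^sup>2 * (1 / a)\<close>.\<close>
  have "\<delta> * (freq b k + \<bar>k\<bar>) = b\<^sup>2"
    using freq_power2[of b k] unfolding \<delta>_def by (simp add: power2_eq_square algebra_simps)
  moreover have "\<delta> * \<bar>k\<bar> \<le> \<delta> * (freq b k + \<bar>k\<bar>)" using \<delta>0 by (intro mult_left_mono) auto
  ultimately have \<delta>k: "\<delta> * \<bar>k\<bar> \<le> b\<^sup>2" by simp
  have "\<delta> * a \<le> \<delta> * \<bar>k\<bar>" using k \<delta>0 by (intro mult_left_mono)
  with \<delta>k have \<delta>a: "\<delta> \<le> b\<^sup>2 * (1 / a)" using a by (simp add: field_simps)
  let ?e = "exp (- freq b k * z)" and ?f = "exp (- \<bar>k\<bar> * z)"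
  have e: "?e \<le> ?f" using freq_ge_abs[of k b] z by (simp add: mult_right_mono)
  have diff: "\<bar>?e - ?f\<bar> \<le> \<delta> * z * ?f"
  proof -
    have "\<bar>?e - ?f\<bar> \<le> \<bar>- freq b k * z - - \<bar>k\<bar> * z\<bar> * exp (max (- freq b k * z) (- \<bar>k\<bar> * z))"
      by (rule abs_exp_diff_le)
    also have "max (- freq b k * z) (- \<bar>k\<bar> * z) = - \<bar>k\<bar> * z"
      using freq_ge_abs[of k b] z by (intro max_absorb2) (simp add: mult_right_mono)
    also have "- freq b k * z - - \<bar>k\<bar> * z = - (\<delta> * z)" by (simp add: \<delta>_def algebra_simps)
    also have "\<bar>- (\<delta> * z)\<bar> = \<delta> * z" using \<delta>0 z by simp
    finally show ?thesis .
  qed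
  have sym: "norm (symbol b k $ p $ q - symbol 0 k $ p $ q) \<le> \<delta>"
  proof -
    have "norm (symbol b k $ 1 $ 1 - symbol 0 k $ 1 $ 1) \<le> \<delta>"
      unfolding symbol_def mat2_nth of_real_diff[symmetric] norm_of_real using \<delta>0 by (simp add: \<delta>_def)
    moreover have "norm (symbol b k $ 2 $ 2 - symbol 0 k $ 2 $ 2) \<le> \<delta>"
    proof -
      have "- k\<^sup>2 / freq b k - - k\<^sup>2 / freq 0 k = \<delta> * (\<bar>k\<bar> / freq b k)"
      proof -
        have "k\<^sup>2 = \<bar>k\<bar> * \<bar>k\<bar>" by (simp add: power2_eq_square)
        then show ?thesis using k0 f0 by (simp add: \<delta>_def field_simps)
      qed
      moreover have "\<bar>\<delta> * (\<bar>k\<bar> / freq b k)\<bar> \<le> \<delta> * 1"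
        unfolding abs_mult using \<delta>0 f0 freq_ge_abs[of k b] by (intro mult_mono) auto
      ultimately show ?thesis
        unfolding symbol_def mat2_nth of_real_diff[symmetric] norm_of_real by simp
    qed
    ultimately show ?thesis
      using exhaust_2[of p] exhaust_2[of q] \<delta>0 by (auto simp: symbol_def)
  qed
  \<comment> \<open>Only differences between \<open>b\<close> and 0 occur in this splitting: the
    symbols differ by at most \<open>\<delta>\<close>, the exponentials by at most
    \<open>\<delta> * z * ?f\<close>, and only the latter is multiplied by a factor of size
    \<open>\<bar>k\<bar>\<close>.\<close>
  have "stokes_mode b z k $ p $ q = (symbol b k $ p $ q - symbol 0 k $ p $ q) * of_real ?e + symbol 0 k $ p $ q * of_real (?e - ?f)"
    by (simp add: stokes_mode_def mode_def algebra_simps)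
  also have "norm \<dots> \<le> norm (symbol b k $ p $ q - symbol 0 k $ p $ q) * ?e + norm (symbol 0 k $ p $ q) * \<bar>?e - ?f\<bar>"
    by (rule order_trans[OF norm_triangle_ineq]) (simp only: norm_mult norm_of_real abs_exp_cancel order_refl)
  also have "\<dots> \<le> \<delta> * ?f + \<bar>k\<bar> * (\<delta> * z * ?f)"
    using sym e diff norm_symbol_le[of 0 k p q] \<delta>0 by (intro add_mono mult_mono) auto
  also have "\<dots> = (\<delta> + \<delta> * \<bar>k\<bar> * z) * ?f" by (simp add: algebra_simps)
  also have "\<dots> \<le> (b\<^sup>2 * (1 / a) + b\<^sup>2 * z) * ?f"
    using \<delta>a \<delta>k z by (intro mult_right_mono add_mono) auto
  finally show ?thesis by (simp add: algebra_simps)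
qed

section \<open>Geometric series and entrywise summation\<close>

lemma has_sum_vec_componentwise:
  fixes f :: "'b \<Rightarrow> 'a::topological_comm_monoid_add ^ 'n"
  assumes "\<And>i. ((\<lambda>x. f x $ i) has_sum (s $ i)) A"
  shows "(f has_sum s) A"
  unfolding has_sum_def
proof (rule vec_tendstoI)
  fix i
  show "((\<lambda>X. sum f X $ i) \<longlongrightarrow> s $ i) (finite_subsets_at_top A)"
    using assms[of i] by (simp add: has_sum_def)
qed

text \<open>With \<open>\<bar>j\<bar> - 1\<close> in the exponent, the first omitted frequencies
  \<open>\<bar>j\<bar> = M + 1\<close> contribute \<open>exp (- w * of_int M)\<close>, the quantity
  controlled by \<open>trunc_M\<close>. The factor 2 counts both signs of \<open>j\<close>.\<close>

lemma has_sum_geometric_tail: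
  fixes w :: real
  assumes w: "w > 0" and M: "M \<ge> 0"
  shows "((\<lambda>j::int. exp (- w * (of_int \<bar>j\<bar> - 1))) has_sum 2 * exp (- w * of_int M) / (1 - exp (- w))) {j. \<bar>j\<bar> > M}"
proof -
  have "norm (exp (- w)) < 1" using w by simp
  then have "(\<lambda>n. exp (- w) ^ n) sums (1 / (1 - exp (- w)))" "summable (\<lambda>n. norm (exp (- w) ^ n))"
    by (rule geometric_sums, simp only: norm_power, intro summable_geometric, simp)
  then have "((\<lambda>n. exp (- w) ^ n) has_sum (1 / (1 - exp (- w)))) UNIV"
    by (intro norm_summable_imp_has_sum)
  from has_sum_cmult_right[OF this, of "exp (- w * of_int M)"]
  have geo: "((\<lambda>n. exp (- w * of_int M) * exp (- w) ^ n) has_sum (exp (- w * of_int M) / (1 - exp (- w)))) UNIV" by simp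
  have e: "exp (- (w * (of_int M + real n))) = exp (- (w * of_int M)) * exp (- w) ^ n" for n
    by (simp add: algebra_simps flip: exp_add exp_of_nat_mult)
  have 1: "((\<lambda>j::int. exp (- w * (of_int \<bar>j\<bar> - 1))) has_sum (exp (- w * of_int M) / (1 - exp (- w)))) {j. j > M}"
    using geo
    by (rule has_sum_reindex_bij_witness[where i="\<lambda>j. nat (j - M - 1)" and j="\<lambda>n. M + 1 + int n", THEN iffD1, rotated -1])
       (use M in \<open>auto simp: e\<close>)
  have 2: "((\<lambda>j::int. exp (- w * (of_int \<bar>j\<bar> - 1))) has_sum (exp (- w * of_int M) / (1 - exp (- w)))) {j. - j > M}"
    using 1
    by (rule has_sum_reindex_bij_witness[where i=uminus and j=uminus, THEN iffD1, rotated -1]) auto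
  have "{j. j > M} \<union> {j. - j > M} = {j. \<bar>j\<bar> > M}" "{j. j > M} \<inter> {j. - j > M} = {}" using M by auto
  with has_sum_Un_disjoint[OF 1 2] show ?thesis by simp
qed

text \<open>A plain geometric series in \<open>- 2 - n\<close>; the row \<open>n = - 2\<close> is
  its first term and supplies the numerator.\<close>

lemma has_sum_geometric_south:
  fixes Q :: complex
  assumes "Re Q > 0"
  shows "((\<lambda>n::int. exp (of_int n * Q)) has_sum exp (- 2 * Q) / (1 - exp (- Q))) {..- 2}"
proof -
  have "norm (exp (- Q)) < 1" using assms by simp
  then have "(\<lambda>n. exp (- Q) ^ n) sums (1 / (1 - exp (- Q)))" "summable (\<lambda>n. norm (exp (- Q) ^ n))"
    by (rule geometric_sums, simp only: norm_power, intro summable_geometric, simp)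
  then have "((\<lambda>n. exp (- Q) ^ n) has_sum (1 / (1 - exp (- Q)))) UNIV"
    by (intro norm_summable_imp_has_sum)
  from has_sum_cmult_right[OF this, of "exp (- 2 * Q)"]
  have geo: "((\<lambda>n. exp (- 2 * Q) * exp (- Q) ^ n) has_sum (exp (- 2 * Q) / (1 - exp (- Q)))) UNIV" by simp
  have e: "exp ((- 2 - of_nat n) * Q) = exp (- (2 * Q)) * exp (- Q) ^ n" for n
  proof -
    have "(- 2 - of_nat n) * Q = - (2 * Q) + of_nat n * (- Q)" by (simp add: algebra_simps)
    then show ?thesis by (simp only: exp_add exp_of_nat_mult)
  qed
  show ?thesis
    using geo
    by (rule has_sum_reindex_bij_witness[where i="\<lambda>j. nat (- 2 - j)" and j="\<lambda>n. - 2 - int n", THEN iffD1, rotated -1])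
       (auto simp: e)
qed

text \<open>The kernels are \<open>infsum\<close>s of whole matrices, so an entry can be extracted
  only once all four entries are known to be summable. The complex limits are automatically
  real.\<close>

lemma infsum_matrix_entry:
  fixes f :: "'b \<Rightarrow> real^2^2" and V :: "2 \<Rightarrow> 2 \<Rightarrow> complex"
  assumes "\<And>p q. ((\<lambda>x. complex_of_real (f x $ p $ q)) has_sum V p q) A"
  shows "complex_of_real (infsum f A $ p $ q) = V p q"
proof -
  have Re: "((\<lambda>x. f x $ p $ q) has_sum Re (V p q)) A" for p q
    using has_sum_bounded_linear[OF bounded_linear_Re assms[of p q]] by (simp add: comp_def)
  have V: "V p q = of_real (Re (V p q))"
    using has_sum_of_real[OF Re[of p q]] assms[of p q] by (metis has_sum_unique)
  have "(f has_sum (\<chi> p q. Re (V p q))) A"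
    by (intro has_sum_vec_componentwise) (simp add: Re)
  then have "infsum f A = (\<chi> p q. Re (V p q))" by (rule infsumI)
  then show ?thesis using V by simp
qed

lemma infsum_G_MS_row:
  assumes b: "b > 0" and d: "d > 0" and y: "y > 0"
  shows "complex_of_real ((\<Sum>\<^sub>\<infinity>m::int. G_MS b (vector [x - of_int m * d, y])) $ p $ q) =
     (\<Sum>\<^sub>\<infinity>j. of_real (1 / (2 * b\<^sup>2 * d)) * (stokes_mode b y (alpha d j) $ p $ q * cis (alpha d j * x)))"
  unfolding infsum_matrix_entry[OF stokes_row_sum(2)[OF b d y]]
  by (rule infsum_cmult_right[OF stokes_row_sum(1)[OF b d y], symmetric])

lemma has_sum_finite_sum:
  fixes f :: "'i \<Rightarrow> 'b \<Rightarrow> 'a::topological_comm_monoid_add"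
  assumes "finite I" "\<And>i. i \<in> I \<Longrightarrow> (f i has_sum S i) A"
  shows "((\<lambda>x. \<Sum>i\<in>I. f i x) has_sum (\<Sum>i\<in>I. S i)) A"
  using assms by (induction I rule: finite_induct) (auto intro!: has_sum_add)

section \<open>Separation of target, source and row\<close>

lemma abs_alpha: "d > 0 \<Longrightarrow> \<bar>alpha d m\<bar> = 2 * pi / d * \<bar>of_int m\<bar>"
  by (simp add: alpha_def abs_mult)

lemma chi_eq_freq: "chi d b m = freq b (alpha d m)"
  by (simp add: chi_def freq_def)

text \<open>The scalars in front of the identity blocks of \<open>L_beta_south\<close> and, for
  \<open>b = 0\<close>, of \<open>L_south\<close>; \<open>south_right\<close> does the same for the
  right factors. This treats both parts of the kernel at once.\<close>

definition south_left :: "real \<Rightarrow> real \<Rightarrow> real^2 \<Rightarrow> int \<Rightarrow> complex" where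
  "south_left b d t m = of_real (exp (- freq b (alpha d m) * t $ 2)) * exp (\<i> * of_real (alpha d m * t $ 1))"

definition south_right :: "real \<Rightarrow> real \<Rightarrow> real^2 \<Rightarrow> int \<Rightarrow> complex" where
  "south_right b d s m = of_real (exp (freq b (alpha d m) * s $ 2)) * exp (- \<i> * of_real (alpha d m * s $ 1))"

definition south_entry :: "real \<Rightarrow> real \<Rightarrow> real \<Rightarrow> real \<Rightarrow> real^2 \<Rightarrow> real^2 \<Rightarrow> int \<Rightarrow> complex^2^2" where
  "south_entry d \<xi> \<eta> b t s m = (\<chi> p q.
     south_left b d t m * D_beta_south_block d \<xi> \<eta> b m $ p $ q * south_right b d s m +
     south_left 0 d t m * D_south_block d \<xi> \<eta> b m $ p $ q * south_right 0 d s m)"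

text \<open>Common form of \<open>Q_beta\<close> (for \<open>c = b\<close>) and \<open>Q\<close>
  (for \<open>c = 0\<close>).\<close>

definition row_exponent :: "real \<Rightarrow> real \<Rightarrow> real \<Rightarrow> real \<Rightarrow> int \<Rightarrow> complex" where
  "row_exponent c d \<xi> \<eta> m = of_real (freq c (alpha d m) * \<eta>) - \<i> * of_real (alpha d m * \<xi>)"

text \<open>The total exponent is linear in the coordinate differences, so it splits into a target,
  a source and a row contribution. This separation of variables is the origin of the low
  rank.\<close>

lemma mode_south_factor:
  "mode c (t $ 2 - s $ 2 - of_int n * \<eta>) (alpha d m) $ p $ q * cis (alpha d m * (t $ 1 - s $ 1 - of_int n * \<xi>)) =
     symbol c (alpha d m) $ p $ q * (south_left c d t m * south_right c d s m) * exp (of_int n * row_exponent c d \<xi> \<eta> m)"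
proof -
  let ?f = "freq c (alpha d m)" and ?a = "alpha d m"
  have "of_real (exp (- ?f * (t $ 2 - s $ 2 - of_int n * \<eta>))) * cis (?a * (t $ 1 - s $ 1 - of_int n * \<xi>)) =
    (south_left c d t m * south_right c d s m) * exp (of_int n * row_exponent c d \<xi> \<eta> m)"
    unfolding south_left_def south_right_def cis_conv_exp exp_of_real[symmetric] exp_add[symmetric] row_exponent_def
    by (rule arg_cong[of _ _ exp]) (simp add: algebra_simps)
  then show ?thesis by (simp add: mode_def mult.assoc)
qed

lemma mode_south_has_sum:
  assumes "freq c (alpha d m) * \<eta> > 0"
  shows "((\<lambda>n. mode c (t $ 2 - s $ 2 - of_int n * \<eta>) (alpha d m) $ p $ q * cis (alpha d m * (t $ 1 - s $ 1 - of_int n * \<xi>)))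
     has_sum symbol c (alpha d m) $ p $ q * (south_left c d t m * south_right c d s m) *
       (exp (- 2 * row_exponent c d \<xi> \<eta> m) / (1 - exp (- row_exponent c d \<xi> \<eta> m)))) {..- 2}"
  unfolding mode_south_factor
  by (intro has_sum_cmult_right has_sum_geometric_south) (use assms in \<open>simp add: row_exponent_def\<close>)

lemma D_beta_south_block_entry:
  "D_beta_south_block d \<xi> \<eta> b m $ p $ q = of_real (1 / (2 * b\<^sup>2 * d)) *
     (exp (- 2 * Q_beta d \<xi> \<eta> b m) / (1 - exp (- Q_beta d \<xi> \<eta> b m))) * symbol b (alpha d m) $ p $ q"
  unfolding D_beta_south_block_def cscale_def symbol_def chi_eq_freq by simp

lemma symbol_0_22: "symbol 0 k $ 2 $ 2 = - of_real \<bar>k\<bar>"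
proof -
  have "- k\<^sup>2 / \<bar>k\<bar> = - \<bar>k\<bar>" by (cases "k = 0") (simp_all add: power2_eq_square abs_if)
  then show ?thesis by (simp only: symbol_def mat2_nth freq_0 of_real_minus)
qed

text \<open>The minus sign is that of the part with \<open>b = 0\<close> in
  \<open>stokes_mode\<close>; since the block already contains it, the two products can be
  added.\<close>

lemma D_south_block_entry:
  "m \<noteq> 0 \<Longrightarrow> D_south_block d \<xi> \<eta> b m $ p $ q = - (of_real (1 / (2 * b\<^sup>2 * d)) *
     (exp (- 2 * Q d \<xi> \<eta> m) / (1 - exp (- Q d \<xi> \<eta> m))) * symbol 0 (alpha d m) $ p $ q)"
proof -
  assume m: "m \<noteq> 0"
  have "mat2 (of_real (- \<bar>alpha d m\<bar>)) (- \<i> * of_real (alpha d m))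
           (- \<i> * of_real (alpha d m)) (of_real \<bar>alpha d m\<bar>) $ p $ q = - (symbol 0 (alpha d m) $ p $ q)"
    using exhaust_2[of p] exhaust_2[of q]
    by (elim disjE) (simp_all add: symbol_0_22, simp_all add: symbol_def)
  then show ?thesis using m unfolding D_south_block_def cscale_def by simp
qed

lemma stokes_mode_south_has_sum:
  assumes b: "b > 0" and d: "d > 0" and \<eta>: "\<eta> > 0"
  shows "((\<lambda>n. of_real (1 / (2 * b\<^sup>2 * d)) * (stokes_mode b (t $ 2 - s $ 2 - of_int n * \<eta>) (alpha d m) $ p $ q *
      cis (alpha d m * (t $ 1 - s $ 1 - of_int n * \<xi>)))) has_sum south_entry d \<xi> \<eta> b t s m $ p $ q) {..- 2}"
proof -
  let ?c = "of_real (1 / (2 * b\<^sup>2 * d)) :: complex"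
  let ?z = "\<lambda>n. t $ 2 - s $ 2 - of_int n * \<eta>" and ?C = "\<lambda>n. cis (alpha d m * (t $ 1 - s $ 1 - of_int n * \<xi>))"
  have "freq b (alpha d m) * \<eta> > 0" using freq_ge[of b "alpha d m"] b \<eta> by simp
  from has_sum_cmult_right[OF mode_south_has_sum[OF this], of ?c]
  have 1: "((\<lambda>n. ?c * (mode b (?z n) (alpha d m) $ p $ q * ?C n)) has_sum
      south_left b d t m * D_beta_south_block d \<xi> \<eta> b m $ p $ q * south_right b d s m) {..- 2}"
    unfolding D_beta_south_block_entry Q_beta_def chi_eq_freq row_exponent_def by (simp add: mult_ac)
  have 2: "((\<lambda>n. - ?c * (mode 0 (?z n) (alpha d m) $ p $ q * ?C n)) has_sum
      south_left 0 d t m * D_south_block d \<xi> \<eta> b m $ p $ q * south_right 0 d s m) {..- 2}"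
  \<comment> \<open>For \<open>m = 0\<close> the exponent of the logarithmic part is 0 and the
    geometric series over the rows would diverge, but its coefficient \<open>symbol 0 0\<close>
    vanishes, in agreement with the zero block.\<close>
  proof (cases "m = 0")
    case True
    have "symbol 0 0 $ p $ q = 0"
      using exhaust_2[of p] exhaust_2[of q] by (auto simp: symbol_def)
    then show ?thesis using True by (simp add: mode_def alpha_def D_south_block_def)
  next
    case False
    then have "freq 0 (alpha d m) * \<eta> > 0" using \<eta> d by (simp add: alpha_def)
    from has_sum_cmult_right[OF mode_south_has_sum[OF this], of "- ?c"]
    show ?thesis unfolding D_south_block_entry[OF False] Q_def row_exponent_def freq_0 by (simp add: mult_ac)
  qed
  have "((\<lambda>n. ?c * (mode b (?z n) (alpha d m) $ p $ q * ?C n) + - ?c * (mode 0 (?z n) (alpha d m) $ p $ q * ?C n)) has_sum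
      south_entry d \<xi> \<eta> b t s m $ p $ q) {..- 2}"
    unfolding south_entry_def using has_sum_add[OF 1 2] by simp
  also have "(\<lambda>n. ?c * (mode b (?z n) (alpha d m) $ p $ q * ?C n) + - ?c * (mode 0 (?z n) (alpha d m) $ p $ q * ?C n)) =
     (\<lambda>n. ?c * (stokes_mode b (?z n) (alpha d m) $ p $ q * ?C n))"
    by (simp add: stokes_mode_def algebra_simps)
  finally show ?thesis .
qed

text \<open>\<open>trunc_M\<close> is the least integer satisfying the second inequality. Its factor
  \<open>1 - exp (- w)\<close> is the denominator of the geometric tail.\<close>

lemma trunc_M_bound:
  assumes d: "d > 0" and \<eta>: "\<eta> > 0" and \<epsilon>: "0 < \<epsilon>" "\<epsilon> < 1"
  defines "w \<equiv> 2 * pi * \<eta> / d"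
  shows "trunc_M d \<eta> \<epsilon> \<ge> 0" and "exp (- w * of_int (trunc_M d \<eta> \<epsilon>)) \<le> (1 - exp (- w)) * \<epsilon>"
proof -
  have w: "w > 0" using d \<eta> by (simp add: w_def)
  let ?a = "(1 - exp (- w)) * \<epsilon>"
  have a: "0 < ?a" "?a \<le> 1"
    using w \<epsilon> by (auto intro!: mult_le_one)
  have eq: "d / (2 * pi * \<eta>) * ln (1 / (1 - exp (- 2 * pi * \<eta> / d)) * (1 / \<epsilon>)) = - ln ?a / w"
  proof -
    have "1 / (1 - exp (- 2 * pi * \<eta> / d)) * (1 / \<epsilon>) = inverse ?a"
      by (simp add: w_def field_simps)
    moreover have "ln (inverse ?a) = - ln ?a" by (rule ln_inverse)
    ultimately show ?thesis by (simp add: w_def)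
  qed
  have M: "of_int (trunc_M d \<eta> \<epsilon>) \<ge> - ln ?a / w" unfolding trunc_M_def eq by (rule le_of_int_ceiling)
  have "ln ?a \<le> 0" using a by simp
  then have "- ln ?a / w \<ge> 0" using w by (intro divide_nonneg_pos) auto
  with M have "(of_int (trunc_M d \<eta> \<epsilon>) :: real) \<ge> 0" by linarith
  then show "trunc_M d \<eta> \<epsilon> \<ge> 0" by simp
  have "- ln ?a \<le> w * of_int (trunc_M d \<eta> \<epsilon>)" using M unfolding pos_divide_le_eq[OF w] by (simp only: mult.commute[of w])
  then have "exp (- w * of_int (trunc_M d \<eta> \<epsilon>)) \<le> exp (ln ?a)" by simp
  then show "exp (- w * of_int (trunc_M d \<eta> \<epsilon>)) \<le> ?a" using a by simp
qed

text \<open>The bound is a product of a function of the row and a function of the frequency, so the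
  tail can be summed in one variable after the other. The exponent \<bar>j\<bar> - 1 keeps the full
  rate \<open>w\<close> in the frequency; only the row gives up half of its rate.\<close>

lemma stokes_mode_tail_term:
  fixes j n :: int
  assumes b: "b > 0" and d: "d > 0" and \<eta>: "\<eta> > 0" and dy: "\<bar>dy\<bar> \<le> \<eta>" and n: "n \<le> - 2" and j: "\<bar>j\<bar> \<ge> 1"
  defines "w \<equiv> 2 * pi * \<eta> / d"
  shows "norm (stokes_mode b (dy - of_int n * \<eta>) (alpha d j) $ p $ q) \<le>
     b\<^sup>2 * (d / (2 * pi) + 3 * \<eta>) * (2 / w) * exp (w / 2) * exp (- (w / 2) * \<bar>of_int n\<bar>) * exp (- w * (of_int \<bar>j\<bar> - 1))"
proof -
  have w: "w > 0" using d \<eta> by (simp add: w_def)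
  \<comment> \<open>The vertical distance to row \<open>n\<close> in units of \<open>\<eta>\<close>,
    less the one unit by which target and source may differ; for \<open>n = - 2\<close> it equals
    1.\<close>
  define i where "i = real_of_int (- n - 1)"
  have i1: "i \<ge> 1" and abs_n: "\<bar>real_of_int n\<bar> = i + 1" using n by (simp_all add: i_def)
  define z where "z = dy - of_int n * \<eta>"
  have z_eq: "z = dy + i * \<eta> + \<eta>" by (simp add: z_def i_def algebra_simps)
  have z1: "i * \<eta> \<le> z" and z2: "z \<le> (i + 2) * \<eta>" using dy unfolding z_eq by (auto simp: algebra_simps)
  have "0 < i * \<eta>" using i1 \<eta> by simp
  then have z0: "z > 0" using z1 by linarith
  have a0: "2 * pi / d > 0" using d by simp
  have J: "real_of_int \<bar>j\<bar> \<ge> 1" using j by linarith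
  have ja: "\<bar>alpha d j\<bar> = 2 * pi / d * real_of_int \<bar>j\<bar>" using abs_alpha[OF d, of j] by simp
  have "2 * pi / d * 1 \<le> \<bar>alpha d j\<bar>" unfolding ja using a0 J by (intro mult_left_mono) auto
  then have "2 * pi / d \<le> \<bar>alpha d j\<bar>" by simp
  from norm_stokes_mode_le[OF b z0 a0 this]
  have "norm (stokes_mode b z (alpha d j) $ p $ q) \<le> b\<^sup>2 * (1 / (2 * pi / d) + z) * exp (- \<bar>alpha d j\<bar> * z)" .
  also have "\<dots> \<le> b\<^sup>2 * ((d / (2 * pi) + 3 * \<eta>) * i) * (exp (- w * i) * exp (- w * (of_int \<bar>j\<bar> - 1)))"
  proof (intro mult_mono)
    have "d / (2 * pi) * 1 \<le> d / (2 * pi) * i" using i1 d by (intro mult_left_mono) auto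
    moreover have "(i + 2) * \<eta> \<le> 3 * \<eta> * i"
    proof -
      have "2 * \<eta> * 1 \<le> 2 * \<eta> * i" using i1 \<eta> by (intro mult_left_mono) auto
      then show ?thesis by (simp add: algebra_simps)
    qed
    moreover have "1 / (2 * pi / d) = d / (2 * pi)" by simp
    ultimately show "1 / (2 * pi / d) + z \<le> (d / (2 * pi) + 3 * \<eta>) * i"
      using z2 unfolding distrib_right by linarith
    \<comment> \<open>decouples the decay in the row number from the decay in the frequency\<close>
    have "(real_of_int \<bar>j\<bar> - 1) * (i - 1) \<ge> 0" using J i1 by simp
    then have "i + (real_of_int \<bar>j\<bar> - 1) \<le> real_of_int \<bar>j\<bar> * i" by (simp add: algebra_simps)
    then have "w * (i + (real_of_int \<bar>j\<bar> - 1)) \<le> w * (real_of_int \<bar>j\<bar> * i)" using w by (intro mult_left_mono) auto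
    also have "w * (real_of_int \<bar>j\<bar> * i) = \<bar>alpha d j\<bar> * (i * \<eta>)" unfolding ja w_def by simp
    also have "\<dots> \<le> \<bar>alpha d j\<bar> * z" using z1 by (intro mult_left_mono) auto
    finally have "- \<bar>alpha d j\<bar> * z \<le> - w * i + - w * (real_of_int \<bar>j\<bar> - 1)" by (simp add: algebra_simps)
    then show "exp (- \<bar>alpha d j\<bar> * z) \<le> exp (- w * i) * exp (- w * (of_int \<bar>j\<bar> - 1))"
      by (simp only: exp_add[symmetric] exp_le_cancel_iff)
  qed (use z0 i1 d \<eta> in auto)
  also have "\<dots> = b\<^sup>2 * (d / (2 * pi) + 3 * \<eta>) * (i * exp (- w * i)) * exp (- w * (of_int \<bar>j\<bar> - 1))"
    by (simp add: mult_ac)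
  also have "\<dots> \<le> b\<^sup>2 * (d / (2 * pi) + 3 * \<eta>) * (2 / w * exp (w / 2) * exp (- (w / 2) * \<bar>of_int n\<bar>)) * exp (- w * (of_int \<bar>j\<bar> - 1))"
  proof (intro mult_right_mono mult_left_mono)
    \<comment> \<open>The factor \<open>i\<close>, which stems from the height \<open>z\<close> in
      the bound for the mode, is paid for with half of the decay in the row;
      \<open>exp (w / 2)\<close> then converts \<open>i\<close> into
      \<open>\<bar>n\<bar> = i + 1\<close>.\<close>
    have "i * exp (- w * i) \<le> 2 / w * exp (- (w / 2) * i)"
      using abs_times_exp_le[OF w, of 0 1 i] i1 by simp
    also have "exp (- (w / 2) * i) = exp (w / 2) * exp (- (w / 2) * \<bar>of_int n\<bar>)"
      unfolding abs_n by (simp add: algebra_simps flip: exp_add)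
    finally show "i * exp (- w * i) \<le> 2 / w * exp (w / 2) * exp (- (w / 2) * \<bar>of_int n\<bar>)" by (simp add: mult.assoc)
  qed (use d \<eta> in auto)
  finally show ?thesis unfolding z_def by (simp only: mult.assoc)
qed

text \<open>The constant is \<open>2 * K * S\<close>: the 2 counts positive and negative
  frequencies, \<open>K\<close> collects the constants of a single term, and \<open>S\<close> is the
  sum of the row decay. Points enter only through the vertical difference, which makes the constant
  uniform.\<close>

lemma K2_south_approx:
  assumes b: "b > 0" and d: "d > 0" and \<eta>: "\<eta> > 0"
  shows "\<exists>C. \<forall>\<epsilon> t s p q. 0 < \<epsilon> \<longrightarrow> \<epsilon> < 1 \<longrightarrow> \<bar>t $ 2 - s $ 2\<bar> \<le> \<eta> \<longrightarrow>
    norm (of_real (K2_south d \<xi> \<eta> b t s $ p $ q) -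
      (\<Sum>m\<in>{- trunc_M d \<eta> \<epsilon>..trunc_M d \<eta> \<epsilon>}. south_entry d \<xi> \<eta> b t s m $ p $ q)) \<le> C * \<epsilon>"
proof -
  define w where "w = 2 * pi * \<eta> / d"
  have w: "w > 0" using d \<eta> by (simp add: w_def)
  define c where "c = 1 / (2 * b\<^sup>2 * d)"
  have c: "c > 0" using b d by (simp add: c_def)
  define K where "K = c * (b\<^sup>2 * (d / (2 * pi) + 3 * \<eta>) * (2 / w) * exp (w / 2))"
  have K: "K \<ge> 0" unfolding K_def using c d \<eta> w by simp
  define e where "e n = exp (- (w / 2) * \<bar>of_int n\<bar>)" for n :: int
  have e_sum: "e summable_on {..- 2}"
    unfolding e_def using summable_on_exp_minus_abs_int[of "w / 2"] w
    by (intro summable_on_subset_banach[where B="{..- 2}" and A=UNIV]) auto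
  define S where "S = infsum e {..- 2}"
  have "norm (of_real (K2_south d \<xi> \<eta> b t s $ p $ q) -
      (\<Sum>m\<in>{- trunc_M d \<eta> \<epsilon>..trunc_M d \<eta> \<epsilon>}. south_entry d \<xi> \<eta> b t s m $ p $ q)) \<le> 2 * K * S * \<epsilon>"
    if \<epsilon>: "0 < \<epsilon>" "\<epsilon> < 1" and dy: "\<bar>t $ 2 - s $ 2\<bar> \<le> \<eta>" for \<epsilon> t s p q
  proof -
    define M where "M = trunc_M d \<eta> \<epsilon>"
    have M0: "M \<ge> 0" and Me: "exp (- w * of_int M) \<le> (1 - exp (- w)) * \<epsilon>"
      using trunc_M_bound[OF d \<eta> \<epsilon>] unfolding M_def w_def by auto
    define z where "z n = t $ 2 - s $ 2 - of_int n * \<eta>" for n :: int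
    define X where "X n = t $ 1 - s $ 1 - of_int n * \<xi>" for n :: int
    \<comment> \<open>The contribution of frequency \<open>j\<close> to row \<open>n\<close>. The
      terms with \<open>\<bar>j\<bar> > M\<close>, collected in \<open>\<tau>\<close>, make up the
      whole error.\<close>
    define a where "a p q j n = of_real c * (stokes_mode b (z n) (alpha d j) $ p $ q * cis (alpha d j * X n))" for p q :: 2 and j n :: int
    define \<tau> where "\<tau> p q n = (\<Sum>\<^sub>\<infinity>j\<in>{j. \<bar>j\<bar> > M}. a p q j n)" for p q n
    have z0: "z n > 0" if "n \<le> - 2" for n
    proof -
      have "2 * \<eta> \<le> - real_of_int n * \<eta>" using that \<eta> by (intro mult_right_mono) auto
      then show ?thesis using dy \<eta> unfolding z_def by linarith
    qed
    have a_sum: "(\<lambda>j. a p q j n) summable_on UNIV" if "n \<le> - 2" for p q n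
      unfolding a_def by (intro summable_on_cmult_right stokes_row_sum(1)[OF b d z0[OF that]])
    have row: "complex_of_real ((\<Sum>\<^sub>\<infinity>m\<in>UNIV. G_MS b (t - (s + lattice_pt d \<xi> \<eta> m n))) $ p $ q) =
        (\<Sum>j\<in>{- M..M}. a p q j n) + \<tau> p q n" if n: "n \<le> - 2" for p q n
    proof -
      have "t - (s + lattice_pt d \<xi> \<eta> m n) = vector [X n - of_int m * d, z n]" for m
        by (simp add: vec_eq_iff forall_2 lattice_pt_def e1_def e2_def X_def z_def algebra_simps)
      then have "complex_of_real ((\<Sum>\<^sub>\<infinity>m\<in>UNIV. G_MS b (t - (s + lattice_pt d \<xi> \<eta> m n))) $ p $ q) = (\<Sum>\<^sub>\<infinity>j. a p q j n)"
        using infsum_G_MS_row[OF b d z0[OF n], of "X n" p q] by (simp add: a_def c_def)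
      also have "\<dots> = (\<Sum>\<^sub>\<infinity>j\<in>{- M..M} \<union> {j. \<bar>j\<bar> > M}. a p q j n)"
      proof -
        have "(UNIV :: int set) = {- M..M} \<union> {j. \<bar>j\<bar> > M}" by auto
        then show ?thesis by (simp only:)
      qed
      also have "(\<Sum>\<^sub>\<infinity>j\<in>{- M..M} \<union> {j. \<bar>j\<bar> > M}. a p q j n) = (\<Sum>\<^sub>\<infinity>j\<in>{- M..M}. a p q j n) + \<tau> p q n"
        unfolding \<tau>_def
        by (intro infsum_Un_disjoint summable_on_subset_banach[OF a_sum[OF n]]) auto
      also have "(\<Sum>\<^sub>\<infinity>j\<in>{- M..M}. a p q j n) = (\<Sum>j\<in>{- M..M}. a p q j n)" by simp
      finally show ?thesis .
    qed
    have \<tau>_le: "norm (\<tau> p q n) \<le> 2 * K * \<epsilon> * e n" if n: "n \<le> - 2" for p q n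
    proof -
      have "norm (\<tau> p q n) \<le> K * e n * (2 * exp (- w * of_int M) / (1 - exp (- w)))"
      proof (rule norm_infsum_le)
        show "((\<lambda>j. a p q j n) has_sum \<tau> p q n) {j. \<bar>j\<bar> > M}"
          unfolding \<tau>_def by (intro has_sum_infsum summable_on_subset_banach[OF a_sum[OF n]]) auto
        show "((\<lambda>j. K * e n * exp (- w * (of_int \<bar>j\<bar> - 1))) has_sum K * e n * (2 * exp (- w * of_int M) / (1 - exp (- w)))) {j. \<bar>j\<bar> > M}"
          by (intro has_sum_cmult_right has_sum_geometric_tail w M0)
        show "norm (a p q j n) \<le> K * e n * exp (- w * (of_int \<bar>j\<bar> - 1))" if "j \<in> {j. \<bar>j\<bar> > M}" for j
        proof -
          have "\<bar>j\<bar> \<ge> 1" using that M0 by auto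
          from mult_left_mono[OF stokes_mode_tail_term[OF b d \<eta> dy n this, of p q], of c] c
          show ?thesis by (simp add: a_def norm_mult K_def e_def z_def w_def mult.assoc)
        qed
      qed
      also have "\<dots> = 2 * K * e n * (exp (- w * of_int M) / (1 - exp (- w)))" by simp
      also have "\<dots> \<le> 2 * K * e n * \<epsilon>"
        using Me w K by (intro mult_left_mono) (auto simp: pos_divide_le_eq mult.commute e_def)
      finally show ?thesis by (simp add: mult_ac)
    qed
    have e_sum': "(\<lambda>n. 2 * K * \<epsilon> * e n) summable_on {..- 2}"
      by (intro summable_on_cmult_right e_sum)
    have \<tau>_sum: "\<tau> p q summable_on {..- 2}" for p q
      by (rule abs_summable_summable, rule summable_on_comparison_test[OF e_sum']) (use \<tau>_le in auto)
    have a_n: "((\<lambda>n. a p q m n) has_sum south_entry d \<xi> \<eta> b t s m $ p $ q) {..- 2}" for p q m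
      unfolding a_def c_def z_def X_def by (rule stokes_mode_south_has_sum[OF b d \<eta>])
    \<comment> \<open>The retained frequencies form a finite sum and may be summed over the rows one
      at a time; the tail is an absolutely convergent series over the rows by
      \<open>\<tau>_le\<close>.\<close>
    have "((\<lambda>n. complex_of_real ((\<Sum>\<^sub>\<infinity>m\<in>UNIV. G_MS b (t - (s + lattice_pt d \<xi> \<eta> m n))) $ p $ q)) has_sum
        (\<Sum>m\<in>{- M..M}. south_entry d \<xi> \<eta> b t s m $ p $ q) + infsum (\<tau> p q) {..- 2}) {..- 2}" for p q
    proof -
      have "((\<lambda>n. (\<Sum>j\<in>{- M..M}. a p q j n) + \<tau> p q n) has_sum
        (\<Sum>m\<in>{- M..M}. south_entry d \<xi> \<eta> b t s m $ p $ q) + infsum (\<tau> p q) {..- 2}) {..- 2}"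
        by (intro has_sum_add has_sum_finite_sum finite_atLeastAtMost_int a_n has_sum_infsum \<tau>_sum) 
      then show ?thesis by (rule has_sum_cong[THEN iffD1, rotated]) (simp add: row)
    qed
    from infsum_matrix_entry[OF this, of p q]
    have "complex_of_real (K2_south d \<xi> \<eta> b t s $ p $ q) - (\<Sum>m\<in>{- M..M}. south_entry d \<xi> \<eta> b t s m $ p $ q) = infsum (\<tau> p q) {..- 2}"
      unfolding K2_south_def by simp
    also have "norm \<dots> \<le> 2 * K * \<epsilon> * S"
      unfolding S_def
      by (rule norm_infsum_le[OF has_sum_infsum[OF \<tau>_sum] has_sum_cmult_right[OF has_sum_infsum[OF e_sum]]])
         (use \<tau>_le in auto)
    finally show ?thesis unfolding M_def by (simp add: mult_ac)
  qed
  then show ?thesis by blast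
qed

text \<open>Evenness of the kernel together with the point reflection of both lattice indices. The
  bound on the vertical difference and \<open>n \<ge> 2\<close> keep the reflected point in the
  upper half plane, as \<open>G_MS_minus\<close> requires.\<close>

lemma K2_north_eq_K2_south:
  assumes b: "b > 0" and \<eta>: "\<eta> > 0" and dy: "\<bar>t $ 2 - s $ 2\<bar> \<le> \<eta>"
  shows "K2_north d \<xi> \<eta> b t s = K2_south d \<xi> \<eta> b s t"
proof -
  have refl: "G_MS b (s - (t + lattice_pt d \<xi> \<eta> (- m) (- n))) = G_MS b (t - (s + lattice_pt d \<xi> \<eta> m n))" if "n \<ge> 2" for m n
  proof -
    have "2 * \<eta> \<le> real_of_int n * \<eta>" using that \<eta> by (intro mult_right_mono) auto
    moreover have "(s - (t + lattice_pt d \<xi> \<eta> (- m) (- n))) $ 2 = s $ 2 - t $ 2 + real_of_int n * \<eta>"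
      by (simp add: lattice_pt_def e1_def e2_def)
    ultimately have "(s - (t + lattice_pt d \<xi> \<eta> (- m) (- n))) $ 2 > 0"
      using dy \<eta> by linarith
    from G_MS_minus[OF b this] show ?thesis
      by (simp add: lattice_pt_def algebra_simps)
  qed
  have "K2_north d \<xi> \<eta> b t s = (\<Sum>\<^sub>\<infinity>n\<in>{2..}. \<Sum>\<^sub>\<infinity>m\<in>UNIV. G_MS b (s - (t + lattice_pt d \<xi> \<eta> (- m) (- n))))"
    unfolding K2_north_def by (intro infsum_cong) (simp add: refl)
  also have "\<dots> = (\<Sum>\<^sub>\<infinity>n\<in>{2..}. \<Sum>\<^sub>\<infinity>m\<in>UNIV. G_MS b (s - (t + lattice_pt d \<xi> \<eta> m (- n))))"
    by (intro infsum_cong infsum_reindex_bij_witness[of _ uminus uminus]) auto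
  also have "\<dots> = K2_south d \<xi> \<eta> b s t"
    unfolding K2_south_def by (rule infsum_reindex_bij_witness[of _ uminus uminus]) auto
  finally show ?thesis .
qed

section \<open>The factorization\<close>

text \<open>The outer blocks are multiples of the identity and commute with everything, so the
  triple product collapses to one sum over frequencies.\<close>

lemma LDR_scalar_entry:
  "LDR M (\<lambda>l m. cscale (u l m) (mat 1)) (block_diag D) (\<lambda>m j. cscale (v m j) (mat 1)) l j $ p $ q =
     (\<Sum>m\<in>{- M..M}. u l m * D m $ p $ q * v m j)"
proof -
  have 1: "(\<Sum>k\<in>{- M..M}. cscale (u l k) (mat 1) ** block_diag D k m) = cscale (u l m) (D m)"
    if "m \<in> {- M..M}" for m
  proof -
    have "(\<Sum>k\<in>{- M..M}. cscale (u l k) (mat 1) ** block_diag D k m) =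
      (\<Sum>k\<in>{- M..M}. if k = m then cscale (u l m) (mat 1) ** D m else 0)"
      by (intro sum.cong refl) (auto simp: block_diag_def matrix_matrix_mult_def vec_eq_iff)
    also have "\<dots> = cscale (u l m) (mat 1) ** D m" using that by simp
    also have "\<dots> = cscale (u l m) (D m)"
      by (simp add: vec_eq_iff forall_2 matrix_matrix_mult_def sum_2 cscale_def mat_def)
    finally show ?thesis .
  qed
  have 2: "A ** cscale c (mat 1) = cscale c A" for A :: "complex^2^2" and c
    by (simp add: vec_eq_iff forall_2 matrix_matrix_mult_def sum_2 cscale_def mat_def mult.commute)
  have "LDR M (\<lambda>l m. cscale (u l m) (mat 1)) (block_diag D) (\<lambda>m j. cscale (v m j) (mat 1)) l j =
     (\<Sum>m\<in>{- M..M}. cscale (v m j) (cscale (u l m) (D m)))"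
    unfolding LDR_def block_mult_def by (intro sum.cong refl) (simp only: 1 2)
  then show ?thesis by (simp add: cscale_def mult_ac)
qed

lemma LDR_south_entry:
  "(LDR M (L_beta_south d b t) (D_beta_south d \<xi> \<eta> b) (R_beta_south d b s) l j +
    LDR M (L_south d t) (D_south d \<xi> \<eta> b) (R_south d s) l j) $ p $ q =
   (\<Sum>m\<in>{- M..M}. south_entry d \<xi> \<eta> b (t l) (s j) m $ p $ q)"
proof -
  have "L_beta_south d b t = (\<lambda>l m. cscale (south_left b d (t l) m) (mat 1))"
    "R_beta_south d b s = (\<lambda>m j. cscale (south_right b d (s j) m) (mat 1))"
    "L_south d t = (\<lambda>l m. cscale (south_left 0 d (t l) m) (mat 1))"
    "R_south d s = (\<lambda>m j. cscale (south_right 0 d (s j) m) (mat 1))"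
    by (simp_all add: L_beta_south_def R_beta_south_def L_south_def R_south_def south_left_def south_right_def chi_eq_freq)
  then show ?thesis
    by (simp add: D_beta_south_def D_south_def LDR_scalar_entry south_entry_def sum.distrib)
qed

text \<open>Conjugation reverses the phases, so the northern left factor is the conjugate of the
  southern right factor at the same point, and conversely. Hence the conjugate of the southern
  approximation with targets and sources exchanged.\<close>

lemma LDR_north_entry:
  "(LDR M (L_beta_north d b t) (D_beta_north d \<xi> \<eta> b) (R_beta_north d b s) l j +
    LDR M (L_north d t) (D_north d \<xi> \<eta> b) (R_north d s) l j) $ p $ q =
   cnj (\<Sum>m\<in>{- M..M}. south_entry d \<xi> \<eta> b (s j) (t l) m $ p $ q)"
proof -
  have "L_beta_north d b t = (\<lambda>l m. cscale (cnj (south_right b d (t l) m)) (mat 1))"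
    "R_beta_north d b s = (\<lambda>m j. cscale (cnj (south_left b d (s j) m)) (mat 1))"
    "L_north d t = (\<lambda>l m. cscale (cnj (south_right 0 d (t l) m)) (mat 1))"
    "R_north d s = (\<lambda>m j. cscale (cnj (south_left 0 d (s j) m)) (mat 1))"
    by (simp_all add: L_beta_north_def R_beta_north_def L_north_def R_north_def south_left_def south_right_def chi_eq_freq exp_cnj)
  then show ?thesis
    by (simp add: D_beta_north_def D_north_def LDR_scalar_entry south_entry_def sum.distrib mat_cnj_def mult_ac)
qed

lemma unit_cell_component_2:
  assumes "\<eta> > 0" "t \<in> unit_cell d \<xi> \<eta>" "s \<in> unit_cell d \<xi> \<eta>"
  shows "\<bar>t $ 2 - s $ 2\<bar> \<le> \<eta>"
proof -
  have "\<bar>u $ 2\<bar> \<le> \<eta> / 2" if u_cell: "u \<in> unit_cell d \<xi> \<eta>" for u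
  proof -
    obtain x' x where u: "u = x' *\<^sub>R e1 d + x *\<^sub>R e2 \<xi> \<eta>" and x: "x \<in> {- 1 / 2..1 / 2}"
      using u_cell unfolding unit_cell_def by blast
    have u2: "u $ 2 = x * \<eta>" by (simp add: u e1_def e2_def)
    have "\<bar>x\<bar> * \<eta> \<le> 1 / 2 * \<eta>" using x assms by (intro mult_right_mono) auto
    then show ?thesis using assms by (simp add: u2 abs_mult)
  qed
  from this[OF assms(2)] this[OF assms(3)] show ?thesis by linarith
qed

theorem theorem6:
  fixes d \<xi> \<eta> \<beta> :: real
  assumes "d > 0" and "\<eta> > 0" and "d \<ge> sqrt (\<xi>\<^sup>2 + \<eta>\<^sup>2)" and "\<beta> > 0"
  shows "\<exists>C::real. \<forall>(\<epsilon>::real) (N\<^sub>T::nat) (N\<^sub>S::nat) (t :: nat \<Rightarrow> real^2) (s :: nat \<Rightarrow> real^2).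
    0 < \<epsilon> \<longrightarrow> \<epsilon> < 1 \<longrightarrow>
    (\<forall>l\<in>{1..N\<^sub>T}. t l \<in> unit_cell d \<xi> \<eta>) \<longrightarrow> (\<forall>j\<in>{1..N\<^sub>S}. s j \<in> unit_cell d \<xi> \<eta>) \<longrightarrow>
    (let M = trunc_M d \<eta> \<epsilon> in
      (\<exists>E. entries_bounded {1..N\<^sub>T} {1..N\<^sub>S} (C * \<epsilon>) E \<and>
        (\<forall>l\<in>{1..N\<^sub>T}. \<forall>j\<in>{1..N\<^sub>S}.
          P2_south d \<xi> \<eta> \<beta> t s l j =
            LDR M (L_beta_south d \<beta> t) (D_beta_south d \<xi> \<eta> \<beta>) (R_beta_south d \<beta> s) l j +
            LDR M (L_south d t) (D_south d \<xi> \<eta> \<beta>) (R_south d s) l j + E l j)) \<and>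
      (\<exists>E. entries_bounded {1..N\<^sub>T} {1..N\<^sub>S} (C * \<epsilon>) E \<and>
        (\<forall>l\<in>{1..N\<^sub>T}. \<forall>j\<in>{1..N\<^sub>S}.
          P2_north d \<xi> \<eta> \<beta> t s l j =
            LDR M (L_beta_north d \<beta> t) (D_beta_north d \<xi> \<eta> \<beta>) (R_beta_north d \<beta> s) l j +
            LDR M (L_north d t) (D_north d \<xi> \<eta> \<beta>) (R_north d s) l j + E l j)))"
proof -
  obtain C where C: "\<And>\<epsilon> t s p q. 0 < \<epsilon> \<Longrightarrow> \<epsilon> < 1 \<Longrightarrow> \<bar>t $ 2 - s $ 2\<bar> \<le> \<eta> \<Longrightarrow>
    norm (of_real (K2_south d \<xi> \<eta> \<beta> t s $ p $ q) -
      (\<Sum>m\<in>{- trunc_M d \<eta> \<epsilon>..trunc_M d \<eta> \<epsilon>}. south_entry d \<xi> \<eta> \<beta> t s m $ p $ q)) \<le> C * \<epsilon>"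
    using K2_south_approx[OF assms(4,1,2)] by meson
  show ?thesis
    unfolding Let_def
  proof (intro exI[of _ C] allI impI conjI)
    fix \<epsilon> :: real and N\<^sub>T N\<^sub>S :: nat and t s :: "nat \<Rightarrow> real^2"
    assume \<epsilon>: "0 < \<epsilon>" "\<epsilon> < 1" and cell: "\<forall>l\<in>{1..N\<^sub>T}. t l \<in> unit_cell d \<xi> \<eta>" "\<forall>j\<in>{1..N\<^sub>S}. s j \<in> unit_cell d \<xi> \<eta>"
    have dy: "\<bar>t l $ 2 - s j $ 2\<bar> \<le> \<eta>" "\<bar>s j $ 2 - t l $ 2\<bar> \<le> \<eta>" if "l \<in> {1..N\<^sub>T}" "j \<in> {1..N\<^sub>S}" for l j
      using unit_cell_component_2[OF assms(2)] cell that by blast+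
    let ?M = "trunc_M d \<eta> \<epsilon>"
    let ?S = "\<lambda>l j. LDR ?M (L_beta_south d \<beta> t) (D_beta_south d \<xi> \<eta> \<beta>) (R_beta_south d \<beta> s) l j +
            LDR ?M (L_south d t) (D_south d \<xi> \<eta> \<beta>) (R_south d s) l j"
    let ?N = "\<lambda>l j. LDR ?M (L_beta_north d \<beta> t) (D_beta_north d \<xi> \<eta> \<beta>) (R_beta_north d \<beta> s) l j +
            LDR ?M (L_north d t) (D_north d \<xi> \<eta> \<beta>) (R_north d s) l j"
    show "\<exists>E. entries_bounded {1..N\<^sub>T} {1..N\<^sub>S} (C * \<epsilon>) E \<and>
        (\<forall>l\<in>{1..N\<^sub>T}. \<forall>j\<in>{1..N\<^sub>S}. P2_south d \<xi> \<eta> \<beta> t s l j = ?S l j + E l j)"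
    proof (intro exI[of _ "\<lambda>l j. P2_south d \<xi> \<eta> \<beta> t s l j - ?S l j"] conjI ballI)
      show "entries_bounded {1..N\<^sub>T} {1..N\<^sub>S} (C * \<epsilon>) (\<lambda>l j. P2_south d \<xi> \<eta> \<beta> t s l j - ?S l j)"
        unfolding entries_bounded_def
      proof (intro ballI allI)
        fix l j p q assume "l \<in> {1..N\<^sub>T}" "j \<in> {1..N\<^sub>S}"
        from C[OF \<epsilon> dy(1)[OF this], of p q]
        show "cmod ((P2_south d \<xi> \<eta> \<beta> t s l j - ?S l j) $ p $ q) \<le> C * \<epsilon>"
          unfolding vector_minus_component LDR_south_entry P2_south_def mat_of_real_def by simp
      qed
    qed simp
    show "\<exists>E. entries_bounded {1..N\<^sub>T} {1..N\<^sub>S} (C * \<epsilon>) E \<and>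
        (\<forall>l\<in>{1..N\<^sub>T}. \<forall>j\<in>{1..N\<^sub>S}. P2_north d \<xi> \<eta> \<beta> t s l j = ?N l j + E l j)"
    proof (intro exI[of _ "\<lambda>l j. P2_north d \<xi> \<eta> \<beta> t s l j - ?N l j"] conjI ballI)
      show "entries_bounded {1..N\<^sub>T} {1..N\<^sub>S} (C * \<epsilon>) (\<lambda>l j. P2_north d \<xi> \<eta> \<beta> t s l j - ?N l j)"
        unfolding entries_bounded_def
      proof (intro ballI allI)
        fix l j p q assume lj: "l \<in> {1..N\<^sub>T}" "j \<in> {1..N\<^sub>S}"
        \<comment> \<open>The southern error with source and target exchanged. The kernel is real,
          so conjugating the approximation conjugates the whole error and preserves its
          modulus.\<close>
        let ?A = "of_real (K2_south d \<xi> \<eta> \<beta> (s j) (t l) $ p $ q) - (\<Sum>m\<in>{- ?M..?M}. south_entry d \<xi> \<eta> \<beta> (s j) (t l) m $ p $ q)"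
        have "(P2_north d \<xi> \<eta> \<beta> t s l j - ?N l j) $ p $ q = cnj ?A"
          unfolding vector_minus_component LDR_north_entry P2_north_def mat_of_real_def
            K2_north_eq_K2_south[OF assms(4,2) dy(1)[OF lj]] by simp
        then show "cmod ((P2_north d \<xi> \<eta> \<beta> t s l j - ?N l j) $ p $ q) \<le> C * \<epsilon>"
          using C[OF \<epsilon> dy(2)[OF lj], of p q] by (simp only: complex_mod_cnj)
      qed
    qed simp
  qed
qed

end
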